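(* Assume (C1)–(C3) and (C5). Then the sparse population B-spline approximation satisfies $$\|\tilde\theta-\theta^*\|_{L_2}\lesssim\sqrt s\,L_n^{-d}.$$
   Context: Model: $U\in[0,1]$ is an exposure variable, $Y\in\{0,1\}$ a label independent of $U$ with $\mathbb P(Y=1)=\mathbb P(Y=0)=1/2$, and $X\in\mathbb R^p$ satisfies, conditionally on $U=u$, $X\sim\mathcal N(\mu_1(u),\Sigma(u))$ if $Y=1$ and $X\sim\mathcal N(\mu_2(u),\Sigma(u))$ if $Y=0$. Write $\delta(u)=\mu_1(u)-\mu_2(u)$, $\mu(u)=(\mu_1(u)+\mu_2(u))/2$, $\beta^*(u)=\Sigma(u)^{-1}\delta(u)$. Let $Z=\mathbb 1(Y=1)-1/2$ and let $\theta^*(u)$ be the minimizer over $\theta\in\mathbb R^p$ of $\mathbb E[(Z-\theta^\top(X-\mu(U)))^2\mid U=u]$. Sparsity: $S=\{j:\mathbb E[\beta^*_j(U)^2]>0\}$, $s=|S|$ ($\theta^*$ has the same support). B-splines: $B^*(u)=(B^*_1(u),\dots,B^*_{L_n}(u))^\top$ is a normalized B-spline basis of fixed order on $[0,1]$ with quasi-uniform knots ($B_k^*\ge0$, $\sum_kB_k^*=1$) and $B(u)=\sqrt{L_n}B^*(u)$. For $v\in\mathbb R^{pL_n}$, $v_{(j)}\in\mathbb R^{L_n}$ is its $j$-th consecutive block and $v_{(S)}$ stacks the blocks with index in $S$; for a $pL_n\times pL_n$ matrix $A$, $A_{(ST)}$ is the corresponding block submatrix. Population quantities: $\tilde B(U)=(X-\mu(U))\otimes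 B(U)$, $D=\mathbb E[\tilde B\tilde B^\top]$, $b=\mathbb E[\tilde BZ]$; sparse approximation coefficient $\tilde\gamma$ with $\tilde\gamma_{(S)}=D_{(SS)}^{-1}b_{(S)}$ and $\tilde\gamma_{(S^c)}=0$; $\tilde\theta(u)=(\tilde\gamma_{(1)}^\top B(u),\dots,\tilde\gamma_{(p)}^\top B(u))^\top$. For $\nu,\xi:[0,1]\to\mathbb R^m$, $\|\nu-\xi\|_{L_2}=(\int_0^1\|\nu(u)-\xi(u)\|_2^2du)^{1/2}$. Asymptotics: $n\to\infty$, $p,s,L_n$ may depend on $n$, $L_n\to\infty$; $\lesssim$ hides constants independent of $n,p,s,L_n$. Conditions: (C1) there are constants $0<\lambda_0\le\lambda_1<\infty$ with $\lambda_0\le\lambda_{\min}(\Sigma(u))\le\lambda_{\max}(\Sigma(u))\le\lambda_1$ for all $u$. (C2) $U$ has a density $h$ with $0<D_1\le h(u)\le D_2<\infty$ on $[0,1]$. (C3) every coordinate of $\mu_1,\mu_2,\beta^*$ lies in $\mathcal W^d([0,1])=\{f:\sup_x|f^{(\ell)}(x)|\le D,\ \ell=0,\dots,t;\ |f^{(t)}(x)-f^{(t)}(x')|\le L|x-x'|^r\}$ with $d=r+t\ge1$ and fixed constants $D,L$. (C5) $\sup_u\max\{\|\delta(u)_S\|_2,\|\theta^*(u)\|_2\}=\delta_s\le M$ for a constant $M$, and $s=o(n^{(2d-1)/(4(d+1))})$.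
   Formalization: The fixed order of the B-splines is assumed to be at least d; without this the claimed rate fails (e.g. piecewise constant splines with d = 2 only give an error of order 1/L_n). Measurability of Σ(u) in u is also made explicit. *)

theory Defs
  imports "HOL-Analysis.Analysis" "HOL-Library.Landau_Symbols"
    "Jordan_Normal_Form.Char_Poly" "Jordan_Normal_Form.Gauss_Jordan_Elimination"
    "Jordan_Normal_Form.DL_Submatrix"
begin

definition holder_class :: "nat \<Rightarrow> real \<Rightarrow> real \<Rightarrow> real \<Rightarrow> (real \<Rightarrow> real) \<Rightarrow> bool" where
  "holder_class t r Dc Lc f \<longleftrightarrow>
     (\<exists>F :: nat \<Rightarrow> real \<Rightarrow> real. F 0 = f \<and>
        (\<forall>l<t. \<forall>x\<in>{0..1}. (F l has_real_derivative F (Suc l) x) (at x within {0..1})) \<and>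
        (\<forall>l\<le>t. \<forall>x\<in>{0..1}. \<bar>F l x\<bar> \<le> Dc) \<and>
        (\<forall>x\<in>{0..1}. \<forall>x'\<in>{0..1}. \<bar>F t x - F t x'\<bar> \<le> Lc * \<bar>x - x'\<bar> powr r))"

section \<open>Normalized B-splines (Cox--de Boor recursion)\<close>

text \<open>Order-k B-spline N_{i,k} for knot sequence tk; 0/0 = 0 convention.
  Order 1: indicator of [t_i, t_{i+1}), closed at the right end point 1.\<close>
fun bspl :: "(nat \<Rightarrow> real) \<Rightarrow> nat \<Rightarrow> nat \<Rightarrow> real \<Rightarrow> real" where
  "bspl tk i 0 x = 0"
| "bspl tk i (Suc 0) x =
     (if (tk i \<le> x \<and> x < tk (Suc i)) \<or> (x = 1 \<and> tk i < tk (Suc i) \<and> tk (Suc i) = 1) then 1 else 0)"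
| "bspl tk i (Suc (Suc k)) x =
     (x - tk i) / (tk (i + Suc k) - tk i) * bspl tk i (Suc k) x
     + (tk (i + Suc (Suc k)) - x) / (tk (i + Suc (Suc k)) - tk (Suc i)) * bspl tk (Suc i) (Suc k) x"

text \<open>Clamped knot sequence of order m with K interior breakpoints
  xi 1 < ... < xi K in (0,1), xi 0 = 0, xi (K+1) = 1.\<close>
definition knots :: "nat \<Rightarrow> nat \<Rightarrow> (nat \<Rightarrow> real) \<Rightarrow> nat \<Rightarrow> real" where
  "knots m K xi j = xi (min (K + 1) (j + 1 - m))"

text \<open>Quasi-uniform breakpoints for a basis of L functions of order m (K = L - m interior knots),
  with mesh ratio bounded by cq.\<close>
definition quasi_uniform :: "nat \<Rightarrow> nat \<Rightarrow> real \<Rightarrow> (nat \<Rightarrow> real) \<Rightarrow> bool" where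
  "quasi_uniform m L cq xi \<longleftrightarrow> m \<le> L \<and> xi 0 = 0 \<and> xi (L - m + 1) = 1 \<and>
     (\<forall>i\<le>L - m. xi i < xi (Suc i)) \<and>
     (\<forall>i\<le>L - m. \<forall>j\<le>L - m. xi (Suc i) - xi i \<le> cq * (xi (Suc j) - xi j))"

definition Bstar :: "nat \<Rightarrow> nat \<Rightarrow> (nat \<Rightarrow> real) \<Rightarrow> nat \<Rightarrow> real \<Rightarrow> real" where
  "Bstar m L xi k u = bspl (knots m (L - m) xi) k m u"

definition Bsc :: "nat \<Rightarrow> nat \<Rightarrow> (nat \<Rightarrow> real) \<Rightarrow> nat \<Rightarrow> real \<Rightarrow> real" where
  "Bsc m L xi k u = sqrt (real L) * Bstar m L xi k u"

definition mvn_density :: "nat \<Rightarrow> real vec \<Rightarrow> real mat \<Rightarrow> (nat \<Rightarrow> real) \<Rightarrow> real" where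
  "mvn_density p mu S x =
     (let v = vec p x - mu in
        exp (- (v \<bullet> (the (mat_inverse S) *\<^sub>v v)) / 2) / sqrt ((2 * pi) ^ p * det S))"

definition Zlab :: "bool \<Rightarrow> real" where
  "Zlab y = (if y then 1 else 0) - 1/2"

text \<open>E[ f(Y,X) | U = u ]: Y ~ Bernoulli(1/2) independent of U (True means Y = 1),
  X | (U=u, Y=1) ~ N(mu1 u, Sigma u), X | (U=u, Y=0) ~ N(mu2 u, Sigma u).\<close>
definition cond_exp :: "nat \<Rightarrow> real vec \<Rightarrow> real vec \<Rightarrow> real mat \<Rightarrow> (bool \<Rightarrow> real vec \<Rightarrow> real) \<Rightarrow> real" where
  "cond_exp p m1 m2 S f =
     1/2 * (\<integral>x. f True (vec p x) * mvn_density p m1 S x \<partial>(PiM {..<p} (\<lambda>_. lborel)))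
   + 1/2 * (\<integral>x. f False (vec p x) * mvn_density p m2 S x \<partial>(PiM {..<p} (\<lambda>_. lborel)))"

definition pop_exp :: "nat \<Rightarrow> (real \<Rightarrow> real) \<Rightarrow> (real \<Rightarrow> real vec) \<Rightarrow> (real \<Rightarrow> real vec)
    \<Rightarrow> (real \<Rightarrow> real mat) \<Rightarrow> (real \<Rightarrow> bool \<Rightarrow> real vec \<Rightarrow> real) \<Rightarrow> real" where
  "pop_exp p h mu1 mu2 Sig g =
     (\<integral>u. indicator {0..1} u * h u * cond_exp p (mu1 u) (mu2 u) (Sig u) (g u) \<partial>lborel)"

definition midpt :: "(real \<Rightarrow> real vec) \<Rightarrow> (real \<Rightarrow> real vec) \<Rightarrow> real \<Rightarrow> real vec" where
  "midpt mu1 mu2 u = (1/2) \<cdot>\<^sub>v (mu1 u + mu2 u)"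

definition betastar :: "(real \<Rightarrow> real vec) \<Rightarrow> (real \<Rightarrow> real vec) \<Rightarrow> (real \<Rightarrow> real mat) \<Rightarrow> real \<Rightarrow> real vec" where
  "betastar mu1 mu2 Sig u = the (mat_inverse (Sig u)) *\<^sub>v (mu1 u - mu2 u)"

definition supp :: "nat \<Rightarrow> (real \<Rightarrow> real) \<Rightarrow> (real \<Rightarrow> real vec) \<Rightarrow> (real \<Rightarrow> real vec)
    \<Rightarrow> (real \<Rightarrow> real mat) \<Rightarrow> nat set" where
  "supp p h mu1 mu2 Sig =
     {j. j < p \<and> (\<integral>u. indicator {0..1} u * h u * (betastar mu1 mu2 Sig u $ j)^2 \<partial>lborel) > 0}"

text \<open>Btilde(U) = (X - mu(U)) (x) B(U); component i = j*L + k (block j, spline k).\<close>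
definition Btil :: "nat \<Rightarrow> nat \<Rightarrow> (nat \<Rightarrow> real) \<Rightarrow> (real \<Rightarrow> real vec) \<Rightarrow> (real \<Rightarrow> real vec)
    \<Rightarrow> nat \<Rightarrow> real \<Rightarrow> real vec \<Rightarrow> real" where
  "Btil m L xi mu1 mu2 i u x =
     (x $ (i div L) - midpt mu1 mu2 u $ (i div L)) * Bsc m L xi (i mod L) u"

definition Dmat :: "nat \<Rightarrow> nat \<Rightarrow> nat \<Rightarrow> (nat \<Rightarrow> real) \<Rightarrow> (real \<Rightarrow> real) \<Rightarrow> (real \<Rightarrow> real vec)
    \<Rightarrow> (real \<Rightarrow> real vec) \<Rightarrow> (real \<Rightarrow> real mat) \<Rightarrow> real mat" where
  "Dmat p m L xi h mu1 mu2 Sig = mat (p * L) (p * L) (\<lambda>(i, i').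
     pop_exp p h mu1 mu2 Sig (\<lambda>u y x. Btil m L xi mu1 mu2 i u x * Btil m L xi mu1 mu2 i' u x))"

definition bvec :: "nat \<Rightarrow> nat \<Rightarrow> nat \<Rightarrow> (nat \<Rightarrow> real) \<Rightarrow> (real \<Rightarrow> real) \<Rightarrow> (real \<Rightarrow> real vec)
    \<Rightarrow> (real \<Rightarrow> real vec) \<Rightarrow> (real \<Rightarrow> real mat) \<Rightarrow> real vec" where
  "bvec p m L xi h mu1 mu2 Sig = vec (p * L) (\<lambda>i.
     pop_exp p h mu1 mu2 Sig (\<lambda>u y x. Btil m L xi mu1 mu2 i u x * Zlab y))"

definition gamma_tilde :: "nat \<Rightarrow> nat \<Rightarrow> nat \<Rightarrow> (nat \<Rightarrow> real) \<Rightarrow> (real \<Rightarrow> real) \<Rightarrow> (real \<Rightarrow> real vec)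
    \<Rightarrow> (real \<Rightarrow> real vec) \<Rightarrow> (real \<Rightarrow> real mat) \<Rightarrow> real vec" where
  "gamma_tilde p m L xi h mu1 mu2 Sig =
     (let S = supp p h mu1 mu2 Sig;
          IS = {i. i < p * L \<and> i div L \<in> S};
          D = Dmat p m L xi h mu1 mu2 Sig;
          b = bvec p m L xi h mu1 mu2 Sig;
          gS = the (mat_inverse (submatrix D IS IS)) *\<^sub>v vec (card IS) (\<lambda>k. b $ pick IS k)
      in vec (p * L) (\<lambda>i. if i \<in> IS then gS $ card {i' \<in> IS. i' < i} else 0))"

definition theta_tilde :: "nat \<Rightarrow> nat \<Rightarrow> nat \<Rightarrow> (nat \<Rightarrow> real) \<Rightarrow> (real \<Rightarrow> real) \<Rightarrow> (real \<Rightarrow> real vec)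
    \<Rightarrow> (real \<Rightarrow> real vec) \<Rightarrow> (real \<Rightarrow> real mat) \<Rightarrow> real \<Rightarrow> real vec" where
  "theta_tilde p m L xi h mu1 mu2 Sig u =
     (let g = gamma_tilde p m L xi h mu1 mu2 Sig
      in vec p (\<lambda>j. \<Sum>k<L. g $ (j * L + k) * Bsc m L xi k u))"

definition L2dist :: "(real \<Rightarrow> real vec) \<Rightarrow> (real \<Rightarrow> real vec) \<Rightarrow> real" where
  "L2dist f g = sqrt (\<integral>u. indicator {0..1} u * ((f u - g u) \<bullet> (f u - g u)) \<partial>lborel)"

definition model_conditions ::
  "nat \<Rightarrow> nat \<Rightarrow> real \<Rightarrow> real \<Rightarrow> real \<Rightarrow> real \<Rightarrow> real \<Rightarrow> real \<Rightarrow> real \<Rightarrow> real \<Rightarrow> real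
   \<Rightarrow> nat \<Rightarrow> nat \<Rightarrow> (nat \<Rightarrow> real) \<Rightarrow> (real \<Rightarrow> real) \<Rightarrow> (real \<Rightarrow> real vec) \<Rightarrow> (real \<Rightarrow> real vec)
   \<Rightarrow> (real \<Rightarrow> real mat) \<Rightarrow> (real \<Rightarrow> real vec) \<Rightarrow> bool" where
  "model_conditions m t r lam0 lam1 D1 D2 Dc Lc M cq p L xi h mu1 mu2 Sig ths \<longleftrightarrow>
     \<comment> \<open>B-spline basis: order m, L functions, quasi-uniform knots\<close>
     quasi_uniform m L cq xi \<and>
     \<comment> \<open>dimensions\<close>
     (\<forall>u\<in>{0..1}. mu1 u \<in> carrier_vec p \<and> mu2 u \<in> carrier_vec p \<and> Sig u \<in> carrier_mat p p
        \<and> ths u \<in> carrier_vec p) \<and>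
     \<comment> \<open>(C1): Sigma(u) a covariance (symmetric) matrix with spectrum in [lambda0, lambda1]\<close>
     (\<forall>u\<in>{0..1}. transpose_mat (Sig u) = Sig u \<and>
        (\<forall>k. eigenvalue (Sig u) k \<longrightarrow> lam0 \<le> k \<and> k \<le> lam1)) \<and>
     (\<forall>i<p. \<forall>j<p. (\<lambda>u. indicator {0..1} u * (Sig u $$ (i, j))) \<in> borel_measurable lborel) \<and>
     \<comment> \<open>(C2): U has density h on [0,1], bounded between D1 and D2\<close>
     (\<lambda>u. indicator {0..1} u * h u) \<in> borel_measurable lborel \<and>
     (\<integral>u. indicator {0..1} u * h u \<partial>lborel) = 1 \<and>
     (\<forall>u\<in>{0..1}. D1 \<le> h u \<and> h u \<le> D2) \<and>
     \<comment> \<open>(C3): coordinates of mu1, mu2, beta* in W^d, d = r + t\<close>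
     (\<forall>j<p. holder_class t r Dc Lc (\<lambda>u. mu1 u $ j) \<and> holder_class t r Dc Lc (\<lambda>u. mu2 u $ j)
        \<and> holder_class t r Dc Lc (\<lambda>u. betastar mu1 mu2 Sig u $ j)) \<and>
     \<comment> \<open>theta*(u) minimizes E[(Z - theta^T (X - mu(U)))^2 | U = u]\<close>
     (\<forall>u\<in>{0..1}. \<forall>\<theta>\<in>carrier_vec p.
        cond_exp p (mu1 u) (mu2 u) (Sig u) (\<lambda>y x. (Zlab y - ths u \<bullet> (x - midpt mu1 mu2 u))^2)
        \<le> cond_exp p (mu1 u) (mu2 u) (Sig u) (\<lambda>y x. (Zlab y - \<theta> \<bullet> (x - midpt mu1 mu2 u))^2)) \<and>
     \<comment> \<open>(C5), first part: sup_u max(||delta(u)_S||_2, ||theta*(u)||_2) <= M\<close>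
     (\<forall>u\<in>{0..1}.
        sqrt (\<Sum>j\<in>supp p h mu1 mu2 Sig. (mu1 u $ j - mu2 u $ j)^2) \<le> M \<and>
        sqrt (ths u \<bullet> ths u) \<le> M)"

end

theory Submission
  imports Defs "HOL-Probability.Distributions"
begin

text \<open>
  The coefficient \<open>\<gamma>\<close> of the sparse approximation solves the normal equations, so the approximation is the
  projection of \<open>\<theta>\<^sup>*\<close> onto the splines with support \<open>S\<close> in the energy
  \<open>\<integral> h v\<^sup>T (\<Sigma> + \<delta>\<delta>\<^sup>T/4) v\<close>. On functions supported in \<open>S\<close> this energy is equivalent to the \<open>L\<^sub>2\<close> norm, hence the
  error is a constant times the best spline approximation error of \<open>\<theta>\<^sup>*\<close>. By Sherman--Morrison
  \<open>\<theta>\<^sup>* = \<beta> / (4 + \<delta>\<^sup>T\<beta>)\<close>.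

  The rate \<open>\<surd>s L^(-d)\<close> needs care because derivatives of \<open>\<delta>\<^sup>T\<beta>\<close> could grow with \<open>s\<close>. Both \<open>\<beta>\<close> and \<open>\<delta>\<close> are bounded in
  \<open>\<ell>\<^sub>2\<close> and within \<open>\<surd>s |x - a|^d\<close> of their Taylor polynomials at \<open>a\<close>; interpolating these two facts at the length scale
  \<open>H = s powr (-1/(2d))\<close> bounds the \<open>k\<close>-th Taylor coefficient in \<open>\<ell>\<^sub>2\<close> by a multiple of \<open>H^(-k)\<close>. In the variable
  \<open>(x - a)/H\<close> all coefficients are therefore bounded, and formal division gives a polynomial within
  \<open>(|x - a|/H)^d = \<surd>s |x - a|^d\<close> of \<open>\<theta>\<^sup>*\<close>. A local quasi-interpolant obtained from Marsden's identity turns this into a spline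
  estimate when the mesh is finer than \<open>H\<close>; on coarser meshes the zero spline is already accurate enough.
\<close>

section \<open>Polynomials\<close>

lemma injective_square_system_invertible:
  fixes G :: "nat \<Rightarrow> nat \<Rightarrow> real"
  assumes inj: "\<forall>c. (\<forall>a<m. (\<Sum>j<m. G a j * c j) = 0) \<longrightarrow> (\<forall>j<m. c j = 0)"
  obtains W where "\<And>i j. i < m \<Longrightarrow> j < m \<Longrightarrow> (\<Sum>a<m. W i a * G a j) = (if i = j then 1 else 0)"
    and "\<And>i j. i < m \<Longrightarrow> j < m \<Longrightarrow> (\<Sum>a<m. G i a * W a j) = (if i = j then 1 else 0)"
proof -
  define A where "A = mat m m (\<lambda>(a, j). G a j)"
  have A: "A \<in> carrier_mat m m" by (simp add: A_def)
  have "det A \<noteq> 0"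
  proof
    assume "det A = 0"
    then obtain v where v: "v \<in> carrier_vec m" "v \<noteq> 0\<^sub>v m" "A *\<^sub>v v = 0\<^sub>v m"
      using det_0_iff_vec_prod_zero[OF A] by blast
    have "(\<Sum>j<m. G a j * v $ j) = 0" if "a < m" for a
    proof -
      have "(A *\<^sub>v v) $ a = (\<Sum>j<m. G a j * v $ j)"
        using that v(1) by (simp add: A_def scalar_prod_def lessThan_atLeast0)
      then show ?thesis using v(3) that by simp
    qed
    then have "\<forall>j<m. v $ j = 0" using inj[rule_format, of "\<lambda>j. v $ j"] by simp
    then have "v = 0\<^sub>v m" using v(1) by (intro eq_vecI) auto
    with v(2) show False ..
  qed
  then have "A \<in> Units (ring_mat TYPE(real) m ())" by (rule det_non_zero_imp_unit[OF A])
  then obtain B where "mat_inverse A = Some B" using mat_inverse(1)[OF A, of "()"] by (cases "mat_inverse A") auto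
  from mat_inverse(2)[OF A this] have B: "A * B = 1\<^sub>m m" "B * A = 1\<^sub>m m" "B \<in> carrier_mat m m" by auto
  show thesis
  proof
    fix i j assume ij: "i < m" "j < m"
    have "(B * A) $$ (i,j) = (\<Sum>a<m. B $$ (i,a) * G a j)"
      using ij B(3) by (simp add: A_def scalar_prod_def lessThan_atLeast0)
    then show "(\<Sum>a<m. B $$ (i,a) * G a j) = (if i = j then 1 else 0)" using B ij by simp
    have "(A * B) $$ (i,j) = (\<Sum>a<m. G i a * B $$ (a,j))"
      using ij B(3) by (simp add: A_def scalar_prod_def lessThan_atLeast0)
    then show "(\<Sum>a<m. G i a * B $$ (a,j)) = (if i = j then 1 else 0)" using B ij by simp
  qed
qed

lemma polyfun_many_zeros:
  fixes c :: "nat \<Rightarrow> real"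
  assumes "\<And>x. x \<in> X \<Longrightarrow> (\<Sum>i<m. c i * x^i) = 0" and "infinite X \<or> m \<le> card X" and "j < m"
  shows "c j = 0"
proof (rule ccontr)
  assume nz: "c j \<noteq> 0"
  obtain n where n: "m = Suc n" using \<open>j < m\<close> by (cases m) auto
  let ?Z = "{z. (\<Sum>i\<le>n. c i * z^i) = 0}"
  have "\<exists>k\<le>n. c k \<noteq> 0" using nz \<open>j < m\<close> n by (intro exI[of _ j]) simp
  from polyfun_rootbound[OF this] have fin: "finite ?Z" and card: "card ?Z \<le> n" by auto
  have "X \<subseteq> ?Z" using assms(1) n by (auto simp: lessThan_Suc_atMost)
  then have "finite X" "card X \<le> n" using fin card by (auto intro: finite_subset order_trans[OF card_mono])
  then show False using assms(2) n by auto
qed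

lemma coefficient_functionals:
  fixes x :: "nat \<Rightarrow> real"
  assumes "inj_on x {..<m}"
  obtains W where "\<And>c k. k < m \<Longrightarrow> c k = (\<Sum>a<m. W k a * (\<Sum>j<m. c j * x a ^ j))"
proof -
  have "c j = 0" if "\<And>a. a < m \<Longrightarrow> (\<Sum>j<m. x a ^ j * c j) = 0" "j < m" for c j
  proof (rule polyfun_many_zeros[where X = "x ` {..<m}", OF _ _ that(2)])
    show "\<And>y. y \<in> x ` {..<m} \<Longrightarrow> (\<Sum>i<m. c i * y^i) = 0" using that(1) by (auto simp: mult.commute)
    show "infinite (x ` {..<m}) \<or> m \<le> card (x ` {..<m})" by (simp add: card_image assms)
  qed
  then have "\<forall>c. (\<forall>a<m. (\<Sum>j<m. x a ^ j * c j) = 0) \<longrightarrow> (\<forall>j<m. c j = 0)" by blast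
  from injective_square_system_invertible[OF this]
  obtain W where W: "\<And>i j. i < m \<Longrightarrow> j < m \<Longrightarrow> (\<Sum>a<m. W i a * x a ^ j) = (if i = j then 1 else 0)" by metis
  show thesis
  proof
    fix c :: "nat \<Rightarrow> real" and k assume k: "k < m"
    have "(\<Sum>a<m. W k a * (\<Sum>j<m. c j * x a ^ j)) = (\<Sum>a<m. \<Sum>j<m. c j * (W k a * x a ^ j))"
      by (simp add: sum_distrib_left algebra_simps)
    also have "\<dots> = (\<Sum>j<m. c j * (\<Sum>a<m. W k a * x a ^ j))"
      by (subst sum.swap) (simp add: sum_distrib_left)
    also have "\<dots> = (\<Sum>j<m. if j = k then c j else 0)"
      using W[OF k] by (intro sum.cong) auto
    finally show "c k = (\<Sum>a<m. W k a * (\<Sum>j<m. c j * x a ^ j))" using k by simp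
  qed
qed

lemma prod_linear_coefficients_bounded:
  fixes Z :: real
  assumes "finite R" "0 \<le> Z"
  shows "\<exists>C\<ge>0. \<forall>z. (\<forall>r\<in>R. \<bar>z r\<bar> \<le> Z) \<longrightarrow>
    (\<exists>e. (\<forall>k. \<bar>e k\<bar> \<le> C) \<and> (\<forall>y::real. (\<Prod>r\<in>R. y - z r) = (\<Sum>k\<le>card R. e k * y^k)))"
  using assms
proof (induction R rule: finite_induct)
  case empty
  show ?case by (intro exI[of _ 1]) (auto intro!: exI[of _ "\<lambda>_. 1"])
next
  case (insert r R)
  then obtain C where C: "C \<ge> 0" "\<And>z. (\<forall>r\<in>R. \<bar>z r\<bar> \<le> Z) \<Longrightarrow>
    (\<exists>e. (\<forall>k. \<bar>e k\<bar> \<le> C) \<and> (\<forall>y::real. (\<Prod>r\<in>R. y - z r) = (\<Sum>k\<le>card R. e k * y^k)))" by blast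
  show ?case
  proof (intro exI[of _ "C + Z * C"] conjI allI impI)
    show "0 \<le> C + Z * C" using C \<open>0 \<le> Z\<close> by simp
    fix z :: "'a \<Rightarrow> real" assume z: "\<forall>r\<in>insert r R. \<bar>z r\<bar> \<le> Z"
    then obtain e where e: "\<And>k. \<bar>e k\<bar> \<le> C" "\<And>y::real. (\<Prod>r\<in>R. y - z r) = (\<Sum>k\<le>card R. e k * y^k)"
      using C(2)[of z] by auto
    define n where "n = card R"
    define e' where "e' k = (if k = 0 then 0 else e (k-1)) - z r * (if k \<le> n then e k else 0)" for k
    have "\<bar>e' k\<bar> \<le> C + Z * C" for k
    proof -
      have "\<bar>e' k\<bar> \<le> \<bar>if k = 0 then 0 else e (k-1)\<bar> + \<bar>z r\<bar> * \<bar>if k \<le> n then e k else 0\<bar>"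
        unfolding e'_def abs_mult[symmetric] by (rule abs_triangle_ineq4)
      also have "\<dots> \<le> C + Z * C"
        using e(1) C(1) z \<open>0 \<le> Z\<close> by (intro add_mono mult_mono) auto
      finally show ?thesis .
    qed
    moreover have "(\<Prod>r\<in>insert r R. y - z r) = (\<Sum>k\<le>card (insert r R). e' k * y^k)" for y
    proof -
      have "(\<Sum>k\<le>card (insert r R). e' k * y^k) =
        (\<Sum>k\<le>Suc n. (if k = 0 then 0 else e (k-1)) * y^k) - z r * (\<Sum>k\<le>Suc n. (if k \<le> n then e k else 0) * y^k)"
        using insert.hyps by (simp add: n_def e'_def left_diff_distrib sum_subtractf sum_distrib_left algebra_simps del: sum.atMost_Suc)
      also have "(\<Sum>k\<le>Suc n. (if k = 0 then 0 else e (k-1)) * y^k) = y * (\<Sum>k\<le>n. e k * y^k)"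
        by (simp only: sum.atMost_Suc_shift) (simp add: sum_distrib_left algebra_simps)
      also have "(\<Sum>k\<le>Suc n. (if k \<le> n then e k else 0) * y^k) = (\<Sum>k\<le>n. e k * y^k)" by simp
      finally show ?thesis using insert.hyps e(2) by (simp add: n_def algebra_simps)
    qed
    ultimately show "\<exists>e. (\<forall>k. \<bar>e k\<bar> \<le> C + Z * C) \<and> (\<forall>y. (\<Prod>r\<in>insert r R. y - z r) = (\<Sum>k\<le>card (insert r R). e k * y ^ k))" by blast
  qed
qed

lemma shifted_power_expansion:
  fixes x y :: real
  assumes "1 \<le> m"
  shows "(y - x)^(m-1) = (\<Sum>j<m. (real ((m-1) choose j) * (-1)^j * y^(m-1-j)) * x^j)"
proof -
  have "(y - x)^(m-1) = ((- x) + y)^(m-1)" by simp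
  also have "\<dots> = (\<Sum>j\<le>m-1. real ((m-1) choose j) * (-x)^j * y^(m-1-j))" by (rule binomial_ring)
  also have "\<dots> = (\<Sum>j<m. (real ((m-1) choose j) * (-1)^j * y^(m-1-j)) * x^j)"
    using \<open>1 \<le> m\<close> by (intro sum.cong) (auto simp: power_minus[of x] algebra_simps)
  finally show ?thesis .
qed

lemma monomial_as_shifted_powers:
  assumes "1 \<le> m"
  obtains \<alpha> where "\<And>k y. k < m \<Longrightarrow> (y::real)^k = (\<Sum>a<m. \<alpha> k a * (y - real a)^(m-1))"
proof -
  obtain W where W: "\<And>c k. k < m \<Longrightarrow> c k = (\<Sum>a<m. W k a * (\<Sum>j<m. c j * real a ^ j))"
    using coefficient_functionals[of real m] by (auto simp: inj_on_def)
  show thesis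
  proof (rule that[of "\<lambda>k a. W (m-1-k) a / (real ((m-1) choose (m-1-k)) * (-1)^(m-1-k))"])
    fix k and y :: real assume k: "k < m"
    define l where "l = m - 1 - k"
    have l: "l < m" "m - 1 - l = k" using k by (auto simp: l_def)
    define b where "b j = real ((m-1) choose j) * (-1)^j" for j
    have bn: "b l \<noteq> 0" using l by (simp add: b_def)
    have exp: "(y - x)^(m-1) = (\<Sum>j<m. (b j * y^(m-1-j)) * x^j)" for x
      unfolding b_def by (rule shifted_power_expansion[OF assms])
    have "b l * y^k = (\<Sum>a<m. W l a * (y - real a)^(m-1))"
      using W[OF l(1), of "\<lambda>j. b j * y^(m-1-j)"] unfolding exp l(2) .
    then have "y^k = (\<Sum>a<m. W l a * (y - real a)^(m-1)) / b l" using bn by (simp add: field_simps)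
    then show "y^k = (\<Sum>a<m. W (m-1-k) a / (real ((m-1) choose (m-1-k)) * (-1)^(m-1-k)) * (y - real a)^(m-1))"
      by (simp add: sum_divide_distrib b_def l_def)
  qed
qed

text \<open>In Marsden's identity the coefficient of a B-spline is a product of linear factors. The weights write it as a
  combination of point evaluations of \<open>x \<mapsto> (y - x)^(m-1)\<close>, with \<open>z r\<close> the knots rescaled to \<open>[0, m]\<close>.\<close>
lemma dual_weights_bounded:
  assumes "1 \<le> m"
  shows "\<exists>C\<ge>0. \<forall>z. (\<forall>r\<in>{1..<m}. \<bar>z r\<bar> \<le> real m) \<longrightarrow>
    (\<exists>w. (\<forall>a<m. \<bar>w a\<bar> \<le> C) \<and> (\<forall>y::real. (\<Prod>r\<in>{1..<m}. y - z r) = (\<Sum>a<m. w a * (y - real a)^(m-1))))"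
proof -
  obtain \<alpha> where \<alpha>: "\<And>k y. k < m \<Longrightarrow> (y::real)^k = (\<Sum>a<m. \<alpha> k a * (y - real a)^(m-1))"
    using monomial_as_shifted_powers[OF assms] by blast
  obtain C where C: "C \<ge> 0" "\<And>z. (\<forall>r\<in>{1..<m}. \<bar>z r\<bar> \<le> real m) \<Longrightarrow>
    (\<exists>e. (\<forall>k. \<bar>e k\<bar> \<le> C) \<and> (\<forall>y::real. (\<Prod>r\<in>{1..<m}. y - z r) = (\<Sum>k\<le>card {1..<m}. e k * y^k)))"
    using prod_linear_coefficients_bounded[of "{1..<m}" "real m"] by auto
  show ?thesis
  proof (intro exI[of _ "\<Sum>a<m. \<Sum>k<m. C * \<bar>\<alpha> k a\<bar>"] conjI allI impI)
    show "0 \<le> (\<Sum>a<m. \<Sum>k<m. C * \<bar>\<alpha> k a\<bar>)" using C by (intro sum_nonneg) auto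
    fix z :: "nat \<Rightarrow> real" assume "\<forall>r\<in>{1..<m}. \<bar>z r\<bar> \<le> real m"
    then obtain e where e: "\<And>k. \<bar>e k\<bar> \<le> C" "\<And>y::real. (\<Prod>r\<in>{1..<m}. y - z r) = (\<Sum>k\<le>card {1..<m}. e k * y^k)"
      using C(2) by blast
    define w where "w a = (\<Sum>k<m. e k * \<alpha> k a)" for a
    have "\<bar>w a\<bar> \<le> (\<Sum>a<m. \<Sum>k<m. C * \<bar>\<alpha> k a\<bar>)" if "a < m" for a
    proof -
      have "\<bar>w a\<bar> \<le> (\<Sum>k<m. C * \<bar>\<alpha> k a\<bar>)" unfolding w_def
        using e(1) by (intro order_trans[OF sum_abs] sum_mono) (auto simp: abs_mult intro: mult_right_mono)
      also have "\<dots> \<le> (\<Sum>a<m. \<Sum>k<m. C * \<bar>\<alpha> k a\<bar>)"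
        using that C by (intro member_le_sum) (auto intro!: sum_nonneg)
      finally show ?thesis .
    qed
    moreover have "(\<Prod>r\<in>{1..<m}. y - z r) = (\<Sum>a<m. w a * (y - real a)^(m-1))" for y
    proof -
      have "{..card {1..<m}} = {..<m}" using assms by auto
      then have "(\<Prod>r\<in>{1..<m}. y - z r) = (\<Sum>k<m. e k * (\<Sum>a<m. \<alpha> k a * (y - real a)^(m-1)))"
        using e(2)[of y] \<alpha> by simp
      also have "\<dots> = (\<Sum>a<m. w a * (y - real a)^(m-1))"
        unfolding w_def sum_distrib_left sum_distrib_right by (subst sum.swap) (simp add: algebra_simps)
      finally show ?thesis .
    qed
    ultimately show "\<exists>w. (\<forall>a<m. \<bar>w a\<bar> \<le> (\<Sum>a<m. \<Sum>k<m. C * \<bar>\<alpha> k a\<bar>)) \<and>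
      (\<forall>y::real. (\<Prod>r\<in>{1..<m}. y - z r) = (\<Sum>a<m. w a * (y - real a)^(m-1)))" by blast
  qed
qed

section \<open>B-splines\<close>

lemma bspl_support:
  assumes "mono tk" "bspl tk i k x \<noteq> 0"
  shows "tk i \<le> x \<and> x \<le> tk (i + k) \<and> tk i < tk (i + k)"
  using assms
proof (induction tk i k x rule: bspl.induct)
  case (3 tk i k x)
  then have "bspl tk i (Suc k) x \<noteq> 0 \<or> bspl tk (Suc i) (Suc k) x \<noteq> 0" by auto
  moreover have "tk (i + Suc k) \<le> tk (i + Suc (Suc k))" "tk i \<le> tk (Suc i)"
    using \<open>mono tk\<close> by (auto intro: monoD)
  ultimately show ?case using "3.IH" \<open>mono tk\<close> by fastforce
qed (auto split: if_splits)

lemma bspl_nonneg: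
  assumes "mono tk"
  shows "0 \<le> bspl tk i k x"
  using assms
proof (induction tk i k x rule: bspl.induct)
  case (3 tk i k x)
  have "0 \<le> (x - tk i) / (tk (i + Suc k) - tk i) * bspl tk i (Suc k) x"
    using 3 bspl_support[OF \<open>mono tk\<close>, of i "Suc k" x]
    by (cases "bspl tk i (Suc k) x = 0") auto
  moreover have "0 \<le> (tk (i + Suc (Suc k)) - x) / (tk (i + Suc (Suc k)) - tk (Suc i)) * bspl tk (Suc i) (Suc k) x"
    using 3 bspl_support[OF \<open>mono tk\<close>, of "Suc i" "Suc k" x]
    by (cases "bspl tk (Suc i) (Suc k) x = 0") auto
  ultimately show ?case by simp
qed auto

lemma bspl_measurable [measurable]: "bspl tk i k \<in> borel_measurable borel"
proof (induction tk i k "0::real" rule: bspl.induct)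
  case (1 tk i)
  have "bspl tk i 0 = (\<lambda>x. 0)" by auto
  then show ?case by simp
next
  case (2 tk i)
  have "bspl tk i (Suc 0) = (\<lambda>x. if (tk i \<le> x \<and> x < tk (Suc i)) \<or> (x = 1 \<and> tk i < tk (Suc i) \<and> tk (Suc i) = 1) then 1 else 0)"
    by auto
  then show ?case by simp
next
  case (3 tk i k)
  note 3[measurable]
  have "bspl tk i (Suc (Suc k)) = (\<lambda>x. (x - tk i) / (tk (i + Suc k) - tk i) * bspl tk i (Suc k) x
     + (tk (i + Suc (Suc k)) - x) / (tk (i + Suc (Suc k)) - tk (Suc i)) * bspl tk (Suc i) (Suc k) x)"
    by auto
  then show ?case by simp
qed

definition knot_ratio :: "(nat \<Rightarrow> real) \<Rightarrow> nat \<Rightarrow> real \<Rightarrow> nat \<Rightarrow> real" where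
  "knot_ratio tk k x i = (x - tk i) / (tk (i + k) - tk i)"

lemma bspl_step:
  assumes "mono tk" "1 \<le> k"
  shows "bspl tk i (Suc k) x = knot_ratio tk k x i * bspl tk i k x
    + (1 - knot_ratio tk k x (Suc i)) * bspl tk (Suc i) k x"
proof -
  obtain k' where k': "k = Suc k'" using \<open>1 \<le> k\<close> by (cases k) auto
  have "(tk (i + Suc k) - x) / (tk (i + Suc k) - tk (Suc i)) * bspl tk (Suc i) k x =
    (1 - knot_ratio tk k x (Suc i)) * bspl tk (Suc i) k x"
  proof (cases "bspl tk (Suc i) k x = 0")
    case False
    then have "tk (Suc i) < tk (Suc i + k)" using bspl_support[OF \<open>mono tk\<close>] by blast
    then show ?thesis by (simp add: knot_ratio_def field_simps)
  qed simp
  then show ?thesis using k' by (simp add: knot_ratio_def)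
qed

locale clamped_knots =
  fixes tk :: "nat \<Rightarrow> real" and m L :: nat
  assumes order_pos: "1 \<le> m" and order_le: "m \<le> L" and mono_knots: "mono tk"
    and knots_zero: "\<And>j. j < m \<Longrightarrow> tk j = 0" and knots_one: "\<And>j. L \<le> j \<Longrightarrow> tk j = 1"
    and knots_strict: "\<And>j. m - 1 \<le> j \<Longrightarrow> j < L \<Longrightarrow> tk j < tk (Suc j)"
begin

lemma knots_le: "i \<le> j \<Longrightarrow> tk i \<le> tk j"
  using mono_knots by (rule monoD)

lemma knots_range: "0 \<le> tk j" "tk j \<le> 1"
proof -
  show "0 \<le> tk j" using knots_le[of 0 j] knots_zero[of 0] order_pos by simp
  show "tk j \<le> 1" using knots_le[of j "max j L"] knots_one[of "max j L"] by simp
qed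

lemma support_width_pos:
  assumes "i < L"
  shows "tk i < tk (i + m)"
proof (cases "m - 1 \<le> i")
  case True
  then show ?thesis using knots_strict[of i] knots_le[of "Suc i" "i + m"] assms order_pos by linarith
next
  case False
  then show ?thesis
    using knots_strict[of "m - 1"] knots_le[of "Suc (m - 1)" "i + m"] knots_zero[of i] knots_zero[of "m - 1"]
      order_pos order_le by fastforce
qed

lemma order_one_delta:
  assumes "0 \<le> x" "x \<le> 1"
  obtains \<mu> where "\<mu> < L" "\<And>i. bspl tk i (Suc 0) x = (if i = \<mu> then 1 else 0)"
proof (cases "x = 1")
  case True
  have L: "tk (L - 1) < tk L" "0 < L" using knots_strict[of "L - 1"] order_pos order_le by auto
  have "(tk i < tk (Suc i) \<and> tk (Suc i) = 1) \<longleftrightarrow> i = L - 1" for i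
    using knots_le[of "Suc i" "L - 1"] knots_one[of i] knots_one[of L] L
    by (cases "i < L - 1"; cases "i = L - 1") auto
  then have "bspl tk i (Suc 0) x = (if i = L - 1 then 1 else 0)" for i
    using knots_range(2)[of "Suc i"] True by auto
  then show ?thesis using that[of "L - 1"] L by auto
next
  case False
  define \<nu> where "\<nu> = (LEAST j. x < tk j)"
  have ex: "x < tk L" using knots_one[of L] False assms by simp
  have \<nu>: "x < tk \<nu>" "\<nu> \<le> L" unfolding \<nu>_def using ex by (auto intro: LeastI Least_le)
  have "\<nu> \<noteq> 0" using \<nu> knots_zero[of 0] order_pos assms by (cases \<nu>) auto
  then obtain \<mu> where \<mu>: "\<nu> = Suc \<mu>" by (cases \<nu>) auto
  have "\<not> x < tk \<mu>" using not_less_Least[of \<mu> "\<lambda>j. x < tk j"] \<mu> \<nu>_def by simp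
  then have "(tk i \<le> x \<and> x < tk (Suc i)) \<longleftrightarrow> i = \<mu>" for i
    using \<nu> \<mu> knots_le[of "Suc i" \<mu>] knots_le[of "Suc \<mu>" i] by (cases "i < \<mu>"; cases "i = \<mu>") auto
  then have "bspl tk i (Suc 0) x = (if i = \<mu> then 1 else 0)" for i using False by auto
  then show ?thesis using that[of \<mu>] \<mu> \<nu> by auto
qed

lemma bspl_sum_step:
  assumes "1 \<le> k" "Suc k \<le> m"
  defines "N \<equiv> L + m - Suc k"
  shows "(\<Sum>i<N. c i * bspl tk i (Suc k) x) =
    (\<Sum>i<N. (c (Suc i) * knot_ratio tk k x (Suc i) + c i * (1 - knot_ratio tk k x (Suc i))) * bspl tk (Suc i) k x)"
    and "(\<Sum>i<L + m - k. g i * bspl tk i k x) = (\<Sum>i<N. g (Suc i) * bspl tk (Suc i) k x)"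
proof -
  have z0: "bspl tk 0 k x = 0"
    using bspl_support[OF mono_knots, of 0 k x] knots_zero[of 0] knots_zero[of k] assms(2) by fastforce
  have zN: "bspl tk N k x = 0"
    using bspl_support[OF mono_knots, of N k x] knots_one[of N] knots_one[of "N + k"] assms(2) by (fastforce simp: N_def)
  have shift: "(\<Sum>i<N. f i * bspl tk i k x) = (\<Sum>i<N. f (Suc i) * bspl tk (Suc i) k x)" for f
    using sum.lessThan_Suc_shift[of "\<lambda>i. f i * bspl tk i k x" N] z0 zN by simp
  have "(\<Sum>i<N. c i * bspl tk i (Suc k) x) = (\<Sum>i<N. (c i * knot_ratio tk k x i) * bspl tk i k x)
    + (\<Sum>i<N. c i * (1 - knot_ratio tk k x (Suc i)) * bspl tk (Suc i) k x)"
    by (simp add: bspl_step[OF mono_knots assms(1)] distrib_left sum.distrib mult.assoc)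
  also note shift[of "\<lambda>i. c i * knot_ratio tk k x i"]
  finally show "(\<Sum>i<N. c i * bspl tk i (Suc k) x) =
    (\<Sum>i<N. (c (Suc i) * knot_ratio tk k x (Suc i) + c i * (1 - knot_ratio tk k x (Suc i))) * bspl tk (Suc i) k x)"
    by (simp add: distrib_right sum.distrib)
  have "L + m - k = Suc N" using assms by (auto simp: N_def)
  then show "(\<Sum>i<L + m - k. g i * bspl tk i k x) = (\<Sum>i<N. g (Suc i) * bspl tk (Suc i) k x)"
    using shift[of g] zN by simp
qed

lemma bspl_partition_of_unity_order:
  assumes "0 \<le> x" "x \<le> 1" "1 \<le> k" "k \<le> m"
  shows "(\<Sum>i<L + m - k. bspl tk i k x) = 1"
  using \<open>1 \<le> k\<close> \<open>k \<le> m\<close>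
proof (induction k rule: nat_induct_at_least)
  case base
  obtain \<mu> where "\<mu> < L" "\<And>i. bspl tk i (Suc 0) x = (if i = \<mu> then 1 else 0)"
    using order_one_delta assms by blast
  then show ?case using order_pos by simp
next
  case (Suc k)
  then show ?case using bspl_sum_step(1)[of k "\<lambda>_. 1" x] bspl_sum_step(2)[of k "\<lambda>_. 1" x] by simp
qed

lemma bspl_partition_of_unity:
  assumes "0 \<le> x" "x \<le> 1"
  shows "(\<Sum>i<L. bspl tk i m x) = 1"
  using bspl_partition_of_unity_order[OF assms order_pos] by simp

lemma marsden_order:
  assumes "0 \<le> x" "x \<le> 1" "1 \<le> k" "k \<le> m"
  shows "(\<Sum>i<L + m - k. (\<Prod>r\<in>{1..<k}. y - tk (i + r)) * bspl tk i k x) = (y - x)^(k-1)"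
  using \<open>1 \<le> k\<close> \<open>k \<le> m\<close>
proof (induction k rule: nat_induct_at_least)
  case base
  show ?case using bspl_partition_of_unity_order[of x 1] assms order_pos by simp
next
  case (Suc k)
  define \<psi> where "\<psi> i = (\<Prod>r\<in>{1..<k}. y - tk (i + r))" for i
  define \<psi>' where "\<psi>' i = (\<Prod>r\<in>{1..<Suc k}. y - tk (i + r))" for i
  define \<omega> where "\<omega> = knot_ratio tk k x"
  have up: "\<psi>' i = \<psi> i * (y - tk (i + k))" for i
    using \<open>1 \<le> k\<close> by (simp add: \<psi>_def \<psi>'_def)
  have down: "\<psi>' i = (y - tk (Suc i)) * \<psi> (Suc i)" for i
  proof -
    have "\<psi>' i = (y - tk (i + 1)) * (\<Prod>r\<in>{Suc 1..<Suc k}. y - tk (i + r))"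
      unfolding \<psi>'_def using \<open>1 \<le> k\<close> by (subst prod.atLeast_Suc_lessThan) auto
    also have "(\<Prod>r\<in>{Suc 1..<Suc k}. y - tk (i + r)) = \<psi> (Suc i)"
      unfolding \<psi>_def by (subst prod.atLeast_Suc_lessThan_Suc_shift) simp
    finally show ?thesis by simp
  qed
  have *: "(\<psi>' (Suc i) * \<omega> (Suc i) + \<psi>' i * (1 - \<omega> (Suc i))) * bspl tk (Suc i) k x
    = (y - x) * (\<psi> (Suc i) * bspl tk (Suc i) k x)" for i
  proof (cases "bspl tk (Suc i) k x = 0")
    case False
    then have "tk (Suc i) < tk (Suc i + k)" using bspl_support[OF mono_knots] by blast
    then have "\<omega> (Suc i) * (tk (Suc i + k) - tk (Suc i)) = x - tk (Suc i)"
      by (simp add: \<omega>_def knot_ratio_def)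
    then have "(y - tk (Suc i + k)) * \<omega> (Suc i) + (y - tk (Suc i)) * (1 - \<omega> (Suc i)) = y - x"
      by (simp add: algebra_simps)
    moreover have "\<psi>' (Suc i) * \<omega> (Suc i) + \<psi>' i * (1 - \<omega> (Suc i)) =
      \<psi> (Suc i) * ((y - tk (Suc i + k)) * \<omega> (Suc i) + (y - tk (Suc i)) * (1 - \<omega> (Suc i)))"
      unfolding up[of "Suc i"] down[of i] by (simp add: algebra_simps)
    ultimately show ?thesis by simp
  qed simp
  have "(\<Sum>i<L + m - Suc k. \<psi>' i * bspl tk i (Suc k) x) = (y - x) * (\<Sum>i<L + m - k. \<psi> i * bspl tk i k x)"
    unfolding bspl_sum_step(1)[OF Suc.hyps Suc.prems] bspl_sum_step(2)[OF Suc.hyps Suc.prems]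
      \<omega>_def[symmetric] * sum_distrib_left ..
  also have "\<dots> = (y - x) * (y - x)^(k-1)" using Suc by (simp add: \<psi>_def)
  also have "\<dots> = (y - x)^(Suc k - 1)" using \<open>1 \<le> k\<close> by (cases k) auto
  finally show ?case by (simp add: \<psi>'_def)
qed

lemma marsden_identity:
  assumes "0 \<le> x" "x \<le> 1"
  shows "(\<Sum>i<L. (\<Prod>r\<in>{1..<m}. y - tk (i + r)) * bspl tk i m x) = (y - x)^(m-1)"
  using marsden_order[OF assms order_pos] by simp

definition node :: "nat \<Rightarrow> nat \<Rightarrow> real" where
  "node i a = tk i + real a * ((tk (i + m) - tk i) / real m)"

lemma node_range:
  assumes "a < m"
  shows "tk i \<le> node i a" "node i a \<le> tk (i + m)"
proof -
  have w: "0 \<le> tk (i + m) - tk i" using knots_le[of i "i+m"] by simp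
  then show "tk i \<le> node i a" by (simp add: node_def)
  have "real a * ((tk (i + m) - tk i) / real m) \<le> real m * ((tk (i + m) - tk i) / real m)"
    using assms w by (intro mult_right_mono) auto
  then show "node i a \<le> tk (i + m)" using assms by (simp add: node_def)
qed

end

definition reproduces_polynomials :: "(nat \<Rightarrow> real) \<Rightarrow> nat \<Rightarrow> nat \<Rightarrow> (nat \<Rightarrow> nat \<Rightarrow> real) \<Rightarrow> bool" where
  "reproduces_polynomials tk m L w \<longleftrightarrow> (\<forall>x0 u c. 0 \<le> u \<longrightarrow> u \<le> 1 \<longrightarrow>
    (\<Sum>i<L. (\<Sum>a<m. w i a * (\<Sum>k<m. c k * (clamped_knots.node tk m i a - x0)^k)) * bspl tk i m u)
      = (\<Sum>k<m. c k * (u - x0)^k))"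

lemma quasi_interpolant_weights:
  assumes "1 \<le> m"
  shows "\<exists>C\<ge>0. \<forall>tk L. clamped_knots tk m L \<longrightarrow>
    (\<exists>w. (\<forall>i<L. \<forall>a<m. \<bar>w i a\<bar> \<le> C) \<and> reproduces_polynomials tk m L w)"
proof -
  obtain C where C: "C \<ge> 0" "\<And>z. (\<forall>r\<in>{1..<m}. \<bar>z r\<bar> \<le> real m) \<Longrightarrow>
    (\<exists>w. (\<forall>a<m. \<bar>w a\<bar> \<le> C) \<and> (\<forall>y::real. (\<Prod>r\<in>{1..<m}. y - z r) = (\<Sum>a<m. w a * (y - real a)^(m-1))))"
    using dual_weights_bounded[OF assms] by blast
  show ?thesis
  proof (intro exI[of _ C] conjI allI impI)
    show "0 \<le> C" by (rule C)
    fix tk L assume "clamped_knots tk m L"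
    then interpret clamped_knots tk m L .
    have "\<exists>w. (\<forall>a<m. \<bar>w a\<bar> \<le> C) \<and> (\<forall>Y::real. (\<Prod>r\<in>{1..<m}. Y - tk (i + r)) = (\<Sum>a<m. w a * (Y - node i a)^(m-1)))"
      if "i < L" for i
    proof -
      define \<rho> where "\<rho> = (tk (i + m) - tk i) / real m"
      have \<rho>: "\<rho> > 0" "real m * \<rho> = tk (i + m) - tk i"
        using support_width_pos[OF that] order_pos by (auto simp: \<rho>_def)
      define z where "z r = (tk (i + r) - tk i) / \<rho>" for r
      have "\<bar>z r\<bar> \<le> real m" if "r \<in> {1..<m}" for r
      proof -
        have "0 \<le> tk (i + r) - tk i" "tk (i + r) - tk i \<le> real m * \<rho>"
          using that knots_le[of i "i + r"] knots_le[of "i + r" "i + m"] \<rho>(2) by auto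
        then show ?thesis using \<rho>(1) by (simp add: z_def divide_le_eq)
      qed
      then obtain w where w: "\<And>a. a < m \<Longrightarrow> \<bar>w a\<bar> \<le> C"
        "\<And>y::real. (\<Prod>r\<in>{1..<m}. y - z r) = (\<Sum>a<m. w a * (y - real a)^(m-1))"
        using C(2)[of z] by blast
      have "(\<Prod>r\<in>{1..<m}. Y - tk (i + r)) = (\<Sum>a<m. w a * (Y - node i a)^(m-1))" for Y
      proof -
        define y where "y = (Y - tk i) / \<rho>"
        have "(\<Prod>r\<in>{1..<m}. Y - tk (i + r)) = (\<Prod>r\<in>{1..<m}. \<rho> * (y - z r))"
          using \<rho>(1) by (intro prod.cong) (auto simp: y_def z_def field_simps)
        also have "\<dots> = \<rho>^(m-1) * (\<Prod>r\<in>{1..<m}. y - z r)" by (simp add: prod.distrib)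
        also have "\<dots> = (\<Sum>a<m. w a * (\<rho> * (y - real a))^(m-1))"
          unfolding w(2) sum_distrib_left power_mult_distrib by (simp add: mult.left_commute)
        also have "\<dots> = (\<Sum>a<m. w a * (Y - node i a)^(m-1))"
        proof (intro sum.cong refl)
          fix a
          have "\<rho> * (y - real a) = Y - node i a" unfolding node_def \<rho>_def[symmetric]
            using \<rho>(1) by (simp add: y_def field_simps)
          then show "w a * (\<rho> * (y - real a))^(m-1) = w a * (Y - node i a)^(m-1)" by simp
        qed
        finally show ?thesis .
      qed
      with w(1) show ?thesis by blast
    qed
    then have "\<forall>i\<in>{..<L}. \<exists>w. (\<forall>a<m. \<bar>w a\<bar> \<le> C) \<and>
      (\<forall>Y::real. (\<Prod>r\<in>{1..<m}. Y - tk (i + r)) = (\<Sum>a<m. w a * (Y - node i a)^(m-1)))" by blast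
    from bchoice[OF this] obtain w where w: "\<And>i a. i < L \<Longrightarrow> a < m \<Longrightarrow> \<bar>w i a\<bar> \<le> C"
      "\<And>i Y. i < L \<Longrightarrow> (\<Prod>r\<in>{1..<m}. Y - tk (i + r)) = (\<Sum>a<m. w i a * (Y - node i a)^(m-1))"
      by blast
    have "(\<Sum>i<L. (\<Sum>a<m. w i a * (\<Sum>k<m. c k * (node i a - x0)^k)) * bspl tk i m u)
          = (\<Sum>k<m. c k * (u - x0)^k)" if u: "0 \<le> u" "u \<le> 1" for x0 u c
    proof -
      define F where "F k = (\<Sum>i<L. (\<Sum>a<m. w i a * (node i a - x0)^k) * bspl tk i m u) - (u - x0)^k" for k
      define b where "b j = real ((m-1) choose j) * (-1)^j" for j
      have lin: "(\<Sum>i<L. (\<Sum>a<m. w i a * (\<Sum>k<m. c k * (node i a - x0)^k)) * bspl tk i m u)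
         - (\<Sum>k<m. c k * (u - x0)^k) = (\<Sum>k<m. c k * F k)" for c
      proof -
        have "(\<Sum>i<L. (\<Sum>a<m. w i a * (\<Sum>k<m. c k * (node i a - x0)^k)) * bspl tk i m u)
          = (\<Sum>i<L. \<Sum>a<m. \<Sum>k<m. c k * (w i a * (node i a - x0)^k * bspl tk i m u))"
          by (simp add: sum_distrib_left sum_distrib_right algebra_simps)
        also have "\<dots> = (\<Sum>i<L. \<Sum>k<m. \<Sum>a<m. c k * (w i a * (node i a - x0)^k * bspl tk i m u))"
          by (rule sum.cong[OF refl]) (rule sum.swap)
        also have "\<dots> = (\<Sum>k<m. \<Sum>i<L. \<Sum>a<m. c k * (w i a * (node i a - x0)^k * bspl tk i m u))"
          by (rule sum.swap)
        also have "\<dots> = (\<Sum>k<m. c k * (\<Sum>i<L. (\<Sum>a<m. w i a * (node i a - x0)^k) * bspl tk i m u))"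
          by (simp add: sum_distrib_left sum_distrib_right)
        finally show ?thesis by (simp add: F_def right_diff_distrib sum_subtractf)
      qed
      have "(\<Sum>j<m. (b j * y^(m-1-j)) * F j) = 0" for y
      proof -
        have e: "(\<Sum>k<m. (b k * y^(m-1-k)) * (x - x0)^k) = ((y + x0) - x)^(m-1)" for x
        proof -
          have "(y + x0) - x = y - (x - x0)" by simp
          then show ?thesis unfolding b_def by (simp only: shifted_power_expansion[OF assms, of y "x - x0"])
        qed
        have "(\<Sum>j<m. (b j * y^(m-1-j)) * F j) =
          (\<Sum>i<L. (\<Sum>a<m. w i a * ((y + x0) - node i a)^(m-1)) * bspl tk i m u) - ((y + x0) - u)^(m-1)"
          unfolding lin[symmetric] e ..
        also have "\<dots> = 0" using marsden_identity[OF u, of "y + x0"] w(2)[of _ "y + x0"] by simp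
        finally show ?thesis .
      qed
      moreover have "(\<Sum>k<m. (b (m - Suc k) * F (m - Suc k)) * y^k) = (\<Sum>j<m. (b j * y^(m-1-j)) * F j)" for y
        unfolding sum.nat_diff_reindex[of "\<lambda>j. (b j * y^(m-1-j)) * F j" m, symmetric]
        by (intro sum.cong refl) auto
      ultimately have "(\<Sum>k<m. (b (m - Suc k) * F (m - Suc k)) * y^k) = 0" for y by simp
      then have z: "b (m - Suc k) * F (m - Suc k) = 0" if "k < m" for k
        using polyfun_many_zeros[where X = UNIV and c = "\<lambda>k. b (m - Suc k) * F (m - Suc k)", OF _ _ that]
        by (simp add: infinite_UNIV_char_0)
      have "F j = 0" if "j < m" for j
      proof -
        have "m - Suc (m - Suc j) = j" using that by simp
        then have "b j * F j = 0" using z[of "m - Suc j"] that by simp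
        moreover have "b j \<noteq> 0" using that by (simp add: b_def)
        ultimately show ?thesis by simp
      qed
      then show ?thesis using lin[of c] by simp
    qed
    then have "reproduces_polynomials tk m L w" unfolding reproduces_polynomials_def by blast
    then show "\<exists>w. (\<forall>i<L. \<forall>a<m. \<bar>w i a\<bar> \<le> C) \<and> reproduces_polynomials tk m L w" using w(1) by blast
  qed
qed

context clamped_knots begin

text \<open>The \<open>m\<close> B-splines active on a knot interval span the \<open>m\<close>-dimensional space of polynomials there.\<close>
lemma bspl_linear_independent_local:
  assumes \<mu>: "m - 1 \<le> \<mu>" "\<mu> < L" and X: "infinite X" "X \<subseteq> {tk \<mu><..<tk (Suc \<mu>)}"
    and zero: "\<And>x. x \<in> X \<Longrightarrow> (\<Sum>i<L. c i * bspl tk i m x) = 0"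
    and i: "\<mu> < i + m" "i \<le> \<mu>"
  shows "c i = 0"
proof -
  obtain w where "reproduces_polynomials tk m L w"
    using quasi_interpolant_weights[OF order_pos] clamped_knots_axioms by blast
  note w = this[unfolded reproduces_polynomials_def, rule_format]
  define o' where "o' = Suc \<mu> - m"
  have o': "o' + m = Suc \<mu>" using \<mu> order_pos by (simp add: o'_def)
  have act: "(\<Sum>i<L. f i * bspl tk i m x) = (\<Sum>l<m. f (o' + l) * bspl tk (o' + l) m x)" if "x \<in> X" for f x
  proof -
    have x: "tk \<mu> < x" "x < tk (Suc \<mu>)" using X(2) that by auto
    have "bspl tk i m x = 0" if "i \<notin> {o'..<o'+m}" for i
    proof (rule ccontr)
      assume "bspl tk i m x \<noteq> 0"
      then have "tk i \<le> x" "x \<le> tk (i + m)" using bspl_support[OF mono_knots] by blast+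
      moreover have "i < o' \<or> Suc \<mu> \<le> i" using that o' by auto
      ultimately show False using x knots_le[of "i + m" \<mu>] knots_le[of "Suc \<mu>" i] o' by auto
    qed
    moreover have "{o'..<o'+m} \<subseteq> {..<L}" using o' \<mu> by auto
    ultimately have "(\<Sum>i<L. f i * bspl tk i m x) = (\<Sum>i\<in>{o'..<o'+m}. f i * bspl tk i m x)"
      by (intro sum.mono_neutral_right) auto
    also have "\<dots> = (\<Sum>l<m. f (o' + l) * bspl tk (o' + l) m x)"
      using sum.shift_bounds_nat_ivl[of "\<lambda>i. f i * bspl tk i m x" 0 o' m]
      by (simp add: lessThan_atLeast0 add.commute)
    finally show ?thesis .
  qed
  have X01: "0 \<le> x" "x \<le> 1" if "x \<in> X" for x
    using X(2) that knots_range[of \<mu>] knots_range[of "Suc \<mu>"] by force+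
  define G where "G l k = (\<Sum>a<m. w (o' + l) a * node (o' + l) a ^ k)" for l k
  have rep: "(\<Sum>l<m. (\<Sum>k<m. G l k * d k) * bspl tk (o' + l) m x) = (\<Sum>k<m. d k * x^k)" if "x \<in> X" for d x
  proof -
    have "(\<Sum>k<m. G l k * d k) = (\<Sum>a<m. w (o' + l) a * (\<Sum>k<m. d k * (node (o' + l) a - 0)^k))" for l
      unfolding G_def sum_distrib_left sum_distrib_right by (subst sum.swap) (simp add: algebra_simps)
    then show ?thesis
      using w[of x d 0] X01[OF that] act[OF that, of "\<lambda>i. \<Sum>a<m. w i a * (\<Sum>k<m. d k * (node i a - 0)^k)"] by simp
  qed
  have "d j = 0" if "\<forall>l<m. (\<Sum>k<m. G l k * d k) = 0" "j < m" for d j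
    using polyfun_many_zeros[where X = X, OF _ _ that(2), of d] rep[of _ d] that(1) X(1) by simp
  then have "\<forall>d. (\<forall>l<m. (\<Sum>k<m. G l k * d k) = 0) \<longrightarrow> (\<forall>j<m. d j = 0)" by blast
  from injective_square_system_invertible[OF this]
  obtain W where W: "\<And>i j. i < m \<Longrightarrow> j < m \<Longrightarrow> (\<Sum>a<m. G i a * W a j) = (if i = j then 1 else 0)" by metis
  define d where "d k = (\<Sum>j<m. W k j * c (o' + j))" for k
  have Gd: "(\<Sum>k<m. G l k * d k) = c (o' + l)" if "l < m" for l
  proof -
    have "(\<Sum>k<m. G l k * d k) = (\<Sum>j<m. (\<Sum>k<m. G l k * W k j) * c (o' + j))"
      unfolding d_def sum_distrib_left sum_distrib_right by (subst sum.swap) (simp add: algebra_simps)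
    also have "\<dots> = (\<Sum>j<m. if j = l then c (o' + j) else 0)" using W[OF that] by (intro sum.cong) auto
    finally show ?thesis using that by simp
  qed
  have "(\<Sum>k<m. d k * x^k) = 0" if "x \<in> X" for x
    using rep[OF that, of d] Gd act[OF that, of c] zero[OF that] by simp
  then have "d j = 0" if "j < m" for j
    using polyfun_many_zeros[where X = X, OF _ _ that, of d] X(1) by simp
  moreover have "i - o' < m" "o' + (i - o') = i" using i o' by auto
  ultimately show ?thesis using Gd[of "i - o'"] by simp
qed

lemma bspl_linear_independent:
  assumes "AE u in lborel. 0 \<le> u \<and> u \<le> 1 \<longrightarrow> (\<Sum>i<L. c i * bspl tk i m u) = 0" and "i < L"
  shows "c i = 0"
proof -
  define \<mu> where "\<mu> = max i (m - 1)"
  have \<mu>: "m - 1 \<le> \<mu>" "\<mu> < L" "\<mu> < i + m" "i \<le> \<mu>" using \<open>i < L\<close> order_pos order_le by (auto simp: \<mu>_def)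
  define X where "X = {u \<in> {tk \<mu><..<tk (Suc \<mu>)}. (\<Sum>i<L. c i * bspl tk i m u) = 0}"
  have "infinite X"
  proof
    assume fin: "finite X"
    then have "AE u in lborel. u \<notin> X"
      by (intro AE_not_in) (auto simp: null_sets_def finite_imp_closed emeasure_lborel_countable countable_finite)
    with assms(1) have "AE u in lborel. u \<notin> {tk \<mu><..<tk (Suc \<mu>)}"
    proof eventually_elim
      case (elim u)
      then show ?case using knots_range[of \<mu>] knots_range[of "Suc \<mu>"] by (auto simp: X_def)
    qed
    then have "emeasure lborel {tk \<mu><..<tk (Suc \<mu>)} = 0"
      by (subst (asm) AE_iff_measurable[of "{tk \<mu><..<tk (Suc \<mu>)}"]) auto
    then show False using knots_strict[OF \<mu>(1,2)] by simp
  qed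
  then show ?thesis
    by (rule bspl_linear_independent_local[OF \<mu>(1,2) _ _ _ \<mu>(3,4), of X]) (auto simp: X_def)
qed

end

lemma quasi_uniform_clamped_knots:
  assumes "1 \<le> m" and qu: "quasi_uniform m L cq xi"
  shows "clamped_knots (knots m (L - m) xi) m L"
    and "0 \<le> cq"
    and "\<And>i. knots m (L - m) xi (i + m) - knots m (L - m) xi i \<le> cq * (real m)\<^sup>2 / real L"
proof -
  define K where "K = L - m"
  have mL: "m \<le> L" and x0: "xi 0 = 0" and x1: "xi (Suc K) = 1"
    and st: "\<And>i. i \<le> K \<Longrightarrow> xi i < xi (Suc i)"
    and ratio: "\<And>i j. i \<le> K \<Longrightarrow> j \<le> K \<Longrightarrow> xi (Suc i) - xi i \<le> cq * (xi (Suc j) - xi j)"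
    using qu by (auto simp: quasi_uniform_def K_def)
  have le: "xi i \<le> xi j" if "i \<le> j" "j \<le> Suc K" for i j
    using that
  proof (induction j rule: dec_induct)
    case (step j)
    then show ?case using st[of j] by simp
  qed simp
  define tk where "tk = knots m K xi"
  have tk: "tk j = xi (min (K + 1) (j + 1 - m))" for j by (simp add: tk_def knots_def)
  have mono: "mono tk" unfolding tk by (intro monoI le) auto
  show "clamped_knots (knots m (L - m) xi) m L"
    unfolding K_def[symmetric] tk_def[symmetric]
  proof
    fix j
    show "tk j = 0" if "j < m" using that x0 by (simp add: tk)
    show "tk j = 1" if "L \<le> j"
    proof -
      have "min (K + 1) (j + 1 - m) = Suc K" using that mL by (auto simp: K_def)
      then show ?thesis using x1 by (simp add: tk)
    qed
    show "tk j < tk (Suc j)" if "m - 1 \<le> j" "j < L"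
    proof -
      have "min (K + 1) (j + 1 - m) = j + 1 - m" "min (K + 1) (Suc j + 1 - m) = Suc (j + 1 - m)" "j + 1 - m \<le> K"
        using that mL \<open>1 \<le> m\<close> by (auto simp: K_def)
      then show ?thesis using st[of "j + 1 - m"] by (simp add: tk)
    qed
  qed (use assms mL mono in auto)
  have gap0: "0 < xi (Suc 0) - xi 0" using st[of 0] by simp
  have "1 * (xi (Suc 0) - xi 0) \<le> cq * (xi (Suc 0) - xi 0)" using ratio[of 0 0] by simp
  then show cq: "0 \<le> cq" using gap0 by (meson mult_right_le_imp_le order_trans zero_le_one)
  have gap: "xi (Suc i) - xi i \<le> cq * real m / real L" if "i \<le> K" for i
  proof -
    have "(\<Sum>j<Suc K. xi (Suc i) - xi i) \<le> (\<Sum>j<Suc K. cq * (xi (Suc j) - xi j))"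
      using ratio that by (intro sum_mono) auto
    also have "\<dots> = cq * (xi (Suc K) - xi 0)"
      by (simp only: sum_distrib_left[symmetric] sum_lessThan_telescope)
    finally have 1: "real (Suc K) * (xi (Suc i) - xi i) \<le> cq" using x0 x1 by simp
    have "L \<le> m * Suc K"
    proof -
      have "L = m + K" using mL by (simp add: K_def)
      moreover have "K \<le> m * K" using \<open>1 \<le> m\<close> by simp
      ultimately show ?thesis by simp
    qed
    then have "real L * (xi (Suc i) - xi i) \<le> real (m * Suc K) * (xi (Suc i) - xi i)"
      using st[OF that] by (intro mult_right_mono) (auto simp del: of_nat_mult)
    also have "\<dots> = real m * (real (Suc K) * (xi (Suc i) - xi i))" by (simp only: of_nat_mult mult.assoc)
    also have "\<dots> \<le> real m * cq" using 1 by (rule mult_left_mono) simp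
    finally show ?thesis using mL \<open>1 \<le> m\<close> by (simp add: field_simps)
  qed
  have step: "tk (Suc j) - tk j \<le> cq * real m / real L" for j
  proof (cases "m \<le> Suc j \<and> j + 1 - m \<le> K")
    case True
    then have "min (K + 1) (j + 1 - m) = j + 1 - m" "min (K + 1) (Suc j + 1 - m) = Suc (j + 1 - m)" by auto
    then show ?thesis using gap[of "j + 1 - m"] True by (simp add: tk)
  next
    case False
    then have "min (K + 1) (j + 1 - m) = min (K + 1) (Suc j + 1 - m)" by auto
    then show ?thesis using cq by (simp add: tk)
  qed
  have "tk (i + n) - tk i \<le> real n * (cq * real m / real L)" for i n
  proof (induction n)
    case (Suc n)
    then show ?case using step[of "i + n"] by (simp add: algebra_simps add_divide_distrib)
  qed simp
  from this[of _ m] show "knots m (L - m) xi (i + m) - knots m (L - m) xi i \<le> cq * (real m)\<^sup>2 / real L" for i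
    by (simp add: tk_def K_def power2_eq_square mult_ac)
qed

section \<open>Local polynomial approximation\<close>

lemma abs_power_le_powr:
  fixes z d :: real
  assumes "\<bar>z\<bar> \<le> 1" "d \<le> real m" "1 \<le> m"
  shows "\<bar>z\<bar> ^ m \<le> \<bar>z\<bar> powr d"
proof (cases "z = 0")
  case False
  then have "\<bar>z\<bar> ^ m = \<bar>z\<bar> powr real m" by (simp add: powr_realpow)
  also have "\<dots> \<le> \<bar>z\<bar> powr d" using assms by (intro powr_mono') auto
  finally show ?thesis .
qed (use assms in \<open>simp add: power_0_left\<close>)

lemma holder_classE:
  assumes "holder_class t r Dc Lc f"
  obtains F where "F 0 = f"
    and "\<And>l x. l < t \<Longrightarrow> x \<in> {0..1} \<Longrightarrow> (F l has_real_derivative F (Suc l) x) (at x within {0..1})"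
    and "\<And>l x. l \<le> t \<Longrightarrow> x \<in> {0..1} \<Longrightarrow> \<bar>F l x\<bar> \<le> Dc"
    and "\<And>x x'. x \<in> {0..1} \<Longrightarrow> x' \<in> {0..1} \<Longrightarrow> \<bar>F t x - F t x'\<bar> \<le> Lc * \<bar>x - x'\<bar> powr r"
  using assms unfolding holder_class_def by (elim exE conjE) simp

lemma holder_local_polynomial:
  assumes hc: "holder_class t r Dc Lc f" and r: "0 \<le> r" and d: "1 \<le> real t + r" "real t + r \<le> real m"
    and x0: "x0 \<in> {0..1}"
  shows "\<exists>c. \<forall>x\<in>{0..1}. \<bar>f x - (\<Sum>k<m. c k * (x - x0)^k)\<bar> \<le> (\<bar>Dc\<bar> + \<bar>Lc\<bar>) * \<bar>x - x0\<bar> powr (real t + r)"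
proof -
  obtain F where F0: "F 0 = f"
    and DF: "\<And>l x. l < t \<Longrightarrow> x \<in> {0..1} \<Longrightarrow> (F l has_real_derivative F (Suc l) x) (at x within {0..1})"
    and bF: "\<And>l x. l \<le> t \<Longrightarrow> x \<in> {0..1} \<Longrightarrow> \<bar>F l x\<bar> \<le> Dc"
    and hF: "\<And>x x'. x \<in> {0..1} \<Longrightarrow> x' \<in> {0..1} \<Longrightarrow> \<bar>F t x - F t x'\<bar> \<le> Lc * \<bar>x - x'\<bar> powr r"
    using holder_classE[OF hc] by metis
  define c where "c n k = (if k \<le> n then F k x0 / fact k else 0)" for n k
  have sum_c: "(\<Sum>k<m. c n k * y^k) = (\<Sum>i\<le>n. F i x0 * y^i / fact i)" if "n < m" for n and y :: real
  proof -
    have "(\<Sum>i\<le>n. F i x0 * y^i / fact i) = (\<Sum>k\<le>n. c n k * y^k)" by (intro sum.cong) (auto simp: c_def)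
    also have "\<dots> = (\<Sum>k<m. c n k * y^k)" using that by (intro sum.mono_neutral_left) (auto simp: c_def)
    finally show ?thesis ..
  qed
  have split: "\<bar>y\<bar> ^ t * \<bar>y\<bar> powr r = \<bar>y\<bar> powr (real t + r)" for y
    using d by (cases "y = 0") (auto simp: powr_add powr_realpow)
  show ?thesis
  proof (cases "r = 0")
    case True
    then obtain n where n: "t = Suc n" using d by (cases t) auto
    show ?thesis
    proof (intro exI[of _ "c n"] ballI)
      fix x :: real assume x: "x \<in> {0..1}"
      have "norm (F 0 x - (\<Sum>i\<le>n. F i x0 * (x - x0)^i / fact i)) \<le> Dc * norm (x - x0)^(Suc n) / fact n"
        using DF bF x x0 n by (intro field_Taylor[of "{0..1}"]) auto
      also have "\<dots> \<le> \<bar>Dc\<bar> * \<bar>x - x0\<bar>^t"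
      proof -
        have "Dc * \<bar>x - x0\<bar>^t / fact n \<le> \<bar>Dc\<bar> * \<bar>x - x0\<bar>^t / fact n"
          by (intro divide_right_mono mult_right_mono) auto
        also have "\<dots> \<le> \<bar>Dc\<bar> * \<bar>x - x0\<bar>^t / 1" by (intro divide_left_mono) (auto simp: fact_ge_1)
        finally show ?thesis by (simp add: n)
      qed
      also have "\<dots> \<le> (\<bar>Dc\<bar> + \<bar>Lc\<bar>) * \<bar>x - x0\<bar> powr (real t + r)"
        using split[of "x - x0"] True by (intro mult_mono) (auto simp: n split: if_splits)
      finally show "\<bar>f x - (\<Sum>k<m. c n k * (x - x0)^k)\<bar> \<le> (\<bar>Dc\<bar> + \<bar>Lc\<bar>) * \<bar>x - x0\<bar> powr (real t + r)"
        using sum_c[of n] F0 n d True by simp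
    qed
  next
    case False
    then have tm: "t < m" using d r by linarith
    show ?thesis
    proof (intro exI[of _ "c t"] ballI)
      fix x :: real assume x: "x \<in> {0..1}"
      have "\<bar>f x - (\<Sum>i\<le>t. F i x0 * (x - x0)^i / fact i)\<bar> \<le> \<bar>Lc\<bar> * (\<bar>x - x0\<bar>^t * \<bar>x - x0\<bar> powr r)"
      proof (cases t)
        case 0
        have "\<bar>F 0 x - F 0 x0\<bar> \<le> Lc * \<bar>x - x0\<bar> powr r" using hF[OF x x0] 0 by simp
        also have "\<dots> \<le> \<bar>Lc\<bar> * \<bar>x - x0\<bar> powr r" by (intro mult_right_mono) auto
        finally show ?thesis using 0 F0 by simp
      next
        case (Suc n)
        define G where "G i y = F i y - F t x0 / fact (t - i) * (y - x0)^(t - i)" for i y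
        let ?S = "closed_segment x0 x"
        have S: "?S \<subseteq> {0..1}" using x x0 closed_segment_subset[of x0 "{0..1}" x] by simp
        have dG: "(G i has_field_derivative G (Suc i) y) (at y within ?S)" if "y \<in> ?S" "i \<le> n" for y i
        proof -
          define k where "k = t - Suc i"
          have k: "t - i = Suc k" "t - Suc i = k" using that Suc by (auto simp: k_def)
          have "((\<lambda>y. (y - x0)^Suc k) has_field_derivative real (Suc k) * (y - x0)^k) (at y within ?S)"
            by (rule derivative_eq_intros refl)+ simp
          from DERIV_cmult[OF this, of "F t x0 / fact (Suc k)"]
          have "((\<lambda>y. F t x0 / fact (t - i) * (y - x0)^(t - i)) has_field_derivative
            F t x0 / fact (t - Suc i) * (y - x0)^(t - Suc i)) (at y within ?S)"
            by (simp add: k del: of_nat_Suc)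
          moreover have "(F i has_field_derivative F (Suc i) y) (at y within ?S)"
            using that S Suc by (intro has_field_derivative_subset[OF DF S]) auto
          ultimately show ?thesis unfolding G_def by (intro derivative_intros)
        qed
        have bG: "norm (G (Suc n) y) \<le> \<bar>Lc\<bar> * \<bar>x - x0\<bar> powr r" if "y \<in> ?S" for y
        proof -
          have "\<bar>F t y - F t x0\<bar> \<le> Lc * \<bar>y - x0\<bar> powr r" using hF[of y x0] that S x0 by auto
          also have "\<dots> \<le> \<bar>Lc\<bar> * \<bar>x - x0\<bar> powr r"
          proof (intro mult_mono powr_mono2)
            show "\<bar>y - x0\<bar> \<le> \<bar>x - x0\<bar>" using dist_in_closed_segment[OF that] by (simp add: dist_real_def abs_minus_commute)
          qed (use r in auto)
          finally show ?thesis by (simp add: G_def Suc)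
        qed
        have "norm (G 0 x - (\<Sum>i\<le>n. G i x0 * (x - x0)^i / fact i)) \<le> \<bar>Lc\<bar> * \<bar>x - x0\<bar> powr r * norm (x - x0)^(Suc n) / fact n"
          by (rule field_Taylor[of ?S, OF _ dG bG]) auto
        also have "\<dots> \<le> \<bar>Lc\<bar> * \<bar>x - x0\<bar> powr r * norm (x - x0)^(Suc n) / 1"
          by (intro divide_left_mono) (auto simp: fact_ge_1)
        also have "(\<Sum>i\<le>n. G i x0 * (x - x0)^i / fact i) = (\<Sum>i\<le>n. F i x0 * (x - x0)^i / fact i)"
          using Suc by (intro sum.cong) (auto simp: G_def)
        finally show ?thesis using Suc F0 by (simp add: G_def mult_ac diff_diff_eq add.commute)
      qed
      also have "\<dots> \<le> (\<bar>Dc\<bar> + \<bar>Lc\<bar>) * \<bar>x - x0\<bar> powr (real t + r)"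
        unfolding split by (intro mult_right_mono) auto
      finally show "\<bar>f x - (\<Sum>k<m. c t k * (x - x0)^k)\<bar> \<le> (\<bar>Dc\<bar> + \<bar>Lc\<bar>) * \<bar>x - x0\<bar> powr (real t + r)"
        using sum_c[OF tm] by simp
    qed
  qed
qed

lemma holder_class_continuous:
  assumes hc: "holder_class t r Dc Lc f" and r: "r \<le> 1" and d: "1 \<le> real t + r"
  shows "continuous_on {0..1} f"
proof -
  obtain F where F0: "F 0 = f"
    and DF: "\<And>l x. l < t \<Longrightarrow> x \<in> {0..1} \<Longrightarrow> (F l has_real_derivative F (Suc l) x) (at x within {0..1})"
    and hF: "\<And>x x'. x \<in> {0..1} \<Longrightarrow> x' \<in> {0..1} \<Longrightarrow> \<bar>F t x - F t x'\<bar> \<le> Lc * \<bar>x - x'\<bar> powr r"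
    using holder_classE[OF hc] by metis
  show ?thesis
  proof (cases t)
    case 0
    then have "r = 1" using r d by simp
    have "\<bar>Lc\<bar>-lipschitz_on {0..1} f"
    proof (rule lipschitz_onI)
      fix x y :: real assume xy: "x \<in> {0..1}" "y \<in> {0..1}"
      have "\<bar>f x - f y\<bar> \<le> Lc * \<bar>x - y\<bar>" using hF[OF xy] \<open>r = 1\<close> 0 F0 by simp
      also have "\<dots> \<le> \<bar>Lc\<bar> * \<bar>x - y\<bar>" by (intro mult_right_mono) auto
      finally show "dist (f x) (f y) \<le> \<bar>Lc\<bar> * dist x y" by (simp add: dist_real_def)
    qed simp
    then show ?thesis by (rule lipschitz_on_continuous_on)
  next
    case (Suc n)
    show ?thesis using DERIV_continuous_on[OF DF[of 0]] F0 Suc by simp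
  qed
qed

lemma L2_set_cmult: "L2_set (\<lambda>j. c * f j) S = \<bar>c\<bar> * L2_set f S"
  by (simp add: L2_set_def power_mult_distrib sum_distrib_left[symmetric] real_sqrt_mult)

lemma L2_set_uminus: "L2_set (\<lambda>j. - f j) S = L2_set f S"
  by (simp add: L2_set_def)

lemma L2_set_diff_le: "L2_set (\<lambda>j. f j - g j) S \<le> L2_set f S + L2_set g S"
  using L2_set_triangle_ineq[of f "\<lambda>j. - g j" S] by (simp add: L2_set_uminus)

lemma L2_set_sum_le:
  assumes "finite I"
  shows "L2_set (\<lambda>j. \<Sum>i\<in>I. f i j) S \<le> (\<Sum>i\<in>I. L2_set (f i) S)"
  using assms
proof (induction I rule: finite_induct)
  case (insert i I)
  then show ?case using L2_set_triangle_ineq[of "f i" "\<lambda>j. \<Sum>i\<in>I. f i j" S] by simp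
qed (simp add: L2_set_0')

lemma L2_set_abs_mono:
  assumes "\<And>j. j \<in> S \<Longrightarrow> \<bar>f j\<bar> \<le> \<bar>g j\<bar>"
  shows "L2_set f S \<le> L2_set g S"
  unfolding L2_set_def using assms by (intro real_sqrt_le_mono sum_mono) (simp add: abs_le_square_iff)

lemma abs_inner_le_L2_set: "\<bar>\<Sum>j\<in>S. f j * g j\<bar> \<le> L2_set f S * L2_set g S"
proof -
  have "\<bar>\<Sum>j\<in>S. f j * g j\<bar> \<le> (\<Sum>j\<in>S. \<bar>f j\<bar> * \<bar>g j\<bar>)"
    using sum_abs[of "\<lambda>j. f j * g j" S] by (simp add: abs_mult)
  also have "\<dots> \<le> L2_set f S * L2_set g S" by (rule L2_set_mult_ineq)
  finally show ?thesis .
qed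

lemma coefficient_bound_interpolation:
  assumes "1 \<le> m"
  shows "\<exists>C\<ge>0. \<forall>(S::nat set) \<sigma> b N. \<bar>\<sigma>\<bar> = 1 \<longrightarrow>
    (\<forall>x\<in>{0..1/2}. L2_set (\<lambda>j. \<Sum>k<m. b j k * (\<sigma> * x)^k) S \<le> N) \<longrightarrow>
    (\<forall>k<m. L2_set (\<lambda>j. b j k) S \<le> C * N)"
proof -
  define x where "x a = real a / (2 * real m)" for a
  have "inj_on x {..<m}" using assms by (auto simp: inj_on_def x_def)
  then obtain W where W: "\<And>c k. k < m \<Longrightarrow> c k = (\<Sum>a<m. W k a * (\<Sum>j<m. c j * x a ^ j))"
    using coefficient_functionals by blast
  have x: "x a \<in> {0..1/2}" if "a < m" for a using that by (auto simp: x_def field_simps)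
  show ?thesis
  proof (intro exI[of _ "\<Sum>k<m. \<Sum>a<m. \<bar>W k a\<bar>"] conjI allI impI)
    show "0 \<le> (\<Sum>k<m. \<Sum>a<m. \<bar>W k a\<bar>)" by (intro sum_nonneg) auto
    fix S :: "nat set" and \<sigma> b N k
    assume \<sigma>: "\<bar>\<sigma>\<bar> = (1::real)" and k: "k < m"
      and bd: "\<forall>x\<in>{0..1/2}. L2_set (\<lambda>j. \<Sum>k<m. b j k * (\<sigma> * x)^k) S \<le> N"
    have N: "0 \<le> N" by (rule order_trans[OF L2_set_nonneg bd[rule_format, of 0]]) simp
    have eq: "b j k * \<sigma>^k = (\<Sum>a<m. W k a * (\<Sum>i<m. b j i * (\<sigma> * x a)^i))" for j
      using W[OF k, of "\<lambda>k. b j k * \<sigma>^k"] by (simp add: power_mult_distrib mult.assoc)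
    have "L2_set (\<lambda>j. b j k) S = L2_set (\<lambda>j. b j k * \<sigma>^k) S"
      using \<sigma> L2_set_cmult[of "\<sigma>^k" "\<lambda>j. b j k" S] by (simp add: power_abs mult.commute)
    also have "\<dots> = L2_set (\<lambda>j. \<Sum>a<m. W k a * (\<Sum>i<m. b j i * (\<sigma> * x a)^i)) S" unfolding eq ..
    also have "\<dots> \<le> (\<Sum>a<m. L2_set (\<lambda>j. W k a * (\<Sum>i<m. b j i * (\<sigma> * x a)^i)) S)"
      by (rule L2_set_sum_le) simp
    also have "\<dots> \<le> (\<Sum>a<m. \<bar>W k a\<bar> * N)"
      unfolding L2_set_cmult using bd x by (intro sum_mono mult_left_mono) auto
    also have "\<dots> \<le> (\<Sum>k<m. \<Sum>a<m. \<bar>W k a\<bar>) * N"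
      unfolding sum_distrib_right[symmetric] using N k
      by (intro mult_right_mono member_le_sum[where f = "\<lambda>k. \<Sum>a<m. \<bar>W k a\<bar>"]) (auto intro: sum_nonneg)
    finally show "L2_set (\<lambda>j. b j k) S \<le> (\<Sum>k<m. \<Sum>a<m. \<bar>W k a\<bar>) * N" .
  qed
qed

lemma truncated_product:
  fixes z :: real
  shows "(\<Sum>i<m. a i * z^i) * (\<Sum>k<m. b k * z^k) - (\<Sum>n<m. (\<Sum>i\<le>n. a i * b (n-i)) * z^n)
    = (\<Sum>i<m. \<Sum>k<m. (if m \<le> i + k then z^(i+k) else 0) * (a i * b k))"
proof -
  define g where "g i k = a i * b k * z^(i+k)" for i k
  have "(\<Sum>n<m. (\<Sum>i\<le>n. a i * b (n-i)) * z^n) = (\<Sum>n<m. \<Sum>i\<le>n. g i (n-i))"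
    unfolding g_def sum_distrib_right by simp
  also have "\<dots> = (\<Sum>(i,k)\<in>{(i,k). i + k < m}. g i k)" by (rule sum.triangle_reindex[symmetric])
  also have "\<dots> = (\<Sum>(i,k)\<in>{..<m} \<times> {..<m}. if i + k < m then g i k else 0)"
    by (rule sum.mono_neutral_cong_left) (auto split: if_splits)
  also have "\<dots> = (\<Sum>i<m. \<Sum>k<m. if i + k < m then g i k else 0)" by (simp add: sum.cartesian_product)
  finally have 1: "(\<Sum>n<m. (\<Sum>i\<le>n. a i * b (n-i)) * z^n) = (\<Sum>i<m. \<Sum>k<m. if i + k < m then g i k else 0)" .
  have 2: "(\<Sum>i<m. a i * z^i) * (\<Sum>k<m. b k * z^k) = (\<Sum>i<m. \<Sum>k<m. g i k)"
    unfolding g_def sum_product by (simp add: power_add mult_ac)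
  show ?thesis unfolding 1 2 sum_subtractf[symmetric]
    by (intro sum.cong refl) (auto simp: g_def)
qed

lemma truncated_product_bound:
  assumes z: "\<bar>z\<bar> \<le> (1::real)" and A: "\<And>i. i < m \<Longrightarrow> L2_set (\<lambda>j. a j i) S \<le> A"
    and B: "\<And>k. k < m \<Longrightarrow> \<bar>b k\<bar> \<le> B" "0 \<le> B"
  shows "L2_set (\<lambda>j. (\<Sum>i<m. a j i * z^i) * (\<Sum>k<m. b k * z^k) - (\<Sum>n<m. (\<Sum>i\<le>n. a j i * b (n-i)) * z^n)) S
    \<le> (real m)\<^sup>2 * A * B * \<bar>z\<bar>^m"
proof -
  have "L2_set (\<lambda>j. \<Sum>i<m. \<Sum>k<m. (if m \<le> i + k then z^(i+k) else 0) * (a j i * b k)) S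
    \<le> (\<Sum>i<m. L2_set (\<lambda>j. \<Sum>k<m. (if m \<le> i + k then z^(i+k) else 0) * (a j i * b k)) S)"
    by (rule L2_set_sum_le) simp
  also have "\<dots> \<le> (\<Sum>i<m. \<Sum>k<m. L2_set (\<lambda>j. (if m \<le> i + k then z^(i+k) else 0) * (a j i * b k)) S)"
    by (intro sum_mono L2_set_sum_le) simp
  also have "\<dots> \<le> (\<Sum>i<m. \<Sum>k<m. \<bar>z\<bar>^m * (B * A))"
  proof (intro sum_mono)
    fix i k assume ik: "i \<in> {..<m}" "k \<in> {..<m}"
    have "L2_set (\<lambda>j. (if m \<le> i + k then z^(i+k) else 0) * (a j i * b k)) S
      = \<bar>if m \<le> i + k then z^(i+k) else 0\<bar> * (\<bar>b k\<bar> * L2_set (\<lambda>j. a j i) S)"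
      by (simp add: L2_set_cmult mult.commute[of _ "b k"])
    also have "\<dots> \<le> \<bar>z\<bar>^m * (B * A)"
    proof (intro mult_mono)
      show "\<bar>if m \<le> i + k then z^(i+k) else 0\<bar> \<le> \<bar>z\<bar>^m"
        using z by (auto simp: power_abs intro: power_decreasing)
    qed (use A B ik in auto)
    finally show "L2_set (\<lambda>j. (if m \<le> i + k then z^(i+k) else 0) * (a j i * b k)) S \<le> \<bar>z\<bar>^m * (B * A)" .
  qed
  also have "\<dots> = (real m)\<^sup>2 * A * B * \<bar>z\<bar>^m" by (simp add: power2_eq_square)
  finally show ?thesis unfolding truncated_product .
qed

lemma formal_reciprocal_bounded:
  assumes "0 \<le> C"
  shows "\<exists>C'\<ge>0. \<forall>Q::nat \<Rightarrow> real. 4 \<le> Q 0 \<longrightarrow> (\<forall>k<m. \<bar>Q k\<bar> \<le> C) \<longrightarrow>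
    (\<exists>R. (\<forall>k<m. \<bar>R k\<bar> \<le> C') \<and> (\<forall>n<m. (\<Sum>i\<le>n. Q i * R (n-i)) = (if n = 0 then 1 else 0)))"
proof (induction m)
  case 0
  show ?case by (intro exI[of _ 0]) auto
next
  case (Suc m)
  then obtain C' where C': "0 \<le> C'" and ex: "\<And>Q::nat \<Rightarrow> real. 4 \<le> Q 0 \<Longrightarrow> (\<forall>k<m. \<bar>Q k\<bar> \<le> C) \<Longrightarrow>
    (\<exists>R. (\<forall>k<m. \<bar>R k\<bar> \<le> C') \<and> (\<forall>n<m. (\<Sum>i\<le>n. Q i * R (n-i)) = (if n = 0 then 1 else 0)))" by blast
  show ?case
  proof (intro exI[of _ "C' + 1 + real m * (C * C')"] conjI allI impI)
    have nn: "0 \<le> real m * (C * C')" using C' assms by simp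
    then show "0 \<le> C' + 1 + real m * (C * C')" using C' by simp
    fix Q :: "nat \<Rightarrow> real" assume Q0: "4 \<le> Q 0" and Q: "\<forall>k<Suc m. \<bar>Q k\<bar> \<le> C"
    then obtain R where R: "\<And>k. k < m \<Longrightarrow> \<bar>R k\<bar> \<le> C'" "\<And>n. n < m \<Longrightarrow> (\<Sum>i\<le>n. Q i * R (n-i)) = (if n = 0 then 1 else 0)"
      using ex[of Q] by auto
    define s where "s = (\<Sum>i<m. Q (Suc i) * R (m - Suc i))"
    define R' where "R' = R(m := ((if m = 0 then 1 else 0) - s) / Q 0)"
    have "\<bar>s\<bar> \<le> (\<Sum>i<m. C * C')" unfolding s_def
      using Q R(1) assms by (intro order_trans[OF sum_abs] sum_mono) (auto simp: abs_mult intro!: mult_mono)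
    then have "\<bar>(if m = 0 then 1 else 0) - s\<bar> \<le> 1 + real m * (C * C')" by auto
    moreover have "\<bar>((if m = 0 then 1 else 0) - s) / Q 0\<bar> \<le> \<bar>(if m = 0 then 1 else 0) - s\<bar> / 1"
      using Q0 by (simp only: abs_divide, intro frac_le) auto
    ultimately have "\<bar>R' k\<bar> \<le> C' + 1 + real m * (C * C')" if "k < Suc m" for k
      using R(1)[of k] that C' nn by (cases "k = m") (auto simp: R'_def)
    moreover have "(\<Sum>i\<le>n. Q i * R' (n-i)) = (if n = 0 then 1 else 0)" if "n < Suc m" for n
    proof (cases "n = m")
      case False
      then have "n - i \<noteq> m" for i using that by auto
      then have "(\<Sum>i\<le>n. Q i * R' (n-i)) = (\<Sum>i\<le>n. Q i * R (n-i))" by (simp add: R'_def)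
      then show ?thesis using R(2)[of n] that False by simp
    next
      case True
      have "(\<Sum>i\<le>m. Q i * R' (m-i)) = Q 0 * R' m + (\<Sum>i<m. Q (Suc i) * R' (m - Suc i))"
      proof (cases m)
        case (Suc m')
        show ?thesis unfolding Suc by (subst sum.atMost_Suc_shift) (simp add: lessThan_Suc_atMost)
      qed simp
      also have "(\<Sum>i<m. Q (Suc i) * R' (m - Suc i)) = s" unfolding s_def R'_def by (intro sum.cong) auto
      also have "Q 0 * R' m = (if m = 0 then 1 else 0) - s" using Q0 by (simp add: R'_def)
      finally show ?thesis using True by simp
    qed
    ultimately show "\<exists>R. (\<forall>k<Suc m. \<bar>R k\<bar> \<le> C' + 1 + real m * (C * C')) \<and>
       (\<forall>n<Suc m. (\<Sum>i\<le>n. Q i * R (n-i)) = (if n = 0 then 1 else 0))" by blast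
  qed
qed

lemma abs_polynomial_le:
  fixes R :: "nat \<Rightarrow> real"
  assumes "\<bar>z\<bar> \<le> 1" "\<And>k. k < m \<Longrightarrow> \<bar>R k\<bar> \<le> C"
  shows "\<bar>\<Sum>k<m. R k * z^k\<bar> \<le> real m * C"
proof -
  have "\<bar>R k * z^k\<bar> \<le> C" if "k < m" for k
  proof -
    have "\<bar>R k\<bar> * \<bar>z\<bar>^k \<le> C * 1" using assms that power_le_one[of "\<bar>z\<bar>" k]
      by (intro mult_mono) (auto intro: order_trans[OF abs_ge_zero])
    then show ?thesis by (simp add: abs_mult power_abs)
  qed
  then have "(\<Sum>k<m. \<bar>R k * z^k\<bar>) \<le> (\<Sum>k<m. C)" by (intro sum_mono) auto
  then show ?thesis using order_trans[OF sum_abs[of "\<lambda>k. R k * z^k" "{..<m}"]] by simp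
qed

lemma quotient_local_polynomial:
  assumes m: "1 \<le> m" and d: "0 < d" "d \<le> real m" and K: "0 \<le> K" and M: "0 \<le> M"
  shows "\<exists>C\<ge>0. \<forall>(S::nat set) Z \<sigma> B D b \<delta>. Z \<subseteq> {-1..1} \<longrightarrow> \<bar>\<sigma>\<bar> = 1 \<longrightarrow> (\<forall>x\<in>{0..1/2}. \<sigma> * x \<in> Z) \<longrightarrow>
    (\<forall>z\<in>Z. L2_set (\<lambda>j. B j z) S \<le> M \<and> L2_set (\<lambda>j. D j z) S \<le> M \<and> 0 \<le> (\<Sum>j\<in>S. D j z * B j z) \<and>
      L2_set (\<lambda>j. B j z - (\<Sum>k<m. b j k * z^k)) S \<le> K * \<bar>z\<bar> powr d \<and>
      L2_set (\<lambda>j. D j z - (\<Sum>k<m. \<delta> j k * z^k)) S \<le> K * \<bar>z\<bar> powr d) \<longrightarrow>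
    (\<exists>T. \<forall>z\<in>Z. L2_set (\<lambda>j. B j z / (4 + (\<Sum>i\<in>S. D i z * B i z)) - (\<Sum>k<m. T j k * z^k)) S \<le> C * \<bar>z\<bar> powr d)"
proof -
  obtain CA where CA0: "0 \<le> CA" and CA': "\<forall>(S::nat set) \<sigma> b N. \<bar>\<sigma>\<bar> = 1 \<longrightarrow>
    (\<forall>x\<in>{0..1/2}. L2_set (\<lambda>j. \<Sum>k<m. b j k * (\<sigma> * x)^k) S \<le> N) \<longrightarrow>
    (\<forall>k<m. L2_set (\<lambda>j. b j k) S \<le> CA * N)"
    using coefficient_bound_interpolation[OF m] by (elim exE conjE) (rule that)
  note CA = CA0 CA'[rule_format]
  define N where "N = M + K"
  define C1 where "C1 = CA * N"
  define C2 where "C2 = M * K + K * N + (real m)\<^sup>2 * C1\<^sup>2"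
  define CQ where "CQ = 4 + real m * C1\<^sup>2"
  have CQ: "0 \<le> CQ" by (simp add: CQ_def)
  obtain CR where CR0: "0 \<le> CR" and CR': "\<forall>Q::nat \<Rightarrow> real. 4 \<le> Q 0 \<longrightarrow> (\<forall>k<m. \<bar>Q k\<bar> \<le> CQ) \<longrightarrow>
    (\<exists>R. (\<forall>k<m. \<bar>R k\<bar> \<le> CR) \<and> (\<forall>n<m. (\<Sum>i\<le>n. Q i * R (n-i)) = (if n = 0 then 1 else 0)))"
    using formal_reciprocal_bounded[OF CQ, of m] by (elim exE conjE) (rule that)
  note CR = CR0 CR'[rule_format]
  define C3 where "C3 = C2 * (real m * CR) + (real m)\<^sup>2 * CQ * CR"
  define C where "C = M * C3 + K * (real m * CR) + (real m)\<^sup>2 * C1 * CR"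
  have nn: "0 \<le> N" "0 \<le> C1" "0 \<le> C2" "0 \<le> C3" "0 \<le> C"
    using K M CA(1) CR(1) CQ by (auto simp: N_def C1_def C2_def C3_def C_def)
  show ?thesis
  proof (intro exI[of _ C] conjI allI impI)
    show "0 \<le> C" by (rule nn)
    fix S :: "nat set" and Z \<sigma> B D b \<delta>
    assume Z: "Z \<subseteq> {-1..1::real}" and \<sigma>: "\<bar>\<sigma>\<bar> = (1::real)" and \<sigma>Z: "\<forall>x\<in>{0..1/2}. \<sigma> * x \<in> Z"
      and H: "\<forall>z\<in>Z. L2_set (\<lambda>j. B j z) S \<le> M \<and> L2_set (\<lambda>j. D j z) S \<le> M \<and> 0 \<le> (\<Sum>j\<in>S. D j z * B j z) \<and>
      L2_set (\<lambda>j. B j z - (\<Sum>k<m. b j k * z^k)) S \<le> K * \<bar>z\<bar> powr d \<and>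
      L2_set (\<lambda>j. D j z - (\<Sum>k<m. \<delta> j k * z^k)) S \<le> K * \<bar>z\<bar> powr d"
    define P where "P j z = (\<Sum>k<m. b j k * z^k)" for j z
    define E where "E j z = (\<Sum>k<m. \<delta> j k * z^k)" for j z
    define q where "q z = (\<Sum>j\<in>S. D j z * B j z)" for z
    have z1: "\<bar>z\<bar> \<le> 1" if "z \<in> Z" for z using that Z by (auto simp: abs_le_iff)
    have pw1: "\<bar>z\<bar> powr d \<le> 1" if "z \<in> Z" for z using z1[OF that] d by (intro powr_le1) auto
    have pwm: "\<bar>z\<bar>^m \<le> \<bar>z\<bar> powr d" if "z \<in> Z" for z using z1[OF that] d m by (intro abs_power_le_powr)
    have hB: "L2_set (\<lambda>j. B j z) S \<le> M" and hD: "L2_set (\<lambda>j. D j z) S \<le> M" and hq: "0 \<le> q z"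
      and hP: "L2_set (\<lambda>j. B j z - P j z) S \<le> K * \<bar>z\<bar> powr d"
      and hE: "L2_set (\<lambda>j. D j z - E j z) S \<le> K * \<bar>z\<bar> powr d" if "z \<in> Z" for z
      using H that by (auto simp: q_def P_def E_def)
    have bound: "L2_set (\<lambda>j. G j z) S \<le> N"
      if "z \<in> Z" "L2_set (\<lambda>j. F j z) S \<le> M" "L2_set (\<lambda>j. F j z - G j z) S \<le> K * \<bar>z\<bar> powr d" for F G :: "nat \<Rightarrow> real \<Rightarrow> real" and z
    proof -
      have "L2_set (\<lambda>j. G j z) S = L2_set (\<lambda>j. F j z - (F j z - G j z)) S" by simp
      also have "\<dots> \<le> L2_set (\<lambda>j. F j z) S + L2_set (\<lambda>j. F j z - G j z) S" by (rule L2_set_diff_le)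
      also have "\<dots> \<le> M + K * 1" using that pw1[OF that(1)] K by (intro add_mono order_trans[OF that(3)] mult_left_mono) auto
      finally show ?thesis by (simp add: N_def)
    qed
    have bP: "L2_set (\<lambda>j. P j z) S \<le> N" if "z \<in> Z" for z using bound[of z B P] hB hP that by auto
    have bE: "L2_set (\<lambda>j. E j z) S \<le> N" if "z \<in> Z" for z using bound[of z D E] hD hE that by auto
    have cb: "L2_set (\<lambda>j. b j k) S \<le> C1" if "k < m" for k
      using CA(2)[OF \<sigma>, where b = b and S = S and N = N, OF _ that] bP \<sigma>Z by (auto simp: P_def C1_def)
    have c\<delta>: "L2_set (\<lambda>j. \<delta> j k) S \<le> C1" if "k < m" for k
      using CA(2)[OF \<sigma>, where b = \<delta> and S = S and N = N, OF _ that] bE \<sigma>Z by (auto simp: E_def C1_def)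
    have in_bd: "\<bar>\<Sum>j\<in>S. \<delta> j i * b j k\<bar> \<le> C1\<^sup>2" if "i < m" "k < m" for i k
    proof -
      have "\<bar>\<Sum>j\<in>S. \<delta> j i * b j k\<bar> \<le> L2_set (\<lambda>j. \<delta> j i) S * L2_set (\<lambda>j. b j k) S" by (rule abs_inner_le_L2_set)
      also have "\<dots> \<le> C1 * C1" using cb c\<delta> that nn by (intro mult_mono) auto
      finally show ?thesis by (simp add: power2_eq_square)
    qed
    define qc where "qc n = (\<Sum>i\<le>n. \<Sum>j\<in>S. \<delta> j i * b j (n-i))" for n
    have qc_bd: "\<bar>qc n\<bar> \<le> real m * C1\<^sup>2" if "n < m" for n
    proof -
      have "\<bar>qc n\<bar> \<le> (\<Sum>i\<le>n. C1\<^sup>2)" unfolding qc_def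
        using in_bd that by (intro order_trans[OF sum_abs sum_mono]) auto
      also have "\<dots> \<le> real m * C1\<^sup>2" using that by (simp add: mult_right_mono)
      finally show ?thesis .
    qed
    have EP: "\<bar>(\<Sum>j\<in>S. E j z * P j z) - (\<Sum>n<m. qc n * z^n)\<bar> \<le> (real m)\<^sup>2 * C1\<^sup>2 * \<bar>z\<bar>^m" if "z \<in> Z" for z
    proof -
      have "qc n * z^n = (\<Sum>j\<in>S. (\<Sum>i\<le>n. \<delta> j i * b j (n-i)) * z^n)" for n
        unfolding qc_def sum_distrib_right[symmetric] by (subst sum.swap) simp
      then have "(\<Sum>n<m. qc n * z^n) = (\<Sum>n<m. \<Sum>j\<in>S. (\<Sum>i\<le>n. \<delta> j i * b j (n-i)) * z^n)" by simp
      also have "\<dots> = (\<Sum>j\<in>S. \<Sum>n<m. (\<Sum>i\<le>n. \<delta> j i * b j (n-i)) * z^n)" by (rule sum.swap)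
      finally have "(\<Sum>j\<in>S. E j z * P j z) - (\<Sum>n<m. qc n * z^n) =
        (\<Sum>j\<in>S. \<Sum>i<m. \<Sum>k<m. (if m \<le> i + k then z^(i+k) else 0) * (\<delta> j i * b j k))"
        by (simp add: sum_subtractf[symmetric] E_def P_def truncated_product)
      also have "\<dots> = (\<Sum>i<m. \<Sum>j\<in>S. \<Sum>k<m. (if m \<le> i + k then z^(i+k) else 0) * (\<delta> j i * b j k))"
        by (rule sum.swap)
      also have "\<dots> = (\<Sum>i<m. \<Sum>k<m. \<Sum>j\<in>S. (if m \<le> i + k then z^(i+k) else 0) * (\<delta> j i * b j k))"
        by (rule sum.cong[OF refl]) (rule sum.swap)
      also have "\<dots> = (\<Sum>i<m. \<Sum>k<m. (if m \<le> i + k then z^(i+k) else 0) * (\<Sum>j\<in>S. \<delta> j i * b j k))"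
        by (simp only: sum_distrib_left)
      also have "\<bar>\<dots>\<bar> \<le> (\<Sum>i<m. \<Sum>k<m. \<bar>z\<bar>^m * C1\<^sup>2)"
      proof (intro order_trans[OF sum_abs] sum_mono)
        fix i k assume ik: "i \<in> {..<m}" "k \<in> {..<m}"
        show "\<bar>(if m \<le> i + k then z^(i+k) else 0) * (\<Sum>j\<in>S. \<delta> j i * b j k)\<bar> \<le> \<bar>z\<bar>^m * C1\<^sup>2"
          unfolding abs_mult
        proof (intro mult_mono)
          show "\<bar>if m \<le> i + k then z^(i+k) else 0\<bar> \<le> \<bar>z\<bar>^m"
            using z1[OF that] by (auto simp: power_abs intro: power_decreasing)
        qed (use in_bd ik in auto)
      qed
      finally show ?thesis by (simp add: power2_eq_square mult_ac)
    qed
    have q_err: "\<bar>q z - (\<Sum>n<m. qc n * z^n)\<bar> \<le> C2 * \<bar>z\<bar> powr d" if "z \<in> Z" for z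
    proof -
      have "q z - (\<Sum>j\<in>S. E j z * P j z) = (\<Sum>j\<in>S. D j z * (B j z - P j z)) + (\<Sum>j\<in>S. (D j z - E j z) * P j z)"
        by (simp add: q_def sum_subtractf[symmetric] sum.distrib[symmetric] algebra_simps)
      also have "\<bar>\<dots>\<bar> \<le> L2_set (\<lambda>j. D j z) S * L2_set (\<lambda>j. B j z - P j z) S + L2_set (\<lambda>j. D j z - E j z) S * L2_set (\<lambda>j. P j z) S"
        by (intro order_trans[OF abs_triangle_ineq] add_mono abs_inner_le_L2_set)
      also have "\<dots> \<le> M * (K * \<bar>z\<bar> powr d) + (K * \<bar>z\<bar> powr d) * N"
        using hB hD hP hE bP that M K by (intro add_mono mult_mono) auto
      finally have "\<bar>q z - (\<Sum>j\<in>S. E j z * P j z)\<bar> \<le> (M * K + K * N) * \<bar>z\<bar> powr d" by (simp add: algebra_simps)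
      moreover have "(real m)\<^sup>2 * C1\<^sup>2 * \<bar>z\<bar>^m \<le> (real m)\<^sup>2 * C1\<^sup>2 * \<bar>z\<bar> powr d"
        using pwm[OF that] by (intro mult_left_mono) auto
      moreover note EP[OF that]
      ultimately have "\<bar>q z - (\<Sum>n<m. qc n * z^n)\<bar> \<le> (M * K + K * N) * \<bar>z\<bar> powr d + (real m)\<^sup>2 * C1\<^sup>2 * \<bar>z\<bar> powr d"
        by linarith
      then show ?thesis by (simp add: C2_def distrib_right)
    qed
    define Q where "Q n = qc n + (if n = 0 then 4 else 0)" for n
    have Qsum: "(\<Sum>n<m. Q n * z^n) = 4 + (\<Sum>n<m. qc n * z^n)" for z :: real
    proof -
      have "(\<Sum>n<m. (if n = 0 then 4 else 0) * z^n) = (\<Sum>n<m. if n = 0 then 4 else 0)" by (intro sum.cong) auto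
      also have "\<dots> = 4" using m by simp
      finally show ?thesis by (simp add: Q_def distrib_right sum.distrib)
    qed
    have "0 \<in> Z" using \<sigma>Z[rule_format, of 0] by simp
    moreover have "(\<Sum>n<m. qc n * 0^n) = qc 0"
    proof -
      have "(\<Sum>n<m. qc n * 0^n) = (\<Sum>n<m. if n = 0 then qc n else 0)" by (intro sum.cong) auto
      then show ?thesis using m by simp
    qed
    ultimately have Q0: "4 \<le> Q 0" using q_err[of 0] hq[of 0] d by (simp add: Q_def)
    have "\<forall>k<m. \<bar>Q k\<bar> \<le> CQ"
    proof (intro allI impI)
      fix k assume "k < m"
      have "\<bar>Q k\<bar> \<le> \<bar>qc k\<bar> + 4" unfolding Q_def by auto
      then show "\<bar>Q k\<bar> \<le> CQ" using qc_bd[OF \<open>k < m\<close>] by (simp add: CQ_def)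
    qed
    note Qbd = this
    obtain R where R: "\<forall>k<m. \<bar>R k\<bar> \<le> CR" "\<forall>n<m. (\<Sum>i\<le>n. Q i * R (n-i)) = (if n = 0 then 1 else 0)"
      using CR(2)[of Q] Q0 Qbd by blast
    define Rz where "Rz z = (\<Sum>k<m. R k * z^k)" for z
    have Rz: "\<bar>Rz z\<bar> \<le> real m * CR" if "z \<in> Z" for z
      unfolding Rz_def using z1[OF that] R(1) by (intro abs_polynomial_le) auto
    have QR: "\<bar>(\<Sum>n<m. Q n * z^n) * Rz z - 1\<bar> \<le> (real m)\<^sup>2 * CQ * CR * \<bar>z\<bar> powr d" if "z \<in> Z" for z
    proof -
      have "(\<Sum>n<m. (\<Sum>i\<le>n. Q i * R (n-i)) * z^n) = (\<Sum>n<m. if n = 0 then 1 else 0)"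
        using R(2) by (intro sum.cong) auto
      also have "\<dots> = 1" using m by simp
      finally have one: "(\<Sum>n<m. (\<Sum>i\<le>n. Q i * R (n-i)) * z^n) = 1" .
      have "L2_set (\<lambda>j. (\<Sum>i<m. Q i * z^i) * (\<Sum>k<m. R k * z^k) - (\<Sum>n<m. (\<Sum>i\<le>n. Q i * R (n-i)) * z^n)) {0::nat}
        \<le> (real m)\<^sup>2 * CQ * CR * \<bar>z\<bar>^m"
        using Qbd R(1) CR(1) z1[OF that] by (intro truncated_product_bound[of z m "\<lambda>_. Q"]) auto
      also have "\<dots> \<le> (real m)\<^sup>2 * CQ * CR * \<bar>z\<bar> powr d"
        using pwm[OF that] CQ CR(1) by (intro mult_left_mono) auto
      finally show ?thesis by (simp add: one Rz_def)
    qed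
    have inv_err: "\<bar>1 / (4 + q z) - Rz z\<bar> \<le> C3 * \<bar>z\<bar> powr d" if "z \<in> Z" for z
    proof -
      have "(4 + q z) * Rz z - 1 = (q z - (\<Sum>n<m. qc n * z^n)) * Rz z + ((\<Sum>n<m. Q n * z^n) * Rz z - 1)"
        by (simp add: Qsum algebra_simps)
      also have "\<bar>\<dots>\<bar> \<le> (C2 * \<bar>z\<bar> powr d) * (real m * CR) + (real m)\<^sup>2 * CQ * CR * \<bar>z\<bar> powr d"
        using q_err[OF that] Rz[OF that] QR[OF that] nn
        by (intro order_trans[OF abs_triangle_ineq] add_mono) (auto simp: abs_mult intro!: mult_mono)
      finally have le: "\<bar>(4 + q z) * Rz z - 1\<bar> \<le> C3 * \<bar>z\<bar> powr d" by (simp add: C3_def algebra_simps)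
      have "1 / (4 + q z) - Rz z = - (((4 + q z) * Rz z - 1) / (4 + q z))" using hq[OF that] by (simp add: field_simps)
      then have "\<bar>1 / (4 + q z) - Rz z\<bar> = \<bar>(4 + q z) * Rz z - 1\<bar> / (4 + q z)" using hq[OF that] by simp
      also have "\<dots> \<le> \<bar>(4 + q z) * Rz z - 1\<bar> / 1" using hq[OF that] by (intro frac_le) auto
      finally show ?thesis using le by simp
    qed
    define T where "T j n = (\<Sum>i\<le>n. b j i * R (n-i))" for j n
    have "L2_set (\<lambda>j. B j z / (4 + q z) - (\<Sum>k<m. T j k * z^k)) S \<le> C * \<bar>z\<bar> powr d" if "z \<in> Z" for z
    proof -
      have "L2_set (\<lambda>j. B j z / (4 + q z) - (\<Sum>k<m. T j k * z^k)) S =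
        L2_set (\<lambda>j. ((1 / (4 + q z) - Rz z) * B j z + Rz z * (B j z - P j z)) + (P j z * Rz z - (\<Sum>k<m. T j k * z^k))) S"
        by (simp add: algebra_simps)
      also have "\<dots> \<le> (L2_set (\<lambda>j. (1 / (4 + q z) - Rz z) * B j z) S + L2_set (\<lambda>j. Rz z * (B j z - P j z)) S)
        + L2_set (\<lambda>j. P j z * Rz z - (\<Sum>k<m. T j k * z^k)) S"
        by (intro order_trans[OF L2_set_triangle_ineq] add_mono order_refl)
      also have "\<dots> \<le> (C3 * \<bar>z\<bar> powr d * M + (real m * CR) * (K * \<bar>z\<bar> powr d)) + (real m)\<^sup>2 * C1 * CR * \<bar>z\<bar> powr d"
      proof (intro add_mono)
        show "L2_set (\<lambda>j. (1 / (4 + q z) - Rz z) * B j z) S \<le> C3 * \<bar>z\<bar> powr d * M"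
          unfolding L2_set_cmult using inv_err[OF that] hB[OF that] nn by (intro mult_mono) auto
        show "L2_set (\<lambda>j. Rz z * (B j z - P j z)) S \<le> (real m * CR) * (K * \<bar>z\<bar> powr d)"
          unfolding L2_set_cmult using Rz[OF that] hP[OF that] CR(1) by (intro mult_mono) auto
        have "L2_set (\<lambda>j. P j z * Rz z - (\<Sum>k<m. T j k * z^k)) S \<le> (real m)\<^sup>2 * C1 * CR * \<bar>z\<bar>^m"
          unfolding P_def Rz_def T_def using cb R(1) CR(1) z1[OF that] by (intro truncated_product_bound) auto
        also have "\<dots> \<le> (real m)\<^sup>2 * C1 * CR * \<bar>z\<bar> powr d"
          using pwm[OF that] nn CR(1) by (intro mult_left_mono) auto
        finally show "L2_set (\<lambda>j. P j z * Rz z - (\<Sum>k<m. T j k * z^k)) S \<le> (real m)\<^sup>2 * C1 * CR * \<bar>z\<bar> powr d" .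
      qed
      also have "\<dots> = C * \<bar>z\<bar> powr d" by (simp add: C_def algebra_simps)
      finally show ?thesis .
    qed
    then show "\<exists>T. \<forall>z\<in>Z. L2_set (\<lambda>j. B j z / (4 + (\<Sum>i\<in>S. D i z * B i z)) - (\<Sum>k<m. T j k * z^k)) S \<le> C * \<bar>z\<bar> powr d"
      unfolding q_def by blast
  qed
qed

definition locally_polynomial :: "nat \<Rightarrow> real \<Rightarrow> real \<Rightarrow> (real \<Rightarrow> real) \<Rightarrow> bool" where
  "locally_polynomial m d K f \<longleftrightarrow>
    (\<forall>x0\<in>{0..1}. \<exists>c. \<forall>x\<in>{0..1}. \<bar>f x - (\<Sum>k<m. c k * (x - x0)^k)\<bar> \<le> K * \<bar>x - x0\<bar> powr d)"

lemma locally_polynomial_scaled: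
  fixes \<beta> :: "nat \<Rightarrow> real \<Rightarrow> real"
  assumes "finite S" and lp: "\<forall>j\<in>S. locally_polynomial m d K (\<beta> j)" and u: "u \<in> {0..1}" and H: "0 < H"
    and Hd: "sqrt (real (card S)) * H powr d = 1" and K: "0 \<le> K"
  obtains b where "\<And>z. u + H * z \<in> {0..1} \<Longrightarrow>
    L2_set (\<lambda>j. \<beta> j (u + H * z) - (\<Sum>k<m. b j k * z^k)) S \<le> K * \<bar>z\<bar> powr d"
proof -
  have "\<forall>j\<in>S. \<exists>c. \<forall>x\<in>{0..1}. \<bar>\<beta> j x - (\<Sum>k<m. c k * (x - u)^k)\<bar> \<le> K * \<bar>x - u\<bar> powr d"
    using lp u unfolding locally_polynomial_def by blast
  from bchoice[OF this] obtain c where c: "\<forall>j\<in>S. \<forall>x\<in>{0..1}. \<bar>\<beta> j x - (\<Sum>k<m. c j k * (x - u)^k)\<bar> \<le> K * \<bar>x - u\<bar> powr d"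
    by (rule exE)
  show thesis
  proof (rule that[of "\<lambda>j k. c j k * H^k"])
    fix z assume z: "u + H * z \<in> {0..1}"
    have "L2_set (\<lambda>j. \<beta> j (u + H * z) - (\<Sum>k<m. c j k * H^k * z^k)) S \<le> L2_set (\<lambda>j. K * (H powr d * \<bar>z\<bar> powr d)) S"
    proof (rule L2_set_abs_mono)
      fix j assume "j \<in> S"
      then have "\<bar>\<beta> j (u + H * z) - (\<Sum>k<m. c j k * (H * z)^k)\<bar> \<le> K * \<bar>H * z\<bar> powr d"
        using c[rule_format, of j "u + H * z"] z by simp
      also have "\<bar>H * z\<bar> powr d = H powr d * \<bar>z\<bar> powr d" using H by (simp add: abs_mult powr_mult)
      finally show "\<bar>\<beta> j (u + H * z) - (\<Sum>k<m. c j k * H^k * z^k)\<bar> \<le> \<bar>K * (H powr d * \<bar>z\<bar> powr d)\<bar>"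
        using K by (simp add: power_mult_distrib mult.assoc)
    qed
    also have "\<dots> = (sqrt (real (card S)) * H powr d) * (K * \<bar>z\<bar> powr d)"
      using K by (simp add: L2_set_constant)
    also have "\<dots> = K * \<bar>z\<bar> powr d" by (simp add: Hd)
    finally show "L2_set (\<lambda>j. \<beta> j (u + H * z) - (\<Sum>k<m. c j k * H^k * z^k)) S \<le> K * \<bar>z\<bar> powr d" .
  qed
qed

lemma spline_quotient_approximation:
  assumes m: "1 \<le> m" and d: "0 < d" "d \<le> real m" and K: "0 \<le> K" and M: "0 \<le> M"
  shows "\<exists>C\<ge>0. \<forall>(S::nat set) L xi \<beta> \<delta>. quasi_uniform m L cq xi \<longrightarrow> finite S \<longrightarrow> S \<noteq> {} \<longrightarrow>
    (\<forall>j\<in>S. locally_polynomial m d K (\<beta> j)) \<longrightarrow> (\<forall>j\<in>S. locally_polynomial m d K (\<delta> j)) \<longrightarrow>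
    (\<forall>u\<in>{0..1}. L2_set (\<lambda>j. \<beta> j u) S \<le> M \<and> L2_set (\<lambda>j. \<delta> j u) S \<le> M \<and> 0 \<le> (\<Sum>j\<in>S. \<delta> j u * \<beta> j u)) \<longrightarrow>
    (\<exists>g. \<forall>u\<in>{0..1}. L2_set (\<lambda>j. \<beta> j u / (4 + (\<Sum>i\<in>S. \<delta> i u * \<beta> i u)) -
        (\<Sum>i<L. g j i * bspl (knots m (L - m) xi) i m u)) S \<le> C * sqrt (real (card S)) * real L powr (- d))"
proof -
  obtain Cw where Cw: "0 \<le> Cw" and w_ex: "\<forall>tk L. clamped_knots tk m L \<longrightarrow>
    (\<exists>w. (\<forall>i<L. \<forall>a<m. \<bar>w i a\<bar> \<le> Cw) \<and> reproduces_polynomials tk m L w)"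
    using quasi_interpolant_weights[OF m] by (elim exE conjE) (rule that)
  obtain CT where CT: "0 \<le> CT" and T_ex: "\<forall>(S::nat set) Z \<sigma> B D b \<delta>. Z \<subseteq> {-1..1} \<longrightarrow> \<bar>\<sigma>\<bar> = 1 \<longrightarrow> (\<forall>x\<in>{0..1/2}. \<sigma> * x \<in> Z) \<longrightarrow>
    (\<forall>z\<in>Z. L2_set (\<lambda>j. B j z) S \<le> M \<and> L2_set (\<lambda>j. D j z) S \<le> M \<and> 0 \<le> (\<Sum>j\<in>S. D j z * B j z) \<and>
      L2_set (\<lambda>j. B j z - (\<Sum>k<m. b j k * z^k)) S \<le> K * \<bar>z\<bar> powr d \<and>
      L2_set (\<lambda>j. D j z - (\<Sum>k<m. \<delta> j k * z^k)) S \<le> K * \<bar>z\<bar> powr d) \<longrightarrow>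
    (\<exists>T. \<forall>z\<in>Z. L2_set (\<lambda>j. B j z / (4 + (\<Sum>i\<in>S. D i z * B i z)) - (\<Sum>k<m. T j k * z^k)) S \<le> CT * \<bar>z\<bar> powr d)"
    using quotient_local_polynomial[OF m d K M] by (elim exE conjE) (rule that)
  define \<rho>0 where "\<rho>0 = cq * (real m)\<^sup>2"
  define C where "C = (real m * Cw * CT + M) * \<rho>0 powr d"
  show ?thesis
  proof (intro exI[of _ C] conjI allI impI)
    show "0 \<le> C" using Cw CT M by (simp add: C_def)
    fix S :: "nat set" and L :: nat and xi :: "nat \<Rightarrow> real" and \<beta> \<delta> :: "nat \<Rightarrow> real \<Rightarrow> real"
    assume qu: "quasi_uniform m L cq xi" and S: "finite S" "S \<noteq> {}"
      and lp\<beta>: "\<forall>j\<in>S. locally_polynomial m d K (\<beta> j)" and lp\<delta>: "\<forall>j\<in>S. locally_polynomial m d K (\<delta> j)"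
      and bd: "\<forall>u\<in>{0..1}. L2_set (\<lambda>j. \<beta> j u) S \<le> M \<and> L2_set (\<lambda>j. \<delta> j u) S \<le> M \<and> 0 \<le> (\<Sum>j\<in>S. \<delta> j u * \<beta> j u)"
    define tk where "tk = knots m (L - m) xi"
    have ck: "clamped_knots tk m L" and cq: "0 \<le> cq" and width: "\<And>i. tk (i + m) - tk i \<le> \<rho>0 / real L"
      using quasi_uniform_clamped_knots[OF m qu] unfolding tk_def \<rho>0_def by auto
    interpret clamped_knots tk m L by (rule ck)
    have L: "0 < real L" using order_pos order_le by simp
    define s where "s = real (card S)"
    have s: "1 \<le> s" using S by (simp add: s_def Suc_leI card_gt_0_iff)
    define H where "H = s powr (- 1 / (2 * d))"
    have H: "0 < H" "H \<le> 1" using s d powr_mono[of "- 1 / (2 * d)" 0 s] by (auto simp: H_def)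
    have "H powr d = s powr (- (1/2))" using d by (simp add: H_def powr_powr)
    then have Hd': "H powr d = 1 / sqrt s" using s by (simp add: powr_minus_divide powr_half_sqrt)
    then have Hd: "sqrt s * H powr d = 1" using s by simp
    define \<rho> where "\<rho> = \<rho>0 / real L"
    have \<rho>: "0 \<le> \<rho>" using cq L by (simp add: \<rho>_def \<rho>0_def)
    have ratio: "(\<rho> / H) powr d = \<rho>0 powr d * sqrt s * real L powr (- d)"
    proof -
      have "(\<rho> / H) powr d = \<rho> powr d / H powr d" using \<rho> H by (simp add: powr_divide)
      also have "\<dots> = \<rho> powr d * sqrt s" by (simp add: Hd')
      also have "\<rho> powr d = \<rho>0 powr d * real L powr (- d)"
        unfolding \<rho>_def using cq L by (simp add: powr_divide \<rho>0_def powr_minus_divide)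
      finally show ?thesis by simp
    qed
    define \<theta> where "\<theta> j u = \<beta> j u / (4 + (\<Sum>i\<in>S. \<delta> i u * \<beta> i u))" for j u
    show "\<exists>g. \<forall>u\<in>{0..1}. L2_set (\<lambda>j. \<beta> j u / (4 + (\<Sum>i\<in>S. \<delta> i u * \<beta> i u)) -
        (\<Sum>i<L. g j i * bspl (knots m (L - m) xi) i m u)) S \<le> C * sqrt (real (card S)) * real L powr (- d)"
      unfolding tk_def[symmetric] \<theta>_def[symmetric] s_def[symmetric]
    proof (cases "\<rho> \<le> H")
      case False
      have "L2_set (\<lambda>j. \<theta> j u) S \<le> C * sqrt s * real L powr (- d)" if u: "u \<in> {0..1}" for u
      proof -
        have q: "0 \<le> (\<Sum>i\<in>S. \<delta> i u * \<beta> i u)" using bd u by blast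
        have "\<bar>\<theta> j u\<bar> \<le> \<bar>\<beta> j u\<bar>" for j
        proof -
          have "\<bar>\<theta> j u\<bar> = \<bar>\<beta> j u\<bar> / (4 + (\<Sum>i\<in>S. \<delta> i u * \<beta> i u))" using q by (simp add: \<theta>_def)
          also have "\<dots> \<le> \<bar>\<beta> j u\<bar> / 1" using q by (intro frac_le) auto
          finally show ?thesis by simp
        qed
        then have "L2_set (\<lambda>j. \<theta> j u) S \<le> L2_set (\<lambda>j. \<beta> j u) S" by (rule L2_set_abs_mono)
        also have "\<dots> \<le> M * 1" using bd u by simp
        also have "\<dots> \<le> M * (\<rho> / H) powr d"
          using False H \<rho> d M by (intro mult_left_mono ge_one_powr_ge_zero) auto
        also have "\<dots> \<le> (real m * Cw * CT + M) * (\<rho> / H) powr d" using Cw CT by (intro mult_right_mono) auto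
        finally show ?thesis by (simp add: ratio C_def mult_ac)
      qed
      then show "\<exists>g. \<forall>u\<in>{0..1}. L2_set (\<lambda>j. \<theta> j u - (\<Sum>i<L. g j i * bspl tk i m u)) S \<le> C * sqrt s * real L powr (- d)"
        by (intro exI[of _ "\<lambda>_ _. 0"]) simp
    next
      case True
      obtain w where w: "\<forall>i<L. \<forall>a<m. \<bar>w i a\<bar> \<le> Cw" and rep: "reproduces_polynomials tk m L w"
        using w_ex[rule_format, OF ck] by (elim exE conjE) (rule that)
      define g where "g j i = (\<Sum>a<m. w i a * \<theta> j (node i a))" for j i
      have "L2_set (\<lambda>j. \<theta> j u - (\<Sum>i<L. g j i * bspl tk i m u)) S \<le> C * sqrt s * real L powr (- d)"
        if u: "u \<in> {0..1}" for u
      proof -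
        obtain b where b: "\<And>z. u + H * z \<in> {0..1} \<Longrightarrow> L2_set (\<lambda>j. \<beta> j (u + H * z) - (\<Sum>k<m. b j k * z^k)) S \<le> K * \<bar>z\<bar> powr d"
          using locally_polynomial_scaled[OF S(1) lp\<beta> u H(1) Hd[unfolded s_def] K] by blast
        obtain b' where b': "\<And>z. u + H * z \<in> {0..1} \<Longrightarrow> L2_set (\<lambda>j. \<delta> j (u + H * z) - (\<Sum>k<m. b' j k * z^k)) S \<le> K * \<bar>z\<bar> powr d"
          using locally_polynomial_scaled[OF S(1) lp\<delta> u H(1) Hd[unfolded s_def] K] by blast
        define Z where "Z = {z \<in> {-1..1}. u + H * z \<in> {0..1}}"
        define \<sigma> :: real where "\<sigma> = (if u \<le> 1/2 then 1 else -1)"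
        have "u + H * (\<sigma> * x) \<in> {0..1} \<and> \<sigma> * x \<in> {-1..1}" if "x \<in> {0..1/2}" for x
        proof -
          have "0 \<le> H * x" "H * x \<le> 1 * (1/2)" using that H by (simp, intro mult_mono) auto
          then show ?thesis using that u by (auto simp: \<sigma>_def)
        qed
        then have \<sigma>Z: "\<forall>x\<in>{0..1/2}. \<sigma> * x \<in> Z" by (auto simp: Z_def)
        have "\<exists>T. \<forall>z\<in>Z. L2_set (\<lambda>j. \<beta> j (u + H * z) / (4 + (\<Sum>i\<in>S. \<delta> i (u + H * z) * \<beta> i (u + H * z))) - (\<Sum>k<m. T j k * z^k)) S
          \<le> CT * \<bar>z\<bar> powr d"
        proof (rule T_ex[rule_format, OF _ _ \<sigma>Z[rule_format], where b = b and \<delta> = b'])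
          show "Z \<subseteq> {-1..1}" by (auto simp: Z_def)
          show "\<bar>\<sigma>\<bar> = 1" by (simp add: \<sigma>_def)
          fix z assume "z \<in> Z"
          then have z: "u + H * z \<in> {0..1}" by (simp add: Z_def)
          then show "L2_set (\<lambda>j. \<beta> j (u + H * z)) S \<le> M \<and> L2_set (\<lambda>j. \<delta> j (u + H * z)) S \<le> M \<and>
            0 \<le> (\<Sum>j\<in>S. \<delta> j (u + H * z) * \<beta> j (u + H * z)) \<and>
            L2_set (\<lambda>j. \<beta> j (u + H * z) - (\<Sum>k<m. b j k * z^k)) S \<le> K * \<bar>z\<bar> powr d \<and>
            L2_set (\<lambda>j. \<delta> j (u + H * z) - (\<Sum>k<m. b' j k * z^k)) S \<le> K * \<bar>z\<bar> powr d"
            using bd[rule_format, OF z] b[OF z] b'[OF z] by simp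
        qed auto
        then obtain T where T: "\<And>z. z \<in> Z \<Longrightarrow> L2_set (\<lambda>j. \<theta> j (u + H * z) - (\<Sum>k<m. T j k * z^k)) S \<le> CT * \<bar>z\<bar> powr d"
          unfolding \<theta>_def by blast
        define P where "P j x = (\<Sum>k<m. (T j k / H^k) * (x - u)^k)" for j x
        have TP: "L2_set (\<lambda>j. \<theta> j x - P j x) S \<le> CT * (\<bar>x - u\<bar> / H) powr d" if x: "x \<in> {0..1}" "\<bar>x - u\<bar> \<le> H" for x
        proof -
          have zZ: "(x - u) / H \<in> Z" using x H by (auto simp: Z_def abs_le_iff field_simps)
          have "u + H * ((x - u) / H) = x" using H by simp
          moreover have "(\<Sum>k<m. T j k * ((x - u) / H)^k) = P j x" for j
            unfolding P_def by (intro sum.cong) (auto simp: power_divide)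
          ultimately show ?thesis using T[OF zZ] H by simp
        qed
        have B1: "(\<Sum>i<L. bspl tk i m u) = 1" using bspl_partition_of_unity u by simp
        have eq: "\<theta> j u - (\<Sum>i<L. g j i * bspl tk i m u) =
          (\<theta> j u - P j u) - (\<Sum>i<L. bspl tk i m u * (\<Sum>a<m. w i a * (\<theta> j (node i a) - P j (node i a))))" for j
        proof -
          have "(\<Sum>i<L. (\<Sum>a<m. w i a * P j (node i a)) * bspl tk i m u) = P j u"
            unfolding P_def by (rule rep[unfolded reproduces_polynomials_def, rule_format]) (use u in auto)
          then show ?thesis
            by (simp add: g_def right_diff_distrib sum_subtractf mult.commute)
        qed
        have node_bd: "L2_set (\<lambda>j. bspl tk i m u * (\<Sum>a<m. w i a * (\<theta> j (node i a) - P j (node i a)))) S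
          \<le> bspl tk i m u * (real m * (Cw * (CT * (\<rho> / H) powr d)))" if i: "i < L" for i
        proof (cases "bspl tk i m u = 0")
          case True
          then show ?thesis by (simp add: L2_set_0')
        next
          case False
          then have su: "tk i \<le> u" "u \<le> tk (i + m)" using bspl_support[OF mono_knots] by blast+
          have "L2_set (\<lambda>j. \<Sum>a<m. w i a * (\<theta> j (node i a) - P j (node i a))) S
            \<le> (\<Sum>a<m. L2_set (\<lambda>j. w i a * (\<theta> j (node i a) - P j (node i a))) S)" by (rule L2_set_sum_le) simp
          also have "\<dots> \<le> (\<Sum>a<m. Cw * (CT * (\<rho> / H) powr d))"
            unfolding L2_set_cmult
          proof (intro sum_mono mult_mono)
            fix a assume a: "a \<in> {..<m}"
            then have n: "tk i \<le> node i a" "node i a \<le> tk (i + m)" using node_range by auto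
            then have dn: "\<bar>node i a - u\<bar> \<le> \<rho>" using su width[of i] by (auto simp: \<rho>_def abs_le_iff)
            have "node i a \<in> {0..1}" using n knots_range[of i] knots_range[of "i + m"] by auto
            then have "L2_set (\<lambda>j. \<theta> j (node i a) - P j (node i a)) S \<le> CT * (\<bar>node i a - u\<bar> / H) powr d"
              using dn \<open>\<rho> \<le> H\<close> by (intro TP) auto
            also have "\<dots> \<le> CT * (\<rho> / H) powr d"
              using dn H d CT by (intro mult_left_mono powr_mono2 divide_right_mono) auto
            finally show "L2_set (\<lambda>j. \<theta> j (node i a) - P j (node i a)) S \<le> CT * (\<rho> / H) powr d" .
            show "\<bar>w i a\<bar> \<le> Cw" using w i a by simp
          qed (use Cw in auto)
          also have "\<dots> = real m * (Cw * (CT * (\<rho> / H) powr d))" by simp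
          finally show ?thesis unfolding L2_set_cmult using bspl_nonneg[OF mono_knots, of i m u]
            by (simp add: mult_left_mono)
        qed
        have "L2_set (\<lambda>j. \<theta> j u - (\<Sum>i<L. g j i * bspl tk i m u)) S \<le> L2_set (\<lambda>j. \<theta> j u - P j u) S
          + L2_set (\<lambda>j. \<Sum>i<L. bspl tk i m u * (\<Sum>a<m. w i a * (\<theta> j (node i a) - P j (node i a)))) S"
          unfolding eq by (rule L2_set_diff_le)
        also have "\<dots> \<le> 0 + (\<Sum>i<L. bspl tk i m u * (real m * (Cw * (CT * (\<rho> / H) powr d))))"
        proof (intro add_mono)
          show "L2_set (\<lambda>j. \<theta> j u - P j u) S \<le> 0" using TP[OF u] H by simp
          show "L2_set (\<lambda>j. \<Sum>i<L. bspl tk i m u * (\<Sum>a<m. w i a * (\<theta> j (node i a) - P j (node i a)))) S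
            \<le> (\<Sum>i<L. bspl tk i m u * (real m * (Cw * (CT * (\<rho> / H) powr d))))"
            using node_bd by (intro order_trans[OF L2_set_sum_le sum_mono]) auto
        qed
        also have "\<dots> = real m * Cw * CT * (\<rho> / H) powr d"
          unfolding sum_distrib_right[symmetric] B1 by simp
        also have "\<dots> \<le> (real m * Cw * CT + M) * (\<rho> / H) powr d" using M by (intro mult_right_mono) auto
        finally show ?thesis by (simp add: ratio C_def mult_ac)
      qed
      then show "\<exists>g. \<forall>u\<in>{0..1}. L2_set (\<lambda>j. \<theta> j u - (\<Sum>i<L. g j i * bspl tk i m u)) S \<le> C * sqrt s * real L powr (- d)"
        by blast
    qed
  qed
qed

section \<open>Quadratic forms and Gaussian integrals\<close>

lemma quadratic_nonneg_imp_linear_coeff_zero: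
  fixes b c :: real
  assumes "\<And>s. 0 \<le> 2 * s * b + s\<^sup>2 * c"
  shows "b = 0"
proof (rule ccontr)
  assume b: "b \<noteq> 0"
  have c: "0 \<le> c" using assms[of 1] assms[of "-1"] by simp
  define s where "s = - b / (c + 1)"
  have "b = - s * (c + 1)" using c by (simp add: s_def)
  then have "2 * s * b + s\<^sup>2 * c = 2 * s * (- s * (c + 1)) + s\<^sup>2 * c" by simp
  also have "\<dots> = - (s\<^sup>2 * (c + 2))" by (simp add: power2_eq_square algebra_simps)
  finally have "2 * s * b + s\<^sup>2 * c = - (s\<^sup>2 * (c + 2))" .
  moreover have "0 < s\<^sup>2 * (c + 2)" using b c by (auto simp: s_def intro!: mult_pos_pos)
  ultimately show False using assms[of s] by linarith
qed

definition qform :: "nat \<Rightarrow> (nat \<Rightarrow> nat \<Rightarrow> real) \<Rightarrow> (nat \<Rightarrow> real) \<Rightarrow> (nat \<Rightarrow> real) \<Rightarrow> real" where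
  "qform p A v w = (\<Sum>i<p. \<Sum>j<p. A i j * v i * w j)"

lemma qform_add_left: "qform p A (\<lambda>i. v i + v' i) w = qform p A v w + qform p A v' w"
  by (simp add: qform_def algebra_simps sum.distrib)

lemma qform_add_right: "qform p A v (\<lambda>i. w i + w' i) = qform p A v w + qform p A v w'"
  by (simp add: qform_def algebra_simps sum.distrib)

lemma qform_scale_left: "qform p A (\<lambda>i. c * v i) w = c * qform p A v w"
  by (simp add: qform_def sum_distrib_left algebra_simps)

lemma qform_scale_right: "qform p A v (\<lambda>i. c * w i) = c * qform p A v w"
  by (simp add: qform_def sum_distrib_left algebra_simps)

lemma qform_sym:
  assumes "\<And>i j. i < p \<Longrightarrow> j < p \<Longrightarrow> A i j = A j i"
  shows "qform p A v w = qform p A w v"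
  unfolding qform_def by (subst sum.swap) (intro sum.cong refl, use assms in \<open>auto simp: algebra_simps\<close>)

lemma qform_left_sum: "qform p A v w = (\<Sum>i<p. v i * (\<Sum>j<p. A i j * w j))"
  by (simp add: qform_def sum_distrib_left algebra_simps)

lemma unit_sphere_compact:
  "compact {x::nat \<Rightarrow> real. (\<forall>i\<ge>p. x i = 0) \<and> (\<Sum>i<p. (x i)\<^sup>2) = 1}"
proof -
  define X where "X = (\<Pi>\<^sub>E i\<in>UNIV. if i < p then {-1..1::real} else {0})"
  have cX: "compact X"
  proof -
    have "compactin (product_topology (\<lambda>i::nat. euclidean::real topology) UNIV) X"
      unfolding X_def by (subst compactin_PiE) auto
    then show ?thesis by (simp add: euclidean_product_topology)
  qed
  have "closed {x::nat \<Rightarrow> real. (\<Sum>i<p. (x i)\<^sup>2) = 1}"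
    by (intro closed_Collect_eq continuous_intros continuous_on_product_coordinates)
  then have "compact (X \<inter> {x. (\<Sum>i<p. (x i)\<^sup>2) = 1})" using cX by (intro compact_Int_closed)
  also have "X \<inter> {x. (\<Sum>i<p. (x i)\<^sup>2) = 1} = {x. (\<forall>i\<ge>p. x i = 0) \<and> (\<Sum>i<p. (x i)\<^sup>2) = 1}"
  proof (intro Set.set_eqI iffI)
    fix x :: "nat \<Rightarrow> real" assume x: "x \<in> {x. (\<forall>i\<ge>p. x i = 0) \<and> (\<Sum>i<p. (x i)\<^sup>2) = 1}"
    have "x i \<in> {-1..1}" if "i < p" for i
    proof -
      have "(x i)\<^sup>2 \<le> (\<Sum>i<p. (x i)\<^sup>2)" using that by (intro member_le_sum) auto
      then have "(x i)\<^sup>2 \<le> 1" using x by simp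
      then show ?thesis by (simp add: abs_square_le_1 abs_le_iff)
    qed
    then show "x \<in> X \<inter> {x. (\<Sum>i<p. (x i)\<^sup>2) = 1}" using x by (auto simp: X_def)
  next
    fix x :: "nat \<Rightarrow> real" assume x: "x \<in> X \<inter> {x. (\<Sum>i<p. (x i)\<^sup>2) = 1}"
    have "x i = 0" if "p \<le> i" for i
    proof -
      have "x i \<in> (if i < p then {-1..1} else {0})" using x by (auto simp: X_def PiE_def Pi_def)
      then show ?thesis using that by simp
    qed
    then show "x \<in> {x. (\<forall>i\<ge>p. x i = 0) \<and> (\<Sum>i<p. (x i)\<^sup>2) = 1}" using x by auto
  qed
  finally show ?thesis .
qed

text \<open>A minimiser of the Rayleigh quotient is an eigenvector.\<close>
lemma qform_ge_eigenvalue_bound: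
  assumes sym: "\<And>i j. i < p \<Longrightarrow> j < p \<Longrightarrow> A i j = A j i"
    and ev: "\<And>k x. (\<exists>i<p. x i \<noteq> 0) \<Longrightarrow> (\<And>i. i < p \<Longrightarrow> (\<Sum>j<p. A i j * x j) = k * x i) \<Longrightarrow> lam \<le> k"
  shows "lam * (\<Sum>i<p. (v i)\<^sup>2) \<le> qform p A v v"
proof (cases "(\<Sum>i<p. (v i)\<^sup>2) = 0")
  case True
  then have "\<forall>i<p. v i = 0" by (simp add: sum_nonneg_eq_0_iff)
  then show ?thesis using True by (simp add: qform_def)
next
  case False
  define K where "K = {x::nat \<Rightarrow> real. (\<forall>i\<ge>p. x i = 0) \<and> (\<Sum>i<p. (x i)\<^sup>2) = 1}"
  define nrm where "nrm y = sqrt (\<Sum>i<p. (y i)\<^sup>2)" for y :: "nat \<Rightarrow> real"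
  define sc where "sc y = (\<lambda>i. if i < p then y i / nrm y else 0)" for y :: "nat \<Rightarrow> real"
  have nrm2: "(nrm y)\<^sup>2 = (\<Sum>i<p. (y i)\<^sup>2)" for y unfolding nrm_def by (simp add: sum_nonneg)
  have sc: "sc y \<in> K" "qform p A y y = (nrm y)\<^sup>2 * qform p A (sc y) (sc y)" if "(\<Sum>i<p. (y i)\<^sup>2) \<noteq> 0" for y
  proof -
    have n: "nrm y \<noteq> 0" using that by (simp add: nrm_def)
    have "(\<Sum>i<p. (sc y i)\<^sup>2) = (\<Sum>i<p. (y i)\<^sup>2) / (nrm y)\<^sup>2"
      by (simp add: sc_def power_divide sum_divide_distrib)
    also have "\<dots> = 1" using that nrm2[of y] by simp
    finally have "(\<Sum>i<p. (sc y i)\<^sup>2) = 1" .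
    moreover have "\<forall>i\<ge>p. sc y i = 0" by (simp add: sc_def)
    ultimately show "sc y \<in> K" unfolding K_def by blast
    have "qform p A y y = qform p A (\<lambda>i. nrm y * sc y i) (\<lambda>i. nrm y * sc y i)"
      unfolding qform_def using n by (intro sum.cong refl) (auto simp: sc_def)
    then show "qform p A y y = (nrm y)\<^sup>2 * qform p A (sc y) (sc y)"
      by (simp add: qform_scale_left qform_scale_right power2_eq_square)
  qed
  have "K \<noteq> {}" using sc(1)[OF False] by auto
  moreover have "compact K" unfolding K_def by (rule unit_sphere_compact)
  moreover have "continuous_on K (\<lambda>x. qform p A x x)"
    unfolding qform_def by (intro continuous_intros continuous_on_subset[OF continuous_on_product_coordinates]) auto
  ultimately obtain x where x: "x \<in> K" and min: "\<And>y. y \<in> K \<Longrightarrow> qform p A x x \<le> qform p A y y"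
    using continuous_attains_inf[of K "\<lambda>x. qform p A x x"] by blast
  define k where "k = qform p A x x"
  have lower: "k * (\<Sum>i<p. (y i)\<^sup>2) \<le> qform p A y y" for y
  proof (cases "(\<Sum>i<p. (y i)\<^sup>2) = 0")
    case True
    then have "\<forall>i<p. y i = 0" by (simp add: sum_nonneg_eq_0_iff)
    then show ?thesis using True by (simp add: qform_def)
  next
    case False
    then show ?thesis unfolding sc(2)[OF False] nrm2[symmetric] using min[OF sc(1)[OF False]]
      by (simp add: k_def mult.commute mult_left_mono)
  qed
  have xx: "(\<Sum>i<p. (x i)\<^sup>2) = 1" using x by (simp add: K_def)
  have eig: "(\<Sum>j<p. A i j * x j) = k * x i" if i: "i < p" for i
  proof -
    define e where "e = (\<lambda>j. if j = i then 1 else (0::real))"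
    have ex: "qform p A e x = (\<Sum>j<p. A i j * x j)"
    proof -
      have "qform p A e x = (\<Sum>l<p. if l = i then (\<Sum>j<p. A l j * x j) else 0)"
        unfolding qform_left_sum e_def by (intro sum.cong) auto
      then show ?thesis using i by simp
    qed
    have "(\<Sum>j<p. A i j * x j) - k * x i = 0"
    proof (rule quadratic_nonneg_imp_linear_coeff_zero[where c = "qform p A e e - k"])
      fix s :: real
      have "qform p A (\<lambda>j. x j + s * e j) (\<lambda>j. x j + s * e j) = k + 2 * s * (\<Sum>j<p. A i j * x j) + s\<^sup>2 * qform p A e e"
        using qform_sym[where v = x and w = e, OF sym]
        by (simp add: qform_add_left qform_add_right qform_scale_left qform_scale_right ex k_def power2_eq_square algebra_simps)
      moreover have "(\<Sum>j<p. (x j + s * e j)\<^sup>2) = 1 + 2 * s * x i + s\<^sup>2"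
      proof -
        have "(\<Sum>j<p. (x j + s * e j)\<^sup>2) = (\<Sum>j<p. (x j)\<^sup>2 + (if j = i then 2 * s * x j + s\<^sup>2 else 0))"
          unfolding e_def by (intro sum.cong) (auto simp: power2_eq_square algebra_simps)
        then show ?thesis using i xx by (simp add: sum.distrib)
      qed
      ultimately show "0 \<le> 2 * s * ((\<Sum>j<p. A i j * x j) - k * x i) + s\<^sup>2 * (qform p A e e - k)"
        using lower[of "\<lambda>j. x j + s * e j"] by (simp add: algebra_simps)
    qed
    then show ?thesis by simp
  qed
  have "\<exists>i<p. x i \<noteq> 0"
  proof (rule ccontr)
    assume "\<not> (\<exists>i<p. x i \<noteq> 0)"
    then have "(\<Sum>i<p. (x i)\<^sup>2) = 0" by simp
    then show False using xx by simp
  qed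
  from ev[OF this eig] have "lam * (\<Sum>i<p. (v i)\<^sup>2) \<le> k * (\<Sum>i<p. (v i)\<^sup>2)" by (intro mult_right_mono sum_nonneg) auto
  then show ?thesis using lower[of v] by simp
qed

lemma eigenvalueI_components:
  assumes "A \<in> carrier_mat p p" "\<exists>i<p. x i \<noteq> 0" "\<And>i. i < p \<Longrightarrow> (\<Sum>j<p. A $$ (i,j) * x j) = k * x i"
  shows "eigenvalue A k"
  unfolding eigenvalue_def eigenvector_def
proof (intro exI[of _ "vec p x"] conjI)
  show "vec p x \<in> carrier_vec (dim_row A)" using assms(1) by simp
  obtain i where "i < p" "x i \<noteq> 0" using assms(2) by blast
  then show "vec p x \<noteq> 0\<^sub>v (dim_row A)" using assms(1) by (metis carrier_matD(1) index_vec index_zero_vec(1))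
  show "A *\<^sub>v vec p x = k \<cdot>\<^sub>v vec p x"
    using assms(1,3) by (intro eq_vecI) (auto simp: scalar_prod_def lessThan_atLeast0)
qed

lemma symmetric_qform_bounds:
  assumes A: "A \<in> carrier_mat p p" and sym: "transpose_mat A = A"
    and ev: "\<And>k. eigenvalue A k \<Longrightarrow> lam0 \<le> k \<and> k \<le> lam1"
  shows "lam0 * (\<Sum>i<p. (v i)\<^sup>2) \<le> qform p (\<lambda>i j. A $$ (i,j)) v v"
    and "qform p (\<lambda>i j. A $$ (i,j)) v v \<le> lam1 * (\<Sum>i<p. (v i)\<^sup>2)"
proof -
  have s: "A $$ (i,j) = A $$ (j,i)" if "i < p" "j < p" for i j
    using arg_cong[OF sym, of "\<lambda>M. M $$ (i,j)"] that A by simp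
  show "lam0 * (\<Sum>i<p. (v i)\<^sup>2) \<le> qform p (\<lambda>i j. A $$ (i,j)) v v"
    using s ev eigenvalueI_components[OF A] by (intro qform_ge_eigenvalue_bound) auto
  have "- lam1 * (\<Sum>i<p. (v i)\<^sup>2) \<le> qform p (\<lambda>i j. - A $$ (i,j)) v v"
  proof (rule qform_ge_eigenvalue_bound)
    fix k x assume x: "\<exists>i<p. x i \<noteq> (0::real)" and e: "\<And>i. i < p \<Longrightarrow> (\<Sum>j<p. - A $$ (i, j) * x j) = k * x i"
    have "(\<Sum>j<p. A $$ (i, j) * x j) = - k * x i" if "i < p" for i
      using e[OF that] by (simp add: sum_negf)
    from ev[OF eigenvalueI_components[OF A x this]] show "- lam1 \<le> k" by simp
  qed (use s in auto)
  then show "qform p (\<lambda>i j. A $$ (i,j)) v v \<le> lam1 * (\<Sum>i<p. (v i)\<^sup>2)"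
    by (simp add: qform_def sum_negf)
qed

lemma cholesky:
  fixes A :: "nat \<Rightarrow> nat \<Rightarrow> real"
  assumes "\<And>i j. i < p \<Longrightarrow> j < p \<Longrightarrow> A i j = A j i"
    and "\<And>v. (\<exists>i<p. v i \<noteq> 0) \<Longrightarrow> 0 < qform p A v v"
  shows "\<exists>l::nat \<Rightarrow> nat \<Rightarrow> real. (\<forall>i<p. 0 < l i i) \<and> (\<forall>i j. i < j \<longrightarrow> l i j = 0) \<and>
    (\<forall>i<p. \<forall>j<p. A i j = (\<Sum>k<p. l i k * l j k))"
  using assms
proof (induction p arbitrary: A)
  case 0
  show ?case by (intro exI[of _ "\<lambda>_ _. 0"]) auto
next
  case (Suc p)
  note sym = Suc.prems(1) and pd = Suc.prems(2)
  define a where "a = A 0 0"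
  have split: "qform (Suc p) A v v = a * (v 0)\<^sup>2 + 2 * v 0 * (\<Sum>j<p. A (Suc j) 0 * v (Suc j))
    + qform p (\<lambda>i j. A (Suc i) (Suc j)) (\<lambda>i. v (Suc i)) (\<lambda>i. v (Suc i))" for v
  proof -
    have "(\<Sum>j<p. A 0 (Suc j) * v 0 * v (Suc j)) = v 0 * (\<Sum>j<p. A (Suc j) 0 * v (Suc j))"
      unfolding sum_distrib_left by (intro sum.cong refl) (use sym[of 0 "Suc _"] in \<open>auto simp: algebra_simps\<close>)
    moreover have "(\<Sum>i<p. A (Suc i) 0 * v (Suc i) * v 0) = v 0 * (\<Sum>j<p. A (Suc j) 0 * v (Suc j))"
      unfolding sum_distrib_left by (intro sum.cong refl) (auto simp: algebra_simps)
    ultimately show ?thesis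
      unfolding qform_def by (simp add: sum.lessThan_Suc_shift sum.distrib a_def power2_eq_square algebra_simps del: sum.lessThan_Suc)
  qed
  have a: "0 < a"
    using pd[of "\<lambda>i. if i = 0 then 1 else 0"] split[of "\<lambda>i. if i = 0 then 1 else 0"] by (auto simp: qform_def)
  define A' where "A' i j = A (Suc i) (Suc j) - A (Suc i) 0 * A (Suc j) 0 / a" for i j
  have "\<exists>l::nat \<Rightarrow> nat \<Rightarrow> real. (\<forall>i<p. 0 < l i i) \<and> (\<forall>i j. i < j \<longrightarrow> l i j = 0) \<and>
    (\<forall>i<p. \<forall>j<p. A' i j = (\<Sum>k<p. l i k * l j k))"
  proof (rule Suc.IH)
    show "A' i j = A' j i" if "i < p" "j < p" for i j using sym[of "Suc i" "Suc j"] that by (simp add: A'_def)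
    fix v :: "nat \<Rightarrow> real" assume v: "\<exists>i<p. v i \<noteq> 0"
    define B where "B = (\<Sum>j<p. A (Suc j) 0 * v j)"
    define v' where "v' = (\<lambda>i. case i of 0 \<Rightarrow> - B / a | Suc i \<Rightarrow> v i)"
    have "qform p A' v v = qform p (\<lambda>i j. A (Suc i) (Suc j)) v v - B\<^sup>2 / a"
    proof -
      have "B\<^sup>2 / a = (\<Sum>i<p. \<Sum>j<p. A (Suc i) 0 * A (Suc j) 0 / a * v i * v j)"
        unfolding B_def power2_eq_square sum_product sum_divide_distrib by (intro sum.cong refl) simp
      then show ?thesis by (simp add: qform_def A'_def left_diff_distrib sum_subtractf)
    qed
    also have "\<dots> = qform (Suc p) A v' v'"
    proof -
      have "v' 0 = - B / a" "\<And>i. v' (Suc i) = v i" by (simp_all add: v'_def)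
      then show ?thesis unfolding split by (simp only: B_def[symmetric]) (use a in \<open>simp add: power2_eq_square field_simps\<close>)
    qed
    also have "0 < \<dots>"
    proof (rule pd)
      obtain i where "i < p" "v i \<noteq> 0" using v by blast
      then show "\<exists>i<Suc p. v' i \<noteq> 0" by (intro exI[of _ "Suc i"]) (simp add: v'_def)
    qed
    finally show "0 < qform p A' v v" .
  qed
  then obtain l where l: "\<And>i. i < p \<Longrightarrow> 0 < l i i" "\<And>i j. i < j \<Longrightarrow> l i j = 0"
    "\<And>i j. i < p \<Longrightarrow> j < p \<Longrightarrow> A' i j = (\<Sum>k<p. l i k * l j k)" by blast
  define l' where "l' i k = (case k of 0 \<Rightarrow> A i 0 / sqrt a | Suc k \<Rightarrow> (case i of 0 \<Rightarrow> 0 | Suc i \<Rightarrow> l i k))" for i k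
  have l'0: "l' 0 0 = sqrt a" using a by (simp add: l'_def a_def real_div_sqrt)
  show ?case
  proof (intro exI[of _ l'] conjI allI impI)
    fix i
    show "0 < l' i i" if "i < Suc p" using that l(1) a l'0 by (cases i) (auto simp: l'_def)
    show "l' i j = 0" if "i < j" for j using that l(2) by (auto simp: l'_def split: nat.splits)
    fix j assume ij: "i < Suc p" "j < Suc p"
    have "(\<Sum>k<Suc p. l' i k * l' j k) = A i 0 * A j 0 / a + (\<Sum>k<p. l' i (Suc k) * l' j (Suc k))"
      using a unfolding sum.lessThan_Suc_shift by (simp add: l'_def field_simps)
    also have "\<dots> = A i j"
    proof (cases i)
      case 0
      then show ?thesis using a sym[of 0 j] ij by (simp add: l'_def a_def)
    next
      case (Suc i')
      show ?thesis
      proof (cases j)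
        case 0
        then show ?thesis using a Suc by (simp add: l'_def a_def)
      next
        case (Suc j')
        then show ?thesis using l(3)[of i' j'] ij \<open>i = Suc i'\<close> by (simp add: l'_def A'_def)
      qed
    qed
    finally show "A i j = (\<Sum>k<Suc p. l' i k * l' j k)" ..
  qed
qed

abbreviation lborel_pow :: "nat \<Rightarrow> (nat \<Rightarrow> real) measure" where
  "lborel_pow p \<equiv> Pi\<^sub>M {..<p} (\<lambda>_. lborel)"

definition tri_map :: "nat \<Rightarrow> (nat \<Rightarrow> real) \<Rightarrow> (nat \<Rightarrow> nat \<Rightarrow> real) \<Rightarrow> (nat \<Rightarrow> real) \<Rightarrow> (nat \<Rightarrow> real)" where
  "tri_map p mu l z = (\<lambda>i\<in>{..<p}. mu i + (\<Sum>k\<le>i. l i k * z k))"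

interpretation lborel_product: product_sigma_finite "\<lambda>_::nat. lborel :: real measure"
  by standard

lemma tri_map_measurable [measurable]:
  "tri_map p mu l \<in> measurable (lborel_pow p) (lborel_pow p)"
  unfolding tri_map_def
proof (rule measurable_restrict)
  fix i assume "i \<in> {..<p}"
  then have "(\<lambda>z. z k) \<in> borel_measurable (lborel_pow p)" if "k \<in> {..i}" for k
    using that measurable_component_singleton[of k "{..<p}" "\<lambda>_. lborel :: real measure"] by simp
  then have "(\<lambda>z. mu i + (\<Sum>k\<le>i. l i k * z k)) \<in> borel_measurable (lborel_pow p)"
    by (intro borel_measurable_add borel_measurable_sum borel_measurable_times) auto
  then show "(\<lambda>z. mu i + (\<Sum>k\<le>i. l i k * z k)) \<in> measurable (lborel_pow p) lborel" by simp
qed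

lemma nn_integral_tri_map:
  assumes "\<And>i. i < p \<Longrightarrow> 0 < l i i" and "f \<in> borel_measurable (lborel_pow p)"
  shows "(\<integral>\<^sup>+x. f x \<partial>lborel_pow p) =
    ennreal (\<Prod>i<p. l i i) * (\<integral>\<^sup>+z. f (tri_map p mu l z) \<partial>lborel_pow p)"
  using assms
proof (induction p arbitrary: f)
  case 0
  have "f x = f (tri_map 0 mu l x)" if "x \<in> space (lborel_pow 0)" for x
    using that by (simp add: space_PiM tri_map_def restrict_def)
  then have "(\<integral>\<^sup>+x. f x \<partial>(lborel_pow 0)) = (\<integral>\<^sup>+z. f (tri_map 0 mu l z) \<partial>(lborel_pow 0))"
    by (rule nn_integral_cong)
  then show ?case by simp
next
  case (Suc p)
  let ?N = "lborel_pow p"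
  note [measurable] = Suc.prems(2)[unfolded lessThan_Suc]
  have lp: "0 < l p p" "0 \<le> (\<Prod>i<p. l i i)"
    using Suc.prems(1) by (simp, intro prod_nonneg) (auto intro: less_imp_le)
  have ins: "(\<integral>\<^sup>+x. g x \<partial>(lborel_pow (Suc p))) = (\<integral>\<^sup>+x. \<integral>\<^sup>+y. g (x(p := y)) \<partial>lborel \<partial>?N)"
    if "g \<in> borel_measurable (lborel_pow (Suc p))" for g
    using that unfolding lessThan_Suc by (intro lborel_product.product_nn_integral_insert) auto
  have [measurable]: "(\<lambda>z. f (tri_map (Suc p) mu l z)) \<in> borel_measurable (Pi\<^sub>M (insert p {..<p}) (\<lambda>_. lborel))"
    using measurable_compose[OF tri_map_measurable Suc.prems(2), of mu l] by (simp add: lessThan_Suc)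
  have inner: "(\<integral>\<^sup>+y. f ((tri_map p mu l z)(p := y)) \<partial>lborel) =
    ennreal (l p p) * (\<integral>\<^sup>+y. f (tri_map (Suc p) mu l (z(p := y))) \<partial>lborel)" if z: "z \<in> space ?N" for z
  proof -
    have tz: "tri_map p mu l z \<in> space ?N" using measurable_space[OF tri_map_measurable z] .
    have m: "(\<lambda>y. f ((tri_map p mu l z)(p := y))) \<in> borel_measurable borel"
      using measurable_comp[OF measurable_component_update[OF tz, of p] Suc.prems(2)[unfolded lessThan_Suc]]
      by (simp add: comp_def)
    have "(tri_map p mu l z)(p := (mu p + (\<Sum>k<p. l p k * z k)) + l p p * y) = tri_map (Suc p) mu l (z(p := y))" for y
    proof
      fix i
      have "(\<Sum>k\<le>i. l i k * z k) = (\<Sum>k\<le>i. l i k * (z(p := y)) k)" if "i < p"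
        using that by (intro sum.cong) auto
      moreover have "(\<Sum>k\<le>p. l p k * (z(p := y)) k) = (\<Sum>k<p. l p k * z k) + l p p * y"
        unfolding lessThan_Suc_atMost[symmetric] by simp
      ultimately show "((tri_map p mu l z)(p := (mu p + (\<Sum>k<p. l p k * z k)) + l p p * y)) i = tri_map (Suc p) mu l (z(p := y)) i"
        by (auto simp: tri_map_def)
    qed
    then show ?thesis
      using nn_integral_real_affine[OF m, of "l p p" "mu p + (\<Sum>k<p. l p k * z k)"] lp by simp
  qed
  have "(\<integral>\<^sup>+x. f x \<partial>(lborel_pow (Suc p))) = (\<integral>\<^sup>+x. \<integral>\<^sup>+y. f (x(p := y)) \<partial>lborel \<partial>?N)"
    by (rule ins[OF Suc.prems(2)])
  also have "\<dots> = ennreal (\<Prod>i<p. l i i) * (\<integral>\<^sup>+z. \<integral>\<^sup>+y. f ((tri_map p mu l z)(p := y)) \<partial>lborel \<partial>?N)"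
  proof (rule Suc.IH)
    show "(\<lambda>x. \<integral>\<^sup>+y. f (x(p := y)) \<partial>lborel) \<in> borel_measurable ?N" by measurable
  qed (use Suc.prems(1) in simp)
  also have "(\<integral>\<^sup>+z. \<integral>\<^sup>+y. f ((tri_map p mu l z)(p := y)) \<partial>lborel \<partial>?N) =
    (\<integral>\<^sup>+z. ennreal (l p p) * (\<integral>\<^sup>+y. f (tri_map (Suc p) mu l (z(p := y))) \<partial>lborel) \<partial>?N)"
    by (rule nn_integral_cong) (rule inner)
  also have "\<dots> = ennreal (l p p) * (\<integral>\<^sup>+z. \<integral>\<^sup>+y. f (tri_map (Suc p) mu l (z(p := y))) \<partial>lborel \<partial>?N)"
    by (rule nn_integral_cmult) measurable
  also have "(\<integral>\<^sup>+z. \<integral>\<^sup>+y. f (tri_map (Suc p) mu l (z(p := y))) \<partial>lborel \<partial>?N) =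
    (\<integral>\<^sup>+z. f (tri_map (Suc p) mu l z) \<partial>(lborel_pow (Suc p)))"
    by (rule ins[symmetric]) (simp add: lessThan_Suc)
  finally show ?case using lp by (simp add: ennreal_mult mult_ac)
qed

lemma std_normal_low_moments:
  "has_bochner_integral lborel std_normal_density 1"
  "has_bochner_integral lborel (\<lambda>x. std_normal_density x * x) 0"
  "has_bochner_integral lborel (\<lambda>x. std_normal_density x * x\<^sup>2) 1"
  using std_normal_moment_even[of 0] std_normal_moment_odd[of 0] std_normal_moment_even[of 1] by auto

definition std_mvn :: "nat \<Rightarrow> (nat \<Rightarrow> real) \<Rightarrow> real" where
  "std_mvn p z = (\<Prod>i<p. std_normal_density (z i))"

lemma std_mvn_monomial:
  assumes "\<And>i. i < p \<Longrightarrow> e i \<le> (2::nat)"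
  shows "has_bochner_integral (lborel_pow p) (\<lambda>z. std_mvn p z * (\<Prod>i<p. z i ^ e i))
    (\<Prod>i<p. if e i = 1 then 0 else 1)"
proof -
  have hb: "has_bochner_integral lborel (\<lambda>x. std_normal_density x * x ^ e i) (if e i = 1 then 0 else 1)" if i: "i < p" for i
  proof -
    consider "e i = 0" | "e i = 1" | "e i = 2" using assms[OF i] by linarith
    then show ?thesis using std_normal_low_moments by cases auto
  qed
  have eq: "std_mvn p z * (\<Prod>i<p. z i ^ e i) = (\<Prod>i<p. std_normal_density (z i) * z i ^ e i)" for z
    by (simp add: std_mvn_def prod.distrib)
  have int: "\<And>i. i \<in> {..<p} \<Longrightarrow> integrable lborel (\<lambda>x. std_normal_density x * x ^ e i)"
    using hb integrable.intros by auto
  show ?thesis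
    unfolding eq has_bochner_integral_iff
  proof
    show "integrable (lborel_pow p) (\<lambda>z. \<Prod>i<p. std_normal_density (z i) * z i ^ e i)"
      by (rule lborel_product.product_integrable_prod) (use int in auto)
    have "(\<integral>z. (\<Prod>i<p. std_normal_density (z i) * z i ^ e i) \<partial>lborel_pow p) =
      (\<Prod>i<p. \<integral>x. std_normal_density x * x ^ e i \<partial>lborel)"
      by (rule lborel_product.product_integral_prod) (use int in auto)
    also have "\<dots> = (\<Prod>i<p. if e i = 1 then 0 else 1)"
      using hb by (intro prod.cong) (auto simp: has_bochner_integral_iff)
    finally show "(\<integral>z. (\<Prod>i<p. std_normal_density (z i) * z i ^ e i) \<partial>lborel_pow p) = (\<Prod>i<p. if e i = 1 then 0 else 1)" .
  qed
qed

lemma std_mvn_moments: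
  shows "has_bochner_integral (lborel_pow p) (\<lambda>z. std_mvn p z) 1"
    and "k < p \<Longrightarrow> has_bochner_integral (lborel_pow p) (\<lambda>z. std_mvn p z * z k) 0"
    and "k < p \<Longrightarrow> n < p \<Longrightarrow>
      has_bochner_integral (lborel_pow p) (\<lambda>z. std_mvn p z * (z k * z n)) (if k = n then 1 else 0)"
proof -
  show "has_bochner_integral (lborel_pow p) (\<lambda>z. std_mvn p z) 1"
    using std_mvn_monomial[of p "\<lambda>_. 0"] by simp
  have pick: "(\<Prod>i<p. z i ^ (if i = k then 1 else 0)) = z k" if "k < p" for z :: "nat \<Rightarrow> real" and k
  proof -
    have "(\<Prod>i<p. z i ^ (if i = k then 1 else 0)) = (\<Prod>i<p. if i = k then z i else 1)" by (intro prod.cong) auto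
    then show ?thesis using that by simp
  qed
  show "has_bochner_integral (lborel_pow p) (\<lambda>z. std_mvn p z * z k) 0" if "k < p"
  proof -
    have "(\<Prod>i<p. if (if i = k then 1 else 0) = (1::nat) then 0 else (1::real)) = 0"
      using that by (intro prod_zero) (auto intro!: bexI[of _ k])
    moreover have "has_bochner_integral (lborel_pow p) (\<lambda>z. std_mvn p z * (\<Prod>i<p. z i ^ (if i = k then 1 else 0)))
      (\<Prod>i<p. if (if i = k then 1 else 0) = (1::nat) then 0 else 1)"
      by (rule std_mvn_monomial) simp
    ultimately show ?thesis by (simp only: pick[OF that])
  qed
  show "has_bochner_integral (lborel_pow p) (\<lambda>z. std_mvn p z * (z k * z n)) (if k = n then 1 else 0)"
    if kn: "k < p" "n < p"
  proof -
    define e where "e i = (if i = k then 1 else 0) + (if i = n then 1 else (0::nat))" for i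
    have "(\<Prod>i<p. z i ^ e i) = z k * z n" for z :: "nat \<Rightarrow> real"
      unfolding e_def power_add prod.distrib using pick kn by simp
    moreover have "(\<Prod>i<p. if e i = 1 then 0 else (1::real)) = (if k = n then 1 else 0)"
    proof (cases "k = n")
      case False
      then have "(\<Prod>i<p. if e i = 1 then 0 else (1::real)) = 0"
        using kn by (intro prod_zero) (auto intro!: bexI[of _ k] simp: e_def)
      then show ?thesis using False by simp
    qed (auto intro!: prod.neutral simp: e_def)
    moreover have "has_bochner_integral (lborel_pow p) (\<lambda>z. std_mvn p z * (\<Prod>i<p. z i ^ e i))
      (\<Prod>i<p. if e i = 1 then 0 else 1)"
      by (rule std_mvn_monomial) (simp add: e_def)
    ultimately show ?thesis by (simp only:)
  qed
qed

lemma std_mvn_affine_product: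
  "(\<integral>z. std_mvn p z * ((c + (\<Sum>k<p. a k * z k)) * (c' + (\<Sum>k<p. a' k * z k))) \<partial>lborel_pow p) =
    c * c' + (\<Sum>k<p. a k * a' k)"
proof -
  let ?N = "lborel_pow p"
  note mom = std_mvn_moments[where p = p]
  have "has_bochner_integral ?N (\<lambda>z. c * c' * std_mvn p z + (\<Sum>k<p. (c * a' k + c' * a k) * (std_mvn p z * z k))
      + (\<Sum>k<p. \<Sum>n<p. a k * a' n * (std_mvn p z * (z k * z n))))
    (c * c' * 1 + (\<Sum>k<p. (c * a' k + c' * a k) * 0) + (\<Sum>k<p. \<Sum>n<p. a k * a' n * (if k = n then 1 else 0)))"
    by (intro has_bochner_integral_add has_bochner_integral_sum has_bochner_integral_mult_right mom) auto
  moreover have "c * c' * std_mvn p z + (\<Sum>k<p. (c * a' k + c' * a k) * (std_mvn p z * z k))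
      + (\<Sum>k<p. \<Sum>n<p. a k * a' n * (std_mvn p z * (z k * z n)))
    = std_mvn p z * ((c + (\<Sum>k<p. a k * z k)) * (c' + (\<Sum>k<p. a' k * z k)))" for z
  proof -
    have "(\<Sum>k<p. (c * a' k + c' * a k) * (std_mvn p z * z k)) =
      std_mvn p z * (c * (\<Sum>k<p. a' k * z k) + c' * (\<Sum>k<p. a k * z k))"
      by (simp add: sum_distrib_left sum.distrib algebra_simps)
    moreover have "(\<Sum>k<p. \<Sum>n<p. a k * a' n * (std_mvn p z * (z k * z n))) =
      std_mvn p z * ((\<Sum>k<p. a k * z k) * (\<Sum>k<p. a' k * z k))"
      unfolding sum_product unfolding sum_distrib_left by (intro sum.cong refl) (simp add: mult_ac)
    ultimately show ?thesis by (simp add: algebra_simps)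
  qed
  moreover have "(\<Sum>k<p. \<Sum>n<p. a k * a' n * (if k = n then 1 else 0)) = (\<Sum>k<p. a k * a' k)"
    by (intro sum.cong refl) (simp add: if_distrib cong: if_cong)
  ultimately show ?thesis by (simp add: has_bochner_integral_iff)
qed

lemma cholesky_det:
  assumes S: "S \<in> carrier_mat p p"
    and l: "\<And>i j. i < j \<Longrightarrow> l i j = 0" "\<And>i j. i < p \<Longrightarrow> j < p \<Longrightarrow> S $$ (i,j) = (\<Sum>k<p. l i k * l j k)"
  defines "Lm \<equiv> mat p p (\<lambda>(i,j). l i j)"
  shows "S = Lm * transpose_mat Lm" and "det Lm = (\<Prod>i<p. l i i)" and "det S = (\<Prod>i<p. l i i)\<^sup>2"
proof -
  have Lm: "Lm \<in> carrier_mat p p" by (simp add: Lm_def)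
  show S_eq: "S = Lm * transpose_mat Lm"
    using S l(2) by (intro eq_matI) (auto simp: Lm_def scalar_prod_def lessThan_atLeast0)
  show detL: "det Lm = (\<Prod>i<p. l i i)"
    using det_lower_triangular[OF _ Lm] l(1) by (simp add: prod_list_diag_prod Lm_def lessThan_atLeast0)
  show "det S = (\<Prod>i<p. l i i)\<^sup>2"
    unfolding S_eq using det_mult[OF Lm, of "transpose_mat Lm"] det_transpose[OF Lm] Lm
    by (simp add: detL power2_eq_square)
qed

lemma mvn_density_tri_map:
  assumes S: "S \<in> carrier_mat p p" and mu: "mu \<in> carrier_vec p"
    and l: "\<And>i. i < p \<Longrightarrow> 0 < l i i" "\<And>i j. i < j \<Longrightarrow> l i j = 0"
      "\<And>i j. i < p \<Longrightarrow> j < p \<Longrightarrow> S $$ (i,j) = (\<Sum>k<p. l i k * l j k)"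
  shows "mvn_density p mu S (tri_map p (\<lambda>i. mu $ i) l z) * (\<Prod>i<p. l i i) = std_mvn p z"
proof -
  define Lm where "Lm = mat p p (\<lambda>(i,j). l i j)"
  have Lm: "Lm \<in> carrier_mat p p" by (simp add: Lm_def)
  have pos: "0 < (\<Prod>i<p. l i i)" using l(1) by (intro prod_pos) auto
  have S_eq: "S = Lm * transpose_mat Lm" and detL: "det Lm = (\<Prod>i<p. l i i)" and detS: "det S = (\<Prod>i<p. l i i)\<^sup>2"
    unfolding Lm_def by (rule cholesky_det[OF S l(2,3)]; assumption)+
  have "0 < det S" using detS zero_less_power[OF pos, of 2] by simp
  then have "S \<in> Units (ring_mat TYPE(real) p ())" by (intro det_non_zero_imp_unit[OF S]) simp
  then obtain P where P: "mat_inverse S = Some P"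
    using mat_inverse(1)[OF S, of "()"] by (cases "mat_inverse S") auto
  from mat_inverse(2)[OF S P] have SP: "S * P = 1\<^sub>m p" and Pc: "P \<in> carrier_mat p p" by auto
  define zv where "zv = vec p z"
  have zv: "zv \<in> carrier_vec p" by (simp add: zv_def)
  define v where "v = vec p (tri_map p (\<lambda>i. mu $ i) l z) - mu"
  have v: "v \<in> carrier_vec p" using mu by (simp add: v_def)
  have v_eq: "v = Lm *\<^sub>v zv"
  proof (intro eq_vecI)
    fix i assume "i < dim_vec (Lm *\<^sub>v zv)"
    then have i: "i < p" by (simp add: Lm_def)
    have "(\<Sum>k\<le>i. l i k * z k) = (\<Sum>k<p. l i k * z k)" using i l(2) by (intro sum.mono_neutral_left) auto
    then show "v $ i = (Lm *\<^sub>v zv) $ i"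
      using i mu by (simp add: v_def tri_map_def Lm_def zv_def scalar_prod_def lessThan_atLeast0)
  qed (simp add: v_def Lm_def mu carrier_vecD[OF mu])
  define w where "w = P *\<^sub>v v"
  have w: "w \<in> carrier_vec p" using Pc v by (simp add: w_def)
  have LTw: "transpose_mat Lm *\<^sub>v w \<in> carrier_vec p" using Lm w by simp
  have "Lm *\<^sub>v (transpose_mat Lm *\<^sub>v w) = S *\<^sub>v w"
    unfolding S_eq using Lm w by (intro assoc_mult_mat_vec[symmetric]) auto
  also have "\<dots> = (S * P) *\<^sub>v v" unfolding w_def using S Pc v by (intro assoc_mult_mat_vec[symmetric]) auto
  also have "\<dots> = Lm *\<^sub>v zv" using v by (simp add: SP v_eq)
  finally have "Lm *\<^sub>v (transpose_mat Lm *\<^sub>v w - zv) = 0\<^sub>v p"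
    using Lm LTw zv by (simp add: mult_minus_distrib_mat_vec)
  then have "transpose_mat Lm *\<^sub>v w - zv = 0\<^sub>v p"
    using det_0_iff_vec_prod_zero[OF Lm] detL pos LTw zv by (metis less_irrefl minus_carrier_vec)
  note d0 = this
  have "(transpose_mat Lm *\<^sub>v w) $ i = zv $ i" if "i < p" for i
  proof -
    have "(transpose_mat Lm *\<^sub>v w - zv) $ i = (transpose_mat Lm *\<^sub>v w) $ i - zv $ i"
      using that by (intro index_minus_vec(1)) (simp add: zv_def)
    then show ?thesis using that by (simp add: d0)
  qed
  then have z_eq: "transpose_mat Lm *\<^sub>v w = zv" using Lm zv by (intro eq_vecI) auto
  have "v \<bullet> w = w \<bullet> (Lm *\<^sub>v zv)" using v w v_eq by (simp add: comm_scalar_prod)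
  also have "\<dots> = zv \<bullet> zv" using transpose_vec_mult_scalar[OF Lm zv w] z_eq by simp
  also have "\<dots> = (\<Sum>i<p. (z i)\<^sup>2)" by (simp add: zv_def scalar_prod_def lessThan_atLeast0 power2_eq_square)
  finally have vw: "v \<bullet> w = (\<Sum>i<p. (z i)\<^sup>2)" .
  have "mvn_density p mu S (tri_map p (\<lambda>i. mu $ i) l z) = exp (- (\<Sum>i<p. (z i)\<^sup>2) / 2) / sqrt ((2 * pi) ^ p * (\<Prod>i<p. l i i)\<^sup>2)"
    using vw unfolding mvn_density_def Let_def v_def[symmetric] P option.sel w_def[symmetric] detS by simp
  also have "sqrt ((2 * pi) ^ p * (\<Prod>i<p. l i i)\<^sup>2) = sqrt (2 * pi) ^ p * (\<Prod>i<p. l i i)"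
    using pos by (simp add: real_sqrt_mult real_sqrt_power power_mult_distrib)
  finally have "mvn_density p mu S (tri_map p (\<lambda>i. mu $ i) l z) * (\<Prod>i<p. l i i) = exp (- (\<Sum>i<p. (z i)\<^sup>2) / 2) / sqrt (2 * pi) ^ p"
    using pos by (simp add: field_simps del: prod_zero_iff)
  also have "\<dots> = std_mvn p z"
    unfolding std_mvn_def std_normal_density_def
    by (simp add: prod.distrib exp_sum[symmetric] sum_negf[symmetric] sum_divide_distrib prod_dividef power_one_over)
  finally show ?thesis .
qed

lemma mvn_density_measurable:
  assumes S: "S \<in> carrier_mat p p" and P: "mat_inverse S = Some P" and mu: "mu \<in> carrier_vec p"
  shows "mvn_density p mu S \<in> borel_measurable (lborel_pow p)"
proof -
  have Pc: "P \<in> carrier_mat p p" using mat_inverse(2)[OF S P] by auto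
  have "(vec p x - mu) \<bullet> (P *\<^sub>v (vec p x - mu)) = (\<Sum>i<p. (x i - mu $ i) * (\<Sum>j<p. P $$ (i,j) * (x j - mu $ j)))" for x
    using Pc mu by (simp add: scalar_prod_def lessThan_atLeast0)
  then have eq: "mvn_density p mu S = (\<lambda>x. exp (- (\<Sum>i<p. (x i - mu $ i) * (\<Sum>j<p. P $$ (i,j) * (x j - mu $ j))) / 2)
    / sqrt ((2 * pi) ^ p * det S))"
    by (intro ext) (simp add: mvn_density_def Let_def P)
  have c: "(\<lambda>x. x i) \<in> borel_measurable (lborel_pow p)" if "i \<in> {..<p}" for i
    using measurable_component_singleton[OF that, of "\<lambda>_. lborel :: real measure"] by simp
  show ?thesis unfolding eq
    by (intro borel_measurable_divide borel_measurable_exp borel_measurable_uminus borel_measurable_sum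
        borel_measurable_times borel_measurable_diff borel_measurable_const c measurable_compose[OF _ borel_measurable_exp]) auto
qed

lemma mvn_affine_product:
  assumes S: "S \<in> carrier_mat p p" and mu: "mu \<in> carrier_vec p"
    and sym: "\<And>i j. i < p \<Longrightarrow> j < p \<Longrightarrow> S $$ (i,j) = S $$ (j,i)"
    and pd: "\<And>v. (\<exists>i<p. v i \<noteq> 0) \<Longrightarrow> 0 < qform p (\<lambda>i j. S $$ (i,j)) v v"
  shows "(\<integral>x. ((c + (\<Sum>i<p. a i * x i)) * (c' + (\<Sum>i<p. a' i * x i))) * mvn_density p mu S x \<partial>lborel_pow p)
    = (c + (\<Sum>i<p. a i * mu $ i)) * (c' + (\<Sum>i<p. a' i * mu $ i)) + qform p (\<lambda>i j. S $$ (i,j)) a a'"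
proof -
  let ?N = "lborel_pow p"
  obtain l where l: "\<And>i. i < p \<Longrightarrow> 0 < l i i" "\<And>i j. i < j \<Longrightarrow> l i j = 0"
      "\<And>i j. i < p \<Longrightarrow> j < p \<Longrightarrow> S $$ (i,j) = (\<Sum>k<p. l i k * l j k)"
    using cholesky[of p "\<lambda>i j. S $$ (i,j)", OF sym pd] by blast
  define T where "T = tri_map p (\<lambda>i. mu $ i) l"
  define dn where "dn = mvn_density p mu S"
  have Tm [measurable]: "T \<in> measurable ?N ?N" unfolding T_def by (rule tri_map_measurable)
  have dT: "dn (T z) * (\<Prod>i<p. l i i) = std_mvn p z" for z
    unfolding T_def dn_def by (rule mvn_density_tri_map[OF S mu l])
  have pos: "0 < (\<Prod>i<p. l i i)" using l(1) by (intro prod_pos) auto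
  have detS: "0 < det S" using cholesky_det(3)[OF S l(2,3)] zero_less_power[OF pos, of 2] by simp
  then obtain P where P: "mat_inverse S = Some P"
    using mat_inverse(1)[OF S, of "()"] det_non_zero_imp_unit[OF S, of "()"] by (cases "mat_inverse S") auto
  have dnm [measurable]: "dn \<in> borel_measurable ?N" unfolding dn_def by (rule mvn_density_measurable[OF S P mu])
  have std_m [measurable]: "std_mvn p \<in> borel_measurable ?N"
    using std_mvn_moments(1)[where p = p] by (auto simp: has_bochner_integral_iff)
  have std_nn: "0 \<le> std_mvn p z" for z unfolding std_mvn_def by (intro prod_nonneg) auto
  have dn_nn: "0 \<le> dn x" for x
    unfolding dn_def mvn_density_def Let_def
    using detS by (intro divide_nonneg_nonneg) auto
  have measures: "density ?N dn = distr (density ?N (std_mvn p)) ?N T"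
  proof (rule measure_eqI)
    fix A assume "A \<in> sets (density ?N dn)"
    then have A [measurable]: "A \<in> sets ?N" by simp
    have "emeasure (density ?N dn) A = (\<integral>\<^sup>+x. ennreal (dn x) * indicator A x \<partial>?N)"
      by (rule emeasure_density) auto
    also have "\<dots> = ennreal (\<Prod>i<p. l i i) * (\<integral>\<^sup>+z. ennreal (dn (T z)) * indicator A (T z) \<partial>?N)"
      unfolding T_def by (rule nn_integral_tri_map[OF l(1)]) auto
    also have "\<dots> = (\<integral>\<^sup>+z. ennreal (\<Prod>i<p. l i i) * (ennreal (dn (T z)) * indicator A (T z)) \<partial>?N)"
      by (rule nn_integral_cmult[symmetric]) measurable
    also have "\<dots> = (\<integral>\<^sup>+z. ennreal (std_mvn p z) * indicator (T -` A \<inter> space ?N) z \<partial>?N)"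
    proof (rule nn_integral_cong)
      fix z assume z: "z \<in> space ?N"
      have "ennreal (\<Prod>i<p. l i i) * ennreal (dn (T z)) = ennreal (std_mvn p z)"
        using pos dn_nn by (simp add: dT[symmetric] ennreal_mult mult.commute)
      then show "ennreal (\<Prod>i<p. l i i) * (ennreal (dn (T z)) * indicator A (T z)) =
        ennreal (std_mvn p z) * indicator (T -` A \<inter> space ?N) z"
        using z by (simp add: mult.assoc[symmetric] indicator_def)
    qed
    also have "\<dots> = emeasure (density ?N (std_mvn p)) (T -` A \<inter> space ?N)"
      by (rule emeasure_density[symmetric]) (auto intro: measurable_sets[OF Tm A])
    also have "\<dots> = emeasure (distr (density ?N (std_mvn p)) ?N T) A"
      by (subst emeasure_distr) auto
    finally show "emeasure (density ?N dn) A = emeasure (distr (density ?N (std_mvn p)) ?N T) A" .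
  qed simp
  define f where "f x = (c + (\<Sum>i<p. a i * x i)) * (c' + (\<Sum>i<p. a' i * x i))" for x :: "nat \<Rightarrow> real"
  have c: "(\<lambda>x. x i) \<in> borel_measurable ?N" if "i \<in> {..<p}" for i
    using measurable_component_singleton[OF that, of "\<lambda>_. lborel :: real measure"] by simp
  have fm [measurable]: "f \<in> borel_measurable ?N" unfolding f_def
    by (intro borel_measurable_times borel_measurable_add borel_measurable_sum borel_measurable_const c)
  have "(\<integral>x. f x * dn x \<partial>?N) = (\<integral>x. dn x *\<^sub>R f x \<partial>?N)" by (simp add: mult.commute)
  also have "\<dots> = integral\<^sup>L (density ?N dn) f" by (rule integral_density[symmetric]) (auto simp: dn_nn)
  also have "\<dots> = integral\<^sup>L (density ?N (std_mvn p)) (\<lambda>z. f (T z))" unfolding measures by (rule integral_distr) auto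
  also have "\<dots> = (\<integral>z. std_mvn p z *\<^sub>R f (T z) \<partial>?N)" by (rule integral_density) (auto simp: std_nn)
  also have "\<dots> = (\<integral>z. std_mvn p z * (((c + (\<Sum>i<p. a i * mu $ i)) + (\<Sum>k<p. (\<Sum>i<p. a i * l i k) * z k)) *
     ((c' + (\<Sum>i<p. a' i * mu $ i)) + (\<Sum>k<p. (\<Sum>i<p. a' i * l i k) * z k))) \<partial>?N)"
  proof -
    have "b + (\<Sum>i<p. e i * T z i) = (b + (\<Sum>i<p. e i * mu $ i)) + (\<Sum>k<p. (\<Sum>i<p. e i * l i k) * z k)" for b e z
    proof -
      have "(\<Sum>i<p. e i * T z i) = (\<Sum>i<p. e i * mu $ i + e i * (\<Sum>k<p. l i k * z k))"
      proof (rule sum.cong[OF refl])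
        fix i assume "i \<in> {..<p}"
        moreover have "(\<Sum>k\<le>i. l i k * z k) = (\<Sum>k<p. l i k * z k)" if "i < p" using that l(2) by (intro sum.mono_neutral_left) auto
        ultimately show "e i * T z i = e i * mu $ i + e i * (\<Sum>k<p. l i k * z k)" by (simp add: T_def tri_map_def distrib_left)
      qed
      moreover have "(\<Sum>i<p. e i * (\<Sum>k<p. l i k * z k)) = (\<Sum>k<p. (\<Sum>i<p. e i * l i k) * z k)"
        unfolding sum_distrib_left sum_distrib_right by (subst sum.swap) (simp add: mult.assoc)
      ultimately show ?thesis by (simp add: sum.distrib)
    qed
    then show ?thesis by (simp add: f_def add.assoc)
  qed
  also have "\<dots> = (c + (\<Sum>i<p. a i * mu $ i)) * (c' + (\<Sum>i<p. a' i * mu $ i))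
    + (\<Sum>k<p. (\<Sum>i<p. a i * l i k) * (\<Sum>i<p. a' i * l i k))" by (rule std_mvn_affine_product)
  also have "(\<Sum>k<p. (\<Sum>i<p. a i * l i k) * (\<Sum>i<p. a' i * l i k)) = qform p (\<lambda>i j. S $$ (i,j)) a a'"
  proof -
    have "(\<Sum>k<p. (\<Sum>i<p. a i * l i k) * (\<Sum>i<p. a' i * l i k)) = (\<Sum>k<p. \<Sum>i<p. \<Sum>j<p. (l i k * l j k) * a i * a' j)"
      unfolding sum_product by (simp add: mult_ac)
    also have "\<dots> = (\<Sum>i<p. \<Sum>k<p. \<Sum>j<p. (l i k * l j k) * a i * a' j)" by (rule sum.swap)
    also have "\<dots> = (\<Sum>i<p. \<Sum>j<p. \<Sum>k<p. (l i k * l j k) * a i * a' j)" by (rule sum.cong[OF refl]) (rule sum.swap)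
    also have "\<dots> = qform p (\<lambda>i j. S $$ (i,j)) a a'"
      unfolding qform_def by (intro sum.cong refl) (simp add: l(3) sum_distrib_right)
    finally show ?thesis .
  qed
  finally show ?thesis by (simp add: f_def dn_def)
qed

section \<open>Integration over the unit interval\<close>

definition bmeas01 :: "(real \<Rightarrow> real) \<Rightarrow> bool" where
  "bmeas01 f \<longleftrightarrow> (\<lambda>u. indicator {0..1} u * f u) \<in> borel_measurable lborel \<and> (\<exists>C. \<forall>u\<in>{0..1}. \<bar>f u\<bar> \<le> C)"

definition int01 :: "(real \<Rightarrow> real) \<Rightarrow> real" where
  "int01 f = (\<integral>u. indicator {0..1} u * f u \<partial>lborel)"

lemma bmeas01_meas: "bmeas01 f \<Longrightarrow> (\<lambda>u. indicator {0..1} u * f u) \<in> borel_measurable lborel"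
  by (simp only: bmeas01_def)

lemma bmeas01_integrable:
  assumes "bmeas01 f"
  shows "integrable lborel (\<lambda>u. indicator {0..1} u * f u)"
proof -
  obtain C where C: "\<And>u. u \<in> {0..1} \<Longrightarrow> \<bar>f u\<bar> \<le> C" using assms unfolding bmeas01_def by blast
  have "integrable lborel (\<lambda>u. indicator {0..1} u *\<^sub>R (indicator {0..1} u * f u))"
    using assms C by (intro integrableI_bounded_set_indicator[where B = C]) (auto simp: bmeas01_def split: split_indicator)
  moreover have "(\<lambda>u. indicator {0..1} u *\<^sub>R (indicator {0..1} u * f u)) = (\<lambda>u. indicator {0..1} u * f u)"
    by (auto simp: indicator_def)
  ultimately show ?thesis by simp
qed

lemma bmeas01_const: "bmeas01 (\<lambda>u. c)"
  by (auto simp: bmeas01_def)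

lemma bmeas01_add:
  assumes "bmeas01 f" "bmeas01 g"
  shows "bmeas01 (\<lambda>u. f u + g u)"
proof -
  obtain C C' where "\<forall>u\<in>{0..1}. \<bar>f u\<bar> \<le> C" "\<forall>u\<in>{0..1}. \<bar>g u\<bar> \<le> C'" using assms by (auto simp: bmeas01_def)
  then have "\<forall>u\<in>{0..1}. \<bar>f u + g u\<bar> \<le> C + C'" by (meson abs_triangle_ineq add_mono order_trans)
  moreover have "(\<lambda>u. indicator {0..1} u * f u + indicator {0..1} u * g u) \<in> borel_measurable lborel"
    by (rule borel_measurable_add[OF bmeas01_meas[OF assms(1)] bmeas01_meas[OF assms(2)]])
  ultimately show ?thesis by (auto simp: bmeas01_def distrib_left)
qed

lemma bmeas01_mult:
  assumes "bmeas01 f" "bmeas01 g"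
  shows "bmeas01 (\<lambda>u. f u * g u)"
proof -
  obtain C C' where "\<forall>u\<in>{0..1}. \<bar>f u\<bar> \<le> C" "\<forall>u\<in>{0..1}. \<bar>g u\<bar> \<le> C'" using assms by (auto simp: bmeas01_def)
  then have "\<forall>u\<in>{0..1}. \<bar>f u * g u\<bar> \<le> C * C'"
    by (auto simp: abs_mult intro!: mult_mono intro: order_trans[OF abs_ge_zero])
  moreover have "(\<lambda>u. (indicator {0..1} u * f u) * (indicator {0..1} u * g u)) \<in> borel_measurable lborel"
    by (rule borel_measurable_times[OF bmeas01_meas[OF assms(1)] bmeas01_meas[OF assms(2)]])
  moreover have "(\<lambda>u. (indicator {0..1} u * f u) * (indicator {0..1} u * g u)) = (\<lambda>u. indicator {0..1} u * (f u * g u))"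
    by (auto simp: indicator_def)
  ultimately show ?thesis by (auto simp: bmeas01_def)
qed

lemma bmeas01_diff:
  assumes "bmeas01 f" "bmeas01 g"
  shows "bmeas01 (\<lambda>u. f u - g u)"
  using bmeas01_add[OF assms(1) bmeas01_mult[OF bmeas01_const[of "-1"] assms(2)]] by simp

lemma bmeas01_sum:
  assumes "\<And>i. i \<in> I \<Longrightarrow> bmeas01 (f i)"
  shows "bmeas01 (\<lambda>u. \<Sum>i\<in>I. f i u)"
  using assms
proof (induction I rule: infinite_finite_induct)
  case (insert i I)
  then show ?case by (simp add: bmeas01_add)
qed (simp_all add: bmeas01_const)

lemma bmeas01_inverse:
  assumes "bmeas01 f" "\<And>u. u \<in> {0..1} \<Longrightarrow> 1 \<le> f u"
  shows "bmeas01 (\<lambda>u. 1 / f u)"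
proof -
  have [measurable]: "(\<lambda>u. indicator {0..1} u * f u) \<in> borel_measurable lborel"
    using assms(1) by (simp add: bmeas01_def)
  have "(\<lambda>u. indicator {0..1} u * (1 / (indicator {0..1} u * f u))) \<in> borel_measurable lborel" by measurable
  moreover have "(\<lambda>u. indicator {0..1} u * (1 / (indicator {0..1} u * f u))) = (\<lambda>u. indicator {0..1} u * (1 / f u))"
    by (auto simp: indicator_def)
  ultimately have "(\<lambda>u. indicator {0..1} u * (1 / f u)) \<in> borel_measurable lborel" by (simp only:)
  moreover have "\<bar>1 / f u\<bar> \<le> 1" if "u \<in> {0..1}" for u using assms(2)[OF that] by simp
  ultimately show ?thesis unfolding bmeas01_def by blast
qed

lemma bmeas01_continuous:
  assumes "continuous_on {0..1} f"
  shows "bmeas01 f"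
proof -
  have "(\<lambda>u. indicator {0..1} u *\<^sub>R f u) \<in> borel_measurable borel"
    using assms by (intro borel_measurable_continuous_on_indicator) auto
  moreover have "bounded (f ` {0..1})" using assms by (intro compact_imp_bounded compact_continuous_image) auto
  ultimately show ?thesis by (auto simp: bmeas01_def bounded_iff)
qed

lemma int01_cong: "(\<And>u. u \<in> {0..1} \<Longrightarrow> f u = g u) \<Longrightarrow> int01 f = int01 g"
  unfolding int01_def by (intro Bochner_Integration.integral_cong) (auto simp: indicator_def)

lemma int01_add: "bmeas01 f \<Longrightarrow> bmeas01 g \<Longrightarrow> int01 (\<lambda>u. f u + g u) = int01 f + int01 g"
  unfolding int01_def distrib_left by (intro Bochner_Integration.integral_add bmeas01_integrable)

lemma int01_cmult: "int01 (\<lambda>u. c * f u) = c * int01 f"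
  unfolding int01_def by (simp add: mult.left_commute)

lemma int01_sum:
  assumes "\<And>i. i \<in> I \<Longrightarrow> bmeas01 (f i)"
  shows "int01 (\<lambda>u. \<Sum>i\<in>I. f i u) = (\<Sum>i\<in>I. int01 (f i))"
  unfolding int01_def sum_distrib_left using assms by (intro Bochner_Integration.integral_sum bmeas01_integrable)

lemma int01_mono:
  assumes "bmeas01 f" "bmeas01 g" "\<And>u. u \<in> {0..1} \<Longrightarrow> f u \<le> g u"
  shows "int01 f \<le> int01 g"
  unfolding int01_def using assms by (intro integral_mono bmeas01_integrable) (auto simp: indicator_def)

lemma int01_const: "int01 (\<lambda>u. c) = c"
  unfolding int01_def by simp

lemma int01_nonneg: "(\<And>u. u \<in> {0..1} \<Longrightarrow> 0 \<le> f u) \<Longrightarrow> 0 \<le> int01 f"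
  unfolding int01_def by (intro Bochner_Integration.integral_nonneg) (auto simp: indicator_def)

lemma int01_zero_AE:
  assumes "bmeas01 f" "\<And>u. u \<in> {0..1} \<Longrightarrow> 0 \<le> f u" "int01 f = 0"
  shows "AE u in lborel. 0 \<le> u \<and> u \<le> 1 \<longrightarrow> f u = 0"
proof -
  have "AE u in lborel. indicator {0..1} u * f u = 0"
    using assms(2,3) bmeas01_integrable[OF assms(1)] unfolding int01_def
    by (subst (asm) integral_nonneg_eq_0_iff_AE) (auto simp: indicator_def)
  then show ?thesis by eventually_elim (auto simp: indicator_def split: if_splits)
qed

lemma int01_zero_continuous:
  assumes cont: "continuous_on {0..1} f" and nn: "\<And>u. u \<in> {0..1} \<Longrightarrow> 0 \<le> f u" and z: "int01 f = 0" and u: "u \<in> {0..1}"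
  shows "f u = 0"
proof -
  have int: "integrable lborel (\<lambda>u. indicator {0..1} u * f u)" by (intro bmeas01_integrable bmeas01_continuous cont)
  have "((\<lambda>u. indicator {0..1} u * f u) has_integral int01 f) UNIV"
    unfolding int01_def by (rule has_integral_integral_lborel[OF int])
  moreover have "(\<lambda>u. indicator {0..1} u * f u) = (\<lambda>u. if u \<in> {0..1} then f u else 0)" by (auto simp: indicator_def)
  ultimately have "((\<lambda>u. if u \<in> {0..1} then f u else 0) has_integral 0) UNIV" using z by (simp only:)
  then have "(f has_integral 0) (cbox 0 1)" unfolding cbox_interval by (simp only: has_integral_restrict_UNIV)
  then show ?thesis using assms by (intro has_integral_0_cbox_imp_0[of 0 1 f u]) auto
qed

section \<open>The discriminant model\<close>

lemma mat_inverse_of_injective: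
  fixes A :: "real mat"
  assumes A: "A \<in> carrier_mat n n" and inj: "\<And>v. v \<in> carrier_vec n \<Longrightarrow> A *\<^sub>v v = 0\<^sub>v n \<Longrightarrow> v = 0\<^sub>v n"
  obtains P where "mat_inverse A = Some P" "P \<in> carrier_mat n n" "A * P = 1\<^sub>m n"
proof -
  have "det A \<noteq> 0" using det_0_iff_vec_prod_zero[OF A] inj by blast
  from det_non_zero_imp_unit[OF A this, of "()"] obtain P where P: "mat_inverse A = Some P"
    using mat_inverse(1)[OF A, of "()"] by (cases "mat_inverse A") auto
  then show thesis using that mat_inverse(2)[OF A P] by blast
qed

lemma sum_delta_eq:
  fixes j p :: nat
  assumes "j < p"
  shows "(\<Sum>i<p. (if i = j then b else 0) * g i) = b * (g j :: real)"
proof -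
  have "(\<Sum>i<p. (if i = j then b else 0) * g i) = (\<Sum>i<p. if i = j then b * g i else 0)" by (intro sum.cong) auto
  then show ?thesis using assms by simp
qed

lemma qform_delta:
  assumes "j < p" "j' < p"
  shows "qform p X (\<lambda>l. if l = j then b else 0) (\<lambda>l. if l = j' then b' else 0) = X j j' * b * b'"
proof -
  have "(\<Sum>l<p. X j l * (if l = j' then b' else 0)) = (\<Sum>l<p. (if l = j' then b' else 0) * X j l)"
    by (intro sum.cong refl mult.commute)
  then show ?thesis
    unfolding qform_left_sum sum_delta_eq[OF assms(1)] sum_delta_eq[OF assms(2)] by (simp add: mult_ac)
qed

lemma sum_blocks:
  fixes f :: "nat \<Rightarrow> 'a::comm_monoid_add"
  shows "(\<Sum>i<p * L. f i) = (\<Sum>j<p. \<Sum>k<L. f (j * L + k))"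
proof -
  have "sum f {j * L..<j * L + L} = (\<Sum>k<L. f (j * L + k))" for j
    using sum.shift_bounds_nat_ivl[of f 0 "j * L" L] by (simp add: lessThan_atLeast0 add.commute)
  then show ?thesis using sum.nat_group[of f L p] by simp
qed

lemma sum_pick:
  assumes "finite I"
  shows "(\<Sum>a<card I. f (pick I a) a) = (\<Sum>i\<in>I. f i (card {i'\<in>I. i' < i}))"
    and "i \<in> I \<Longrightarrow> card {i'\<in>I. i' < i} < card I"
proof -
  define idx where "idx i = card {i'\<in>I. i' < i}" for i
  have lt: "idx i < card I" if "i \<in> I" for i
    unfolding idx_def using that assms by (intro psubset_card_mono) auto
  then show "i \<in> I \<Longrightarrow> card {i'\<in>I. i' < i} < card I" by (simp add: idx_def)
  have pk: "pick I (idx i) = i" if "i \<in> I" for i unfolding idx_def by (rule pick_card_in_set[OF that])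
  then have inj: "inj_on idx I" by (metis inj_onI)
  have "idx ` I = {..<card I}"
    using lt assms inj by (intro card_subset_eq) (auto simp: card_image)
  then have "bij_betw idx I {..<card I}" using inj by (simp add: bij_betw_def)
  from sum.reindex_bij_betw[OF this, of "\<lambda>a. f (pick I a) a"]
  show "(\<Sum>a<card I. f (pick I a) a) = (\<Sum>i\<in>I. f i (card {i'\<in>I. i' < i}))"
    using pk by (simp add: idx_def[symmetric])
qed

locale varying_discriminant =
  fixes m t :: nat and r lam0 lam1 D1 D2 Dc Lc M cq :: real and p L :: nat and xi :: "nat \<Rightarrow> real"
    and h :: "real \<Rightarrow> real" and mu1 mu2 :: "real \<Rightarrow> real vec" and Sig :: "real \<Rightarrow> real mat" and ths :: "real \<Rightarrow> real vec"
  assumes m_pos: "1 \<le> m" and lam: "0 < lam0" "lam0 \<le> lam1" and D: "0 < D1" "D1 \<le> D2"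
    and r: "0 \<le> r" "r \<le> 1" and d: "1 \<le> real t + r" "real t + r \<le> real m"
    and mc: "model_conditions m t r lam0 lam1 D1 D2 Dc Lc M cq p L xi h mu1 mu2 Sig ths"
begin

definition S where "S = supp p h mu1 mu2 Sig"
definition \<delta> where "\<delta> i u = mu1 u $ i - mu2 u $ i"
definition \<beta> where "\<beta> i u = betastar mu1 mu2 Sig u $ i"
definition q where "q u = (\<Sum>i<p. \<delta> i u * \<beta> i u)"
definition A where "A u i j = Sig u $$ (i,j) + \<delta> i u * \<delta> j u / 4"
definition \<theta> where "\<theta> i u = \<beta> i u / (4 + q u)"
definition B where "B k u = Bsc m L xi k u"
definition tk where "tk = knots m (L - m) xi"

lemmas mcs = mc[unfolded model_conditions_def]
lemmas knots_quasi_uniform = mcs[THEN conjunct1]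
lemmas dims = mcs[THEN conjunct2, THEN conjunct1, rule_format]
lemmas spectrum = mcs[THEN conjunct2, THEN conjunct2, THEN conjunct1, rule_format]
lemmas Sig_meas = mcs[THEN conjunct2, THEN conjunct2, THEN conjunct2, THEN conjunct1, rule_format]
lemmas h_meas = mcs[THEN conjunct2, THEN conjunct2, THEN conjunct2, THEN conjunct2, THEN conjunct1]
lemmas h_bounds = mcs[THEN conjunct2, THEN conjunct2, THEN conjunct2, THEN conjunct2, THEN conjunct2, THEN conjunct2,
  THEN conjunct1, rule_format]
lemmas holder = mcs[THEN conjunct2, THEN conjunct2, THEN conjunct2, THEN conjunct2, THEN conjunct2, THEN conjunct2,
  THEN conjunct2, THEN conjunct1, rule_format]
lemmas minimizer = mcs[THEN conjunct2, THEN conjunct2, THEN conjunct2, THEN conjunct2, THEN conjunct2, THEN conjunct2,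
  THEN conjunct2, THEN conjunct2, THEN conjunct1, rule_format]
lemmas norm_bounds = mcs[THEN conjunct2, THEN conjunct2, THEN conjunct2, THEN conjunct2, THEN conjunct2, THEN conjunct2,
  THEN conjunct2, THEN conjunct2, THEN conjunct2, rule_format]

sublocale clamped_knots tk m L
  unfolding tk_def by (rule quasi_uniform_clamped_knots(1)[OF m_pos knots_quasi_uniform])

lemma L_pos: "0 < L" using order_pos order_le by simp

lemma S_subset: "S \<subseteq> {..<p}" "finite S"
proof -
  show "S \<subseteq> {..<p}" by (auto simp: S_def supp_def)
  then show "finite S" by (rule finite_subset) simp
qed

lemma Sig_sym:
  assumes "u \<in> {0..1}" "i < p" "j < p"
  shows "Sig u $$ (i,j) = Sig u $$ (j,i)"
  using arg_cong[OF spectrum[OF assms(1), THEN conjunct1], of "\<lambda>M. M $$ (i,j)"] carrier_matD[of "Sig u" p p] dims[OF assms(1)] assms by simp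

lemma Sig_bounds:
  assumes "u \<in> {0..1}"
  shows "lam0 * (\<Sum>i<p. (v i)\<^sup>2) \<le> qform p (\<lambda>i j. Sig u $$ (i,j)) v v"
    and "qform p (\<lambda>i j. Sig u $$ (i,j)) v v \<le> lam1 * (\<Sum>i<p. (v i)\<^sup>2)"
  using symmetric_qform_bounds[of "Sig u" p lam0 lam1 v] dims[OF assms] spectrum[OF assms] by auto

lemma Sig_pd:
  assumes "u \<in> {0..1}" "\<exists>i<p. v i \<noteq> 0"
  shows "0 < qform p (\<lambda>i j. Sig u $$ (i,j)) v v"
proof -
  obtain i where "i < p" "v i \<noteq> 0" using assms(2) by blast
  then have "0 < (\<Sum>i<p. (v i)\<^sup>2)" by (intro sum_pos2[of _ i]) auto
  then have "0 < lam0 * (\<Sum>i<p. (v i)\<^sup>2)" using lam by simp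
  then show ?thesis using Sig_bounds(1)[OF assms(1), of v] by linarith
qed

lemma Sig_beta:
  assumes u: "u \<in> {0..1}" and i: "i < p"
  shows "(\<Sum>j<p. Sig u $$ (i,j) * \<beta> j u) = \<delta> i u"
proof -
  have S: "Sig u \<in> carrier_mat p p" and mu: "mu1 u \<in> carrier_vec p" "mu2 u \<in> carrier_vec p" using dims[OF u] by auto
  obtain P where P: "mat_inverse (Sig u) = Some P" "P \<in> carrier_mat p p" "Sig u * P = 1\<^sub>m p"
  proof (rule mat_inverse_of_injective[OF S])
    fix v assume v: "v \<in> carrier_vec p" "Sig u *\<^sub>v v = 0\<^sub>v p"
    have "(\<Sum>j<p. Sig u $$ (i,j) * v $ j) = 0" if "i < p" for i
      using arg_cong[OF v(2), of "\<lambda>x. x $ i"] that S v(1) by (simp add: scalar_prod_def lessThan_atLeast0)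
    then have "qform p (\<lambda>i j. Sig u $$ (i,j)) (\<lambda>i. v $ i) (\<lambda>i. v $ i) = 0" by (simp add: qform_left_sum)
    then have "\<not> (\<exists>i<p. v $ i \<noteq> 0)" using Sig_pd[OF u, of "\<lambda>i. v $ i"] by auto
    then show "v = 0\<^sub>v p" using v(1) by (intro eq_vecI) auto
  qed auto
  define b where "b = P *\<^sub>v (mu1 u - mu2 u)"
  have b: "b \<in> carrier_vec p" using P(2) mu by (simp add: b_def)
  have "Sig u *\<^sub>v b = (Sig u * P) *\<^sub>v (mu1 u - mu2 u)"
    unfolding b_def using S P(2) mu by (intro assoc_mult_mat_vec[symmetric]) auto
  also have "\<dots> = mu1 u - mu2 u" using P(3) mu by simp
  finally have "(Sig u *\<^sub>v b) $ i = \<delta> i u" using i mu by (simp add: \<delta>_def)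
  moreover have "(Sig u *\<^sub>v b) $ i = (\<Sum>j<p. Sig u $$ (i,j) * b $ j)"
    using i S b by (simp add: scalar_prod_def lessThan_atLeast0)
  moreover have "b $ j = \<beta> j u" for j by (simp add: b_def \<beta>_def betastar_def P(1))
  ultimately show ?thesis by simp
qed

lemma qform_A: "qform p (A u) v w =
    qform p (\<lambda>i j. Sig u $$ (i,j)) v w + (\<Sum>i<p. v i * \<delta> i u) * (\<Sum>i<p. w i * \<delta> i u) / 4"
proof -
  have "(\<Sum>i<p. v i * \<delta> i u) * (\<Sum>i<p. w i * \<delta> i u) / 4 = (\<Sum>i<p. \<Sum>j<p. \<delta> i u * \<delta> j u / 4 * v i * w j)"
    unfolding sum_product sum_divide_distrib by (intro sum.cong refl) simp
  then show ?thesis unfolding qform_def A_def distrib_right sum.distrib by simp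
qed

lemma A_sym:
  assumes "u \<in> {0..1}" "i < p" "j < p"
  shows "A u i j = A u j i"
  using Sig_sym[OF assms] by (simp add: A_def)

lemma A_lower:
  assumes "u \<in> {0..1}"
  shows "lam0 * (\<Sum>i<p. (v i)\<^sup>2) \<le> qform p (A u) v v"
proof -
  have "0 \<le> (\<Sum>i<p. v i * \<delta> i u) * (\<Sum>i<p. v i * \<delta> i u) / 4" by simp
  then show ?thesis using Sig_bounds(1)[OF assms, of v] unfolding qform_A by linarith
qed

lemma q_nonneg:
  assumes "u \<in> {0..1}"
  shows "0 \<le> q u" and "lam0 * (\<Sum>i<p. (\<beta> i u)\<^sup>2) \<le> q u"
proof -
  have "q u = (\<Sum>i<p. \<beta> i u * (\<Sum>j<p. Sig u $$ (i,j) * \<beta> j u))"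
    unfolding q_def using Sig_beta[OF assms] by (intro sum.cong) auto
  then have "q u = qform p (\<lambda>i j. Sig u $$ (i,j)) (\<lambda>i. \<beta> i u) (\<lambda>i. \<beta> i u)" by (simp add: qform_left_sum)
  then show *: "lam0 * (\<Sum>i<p. (\<beta> i u)\<^sup>2) \<le> q u" using Sig_bounds(1)[OF assms] by simp
  have "0 \<le> lam0 * (\<Sum>i<p. (\<beta> i u)\<^sup>2)" using lam by (simp add: sum_nonneg)
  then show "0 \<le> q u" using * by linarith
qed

lemma A_theta:
  assumes u: "u \<in> {0..1}" and i: "i < p"
  shows "(\<Sum>j<p. A u i j * \<theta> j u) = \<delta> i u / 4"
proof -
  have "(\<Sum>j<p. A u i j * \<theta> j u) = (\<Sum>j<p. (Sig u $$ (i,j) * \<beta> j u + \<delta> i u / 4 * (\<delta> j u * \<beta> j u)) / (4 + q u))"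
    by (intro sum.cong refl) (simp add: A_def \<theta>_def distrib_right)
  also have "\<dots> = (\<delta> i u + \<delta> i u / 4 * q u) / (4 + q u)"
    unfolding sum_divide_distrib[symmetric] sum.distrib sum_distrib_left[symmetric] Sig_beta[OF u i] q_def ..
  also have "\<dots> = \<delta> i u / 4 * (4 + q u) / (4 + q u)" by (simp add: algebra_simps)
  also have "\<dots> = \<delta> i u / 4" using q_nonneg(1)[OF u] by (intro nonzero_mult_div_cancel_right) simp
  finally show ?thesis .
qed

lemma cond_exp_affine:
  assumes u: "u \<in> {0..1}"
    and f: "\<And>y x. f y (vec p x) = (c y + (\<Sum>i<p. a i * (x i - midpt mu1 mu2 u $ i))) * (c' y + (\<Sum>i<p. a' i * (x i - midpt mu1 mu2 u $ i)))"
  shows "cond_exp p (mu1 u) (mu2 u) (Sig u) f =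
    ((c True + (\<Sum>i<p. a i * \<delta> i u) / 2) * (c' True + (\<Sum>i<p. a' i * \<delta> i u) / 2)
     + (c False - (\<Sum>i<p. a i * \<delta> i u) / 2) * (c' False - (\<Sum>i<p. a' i * \<delta> i u) / 2)) / 2
    + qform p (\<lambda>i j. Sig u $$ (i,j)) a a'"
proof -
  have S: "Sig u \<in> carrier_mat p p" and mu: "mu1 u \<in> carrier_vec p" "mu2 u \<in> carrier_vec p" using dims[OF u] by auto
  have mid: "midpt mu1 mu2 u $ i = (mu1 u $ i + mu2 u $ i) / 2" if "i < p" for i
    using that mu by (simp add: midpt_def)
  define c0 where "c0 a = (\<Sum>i<p. a i * (midpt mu1 mu2 u $ i))" for a
  have shift: "b + (\<Sum>i<p. a i * (x i - midpt mu1 mu2 u $ i)) = (b - c0 a) + (\<Sum>i<p. a i * x i)" for a x and b :: real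
    by (simp add: c0_def right_diff_distrib sum_subtractf)
  have m1: "(b - c0 a) + (\<Sum>i<p. a i * mu1 u $ i) = b + (\<Sum>i<p. a i * \<delta> i u) / 2" for a b
  proof -
    have "(\<Sum>i<p. a i * \<delta> i u) / 2 = (\<Sum>i<p. a i * mu1 u $ i - a i * (midpt mu1 mu2 u $ i))"
      unfolding sum_divide_distrib by (intro sum.cong refl) (simp add: mid \<delta>_def field_simps)
    then show ?thesis unfolding c0_def sum_subtractf by linarith
  qed
  have m2: "(b - c0 a) + (\<Sum>i<p. a i * mu2 u $ i) = b - (\<Sum>i<p. a i * \<delta> i u) / 2" for a b
  proof -
    have "(\<Sum>i<p. a i * \<delta> i u) / 2 = (\<Sum>i<p. a i * (midpt mu1 mu2 u $ i) - a i * mu2 u $ i)"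
      unfolding sum_divide_distrib by (intro sum.cong refl) (simp add: mid \<delta>_def field_simps)
    then show ?thesis unfolding c0_def sum_subtractf by linarith
  qed
  have I: "(\<integral>x. f y (vec p x) * mvn_density p \<mu> (Sig u) x \<partial>lborel_pow p) =
    ((c y - c0 a) + (\<Sum>i<p. a i * \<mu> $ i)) * ((c' y - c0 a') + (\<Sum>i<p. a' i * \<mu> $ i)) + qform p (\<lambda>i j. Sig u $$ (i,j)) a a'"
    if "\<mu> \<in> carrier_vec p" for y \<mu>
    unfolding f shift by (rule mvn_affine_product[OF S that Sig_sym[OF u] Sig_pd[OF u]])
  show ?thesis unfolding cond_exp_def I[OF mu(1)] I[OF mu(2)] m1 m2 by (simp add: field_simps)
qed

lemma pop_exp_int01: "pop_exp p h mu1 mu2 Sig g = int01 (\<lambda>u. h u * cond_exp p (mu1 u) (mu2 u) (Sig u) (g u))"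
  by (simp add: pop_exp_def int01_def mult.assoc)

lemma Dmat_entry:
  assumes "i < p * L" "i' < p * L"
  shows "Dmat p m L xi h mu1 mu2 Sig $$ (i,i') =
    int01 (\<lambda>u. h u * (A u (i div L) (i' div L) * B (i mod L) u * B (i' mod L) u))"
proof -
  have j: "i div L < p" "i' div L < p" using assms by (auto simp: less_mult_imp_div_less)
  have "cond_exp p (mu1 u) (mu2 u) (Sig u) (\<lambda>y x. Btil m L xi mu1 mu2 i u x * Btil m L xi mu1 mu2 i' u x)
    = A u (i div L) (i' div L) * B (i mod L) u * B (i' mod L) u" if u: "u \<in> {0..1}" for u
  proof -
    let ?a = "\<lambda>l. if l = i div L then B (i mod L) u else 0"
    let ?a' = "\<lambda>l. if l = i' div L then B (i' mod L) u else 0"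
    have "cond_exp p (mu1 u) (mu2 u) (Sig u) (\<lambda>y x. Btil m L xi mu1 mu2 i u x * Btil m L xi mu1 mu2 i' u x) =
      ((0 + (\<Sum>i<p. ?a i * \<delta> i u) / 2) * (0 + (\<Sum>i<p. ?a' i * \<delta> i u) / 2)
     + (0 - (\<Sum>i<p. ?a i * \<delta> i u) / 2) * (0 - (\<Sum>i<p. ?a' i * \<delta> i u) / 2)) / 2
    + qform p (\<lambda>i j. Sig u $$ (i,j)) ?a ?a'"
      by (rule cond_exp_affine[OF u], subst sum_delta_eq[OF j(1)], subst sum_delta_eq[OF j(2)])
        (simp add: Btil_def B_def j mult_ac)
    also have "\<dots> = A u (i div L) (i' div L) * B (i mod L) u * B (i' mod L) u"
      unfolding sum_delta_eq[OF j(1)] sum_delta_eq[OF j(2)] qform_delta[OF j] A_def by (simp add: algebra_simps)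
    finally show ?thesis .
  qed
  then have "int01 (\<lambda>u. h u * cond_exp p (mu1 u) (mu2 u) (Sig u) (\<lambda>y x. Btil m L xi mu1 mu2 i u x * Btil m L xi mu1 mu2 i' u x)) =
    int01 (\<lambda>u. h u * (A u (i div L) (i' div L) * B (i mod L) u * B (i' mod L) u))"
    by (intro int01_cong arg_cong2[where f = "(*)"] refl)
  then show ?thesis using assms unfolding Dmat_def pop_exp_int01 by simp
qed

lemma bvec_entry:
  assumes "i < p * L"
  shows "bvec p m L xi h mu1 mu2 Sig $ i = int01 (\<lambda>u. h u * (\<delta> (i div L) u / 4 * B (i mod L) u))"
proof -
  have j: "i div L < p" using assms by (auto simp: less_mult_imp_div_less)
  have "cond_exp p (mu1 u) (mu2 u) (Sig u) (\<lambda>y x. Btil m L xi mu1 mu2 i u x * Zlab y)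
    = \<delta> (i div L) u / 4 * B (i mod L) u" if u: "u \<in> {0..1}" for u
  proof -
    let ?a = "\<lambda>l. if l = i div L then B (i mod L) u else 0"
    have "cond_exp p (mu1 u) (mu2 u) (Sig u) (\<lambda>y x. Btil m L xi mu1 mu2 i u x * Zlab y) =
      ((0 + (\<Sum>i<p. ?a i * \<delta> i u) / 2) * (Zlab True + (\<Sum>i<p. 0 * \<delta> i u) / 2)
     + (0 - (\<Sum>i<p. ?a i * \<delta> i u) / 2) * (Zlab False - (\<Sum>i<p. 0 * \<delta> i u) / 2)) / 2
    + qform p (\<lambda>i j. Sig u $$ (i,j)) ?a (\<lambda>_. 0)"
      by (rule cond_exp_affine[OF u], subst sum_delta_eq[OF j]) (simp add: Btil_def B_def j mult_ac)
    also have "\<dots> = \<delta> (i div L) u / 4 * B (i mod L) u"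
      unfolding sum_delta_eq[OF j] by (simp add: qform_def Zlab_def algebra_simps)
    finally show ?thesis .
  qed
  then have "int01 (\<lambda>u. h u * cond_exp p (mu1 u) (mu2 u) (Sig u) (\<lambda>y x. Btil m L xi mu1 mu2 i u x * Zlab y)) =
    int01 (\<lambda>u. h u * (\<delta> (i div L) u / 4 * B (i mod L) u))"
    by (intro int01_cong arg_cong2[where f = "(*)"] refl)
  then show ?thesis using assms unfolding bvec_def pop_exp_int01 by simp
qed

lemma objective:
  assumes u: "u \<in> {0..1}" and v: "v \<in> carrier_vec p"
  shows "cond_exp p (mu1 u) (mu2 u) (Sig u) (\<lambda>y x. (Zlab y - v \<bullet> (x - midpt mu1 mu2 u))^2) =
    1/4 - (\<Sum>i<p. v $ i * \<delta> i u) / 2 + qform p (A u) (\<lambda>i. v $ i) (\<lambda>i. v $ i)"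
proof -
  have mid: "midpt mu1 mu2 u \<in> carrier_vec p" using dims[OF u] by (simp add: midpt_def)
  have e: "(Zlab y - v \<bullet> (vec p x - midpt mu1 mu2 u))^2 =
    (Zlab y + (\<Sum>i<p. (- v $ i) * (x i - midpt mu1 mu2 u $ i))) * (Zlab y + (\<Sum>i<p. (- v $ i) * (x i - midpt mu1 mu2 u $ i)))" for y x
    using v mid by (simp add: scalar_prod_def lessThan_atLeast0 sum_negf power2_eq_square)
  have "qform p (\<lambda>i j. Sig u $$ (i,j)) (\<lambda>i. - v $ i) (\<lambda>i. - v $ i) = qform p (\<lambda>i j. Sig u $$ (i,j)) (\<lambda>i. v $ i) (\<lambda>i. v $ i)"
    by (simp add: qform_def)
  then show ?thesis
    unfolding cond_exp_affine[OF u e] qform_A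
    by (simp add: Zlab_def sum_negf power2_eq_square field_simps)
qed

lemma ths_eq:
  assumes u: "u \<in> {0..1}" and i: "i < p"
  shows "ths u $ i = \<theta> i u"
proof -
  have tc: "ths u \<in> carrier_vec p" using dims[OF u] by simp
  define e where "e i = ths u $ i - \<theta> i u" for i
  define v where "v = vec p (\<lambda>i. \<theta> i u)"
  have v: "v \<in> carrier_vec p" "\<And>i. i < p \<Longrightarrow> v $ i = \<theta> i u" by (auto simp: v_def)
  have cong: "qform p (A u) (\<lambda>i. v $ i) (\<lambda>i. v $ i) = qform p (A u) (\<lambda>i. \<theta> i u) (\<lambda>i. \<theta> i u)"
    "(\<Sum>i<p. v $ i * \<delta> i u) = (\<Sum>i<p. \<theta> i u * \<delta> i u)" unfolding qform_def using v(2) by auto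
  have ths: "ths u $ i = e i + \<theta> i u" for i by (simp add: e_def)
  have cross: "qform p (A u) e (\<lambda>i. \<theta> i u) = (\<Sum>i<p. e i * \<delta> i u) / 4"
    unfolding qform_left_sum sum_divide_distrib using A_theta[OF u] by (intro sum.cong) auto
  have cross': "qform p (A u) (\<lambda>i. \<theta> i u) e = (\<Sum>i<p. e i * \<delta> i u) / 4"
    using qform_sym[where v = "\<lambda>i. \<theta> i u" and w = e and A = "A u", OF A_sym[OF u]] cross by simp
  have "qform p (A u) (\<lambda>i. ths u $ i) (\<lambda>i. ths u $ i) =
    qform p (A u) e e + (\<Sum>i<p. e i * \<delta> i u) / 2 + qform p (A u) (\<lambda>i. \<theta> i u) (\<lambda>i. \<theta> i u)"
    unfolding ths qform_add_left qform_add_right cross cross' by simp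
  moreover have "(\<Sum>i<p. ths u $ i * \<delta> i u) = (\<Sum>i<p. e i * \<delta> i u) + (\<Sum>i<p. \<theta> i u * \<delta> i u)"
    unfolding ths by (simp add: distrib_right sum.distrib)
  ultimately have "qform p (A u) e e \<le> 0"
    using minimizer[OF u v(1)] unfolding objective[OF u tc] objective[OF u v(1)] cong by linarith
  then have "lam0 * (\<Sum>i<p. (e i)\<^sup>2) \<le> 0" using A_lower[OF u, of e] by linarith
  then have "(\<Sum>i<p. (e i)\<^sup>2) \<le> 0" using lam by (simp add: mult_le_0_iff)
  moreover have "(e i)\<^sup>2 \<le> (\<Sum>i<p. (e i)\<^sup>2)" using i by (intro member_le_sum) auto
  ultimately have "(e i)\<^sup>2 \<le> 0" by linarith
  then show ?thesis by (simp add: e_def)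
qed

lemma bmeas_h: "bmeas01 h"
proof -
  have "\<bar>h u\<bar> \<le> D2" if "u \<in> {0..1}" for u using h_bounds[OF that] D by auto
  then show ?thesis using h_meas unfolding bmeas01_def by blast
qed

lemma continuous_coords:
  assumes "j < p"
  shows "continuous_on {0..1} (\<delta> j)" "continuous_on {0..1} (\<beta> j)"
proof -
  have "continuous_on {0..1} (\<lambda>u. mu1 u $ j)" "continuous_on {0..1} (\<lambda>u. mu2 u $ j)"
    "continuous_on {0..1} (\<lambda>u. betastar mu1 mu2 Sig u $ j)"
    using holder[OF assms] holder_class_continuous[OF _ r(2) d(1)] by blast+
  then show "continuous_on {0..1} (\<delta> j)" "continuous_on {0..1} (\<beta> j)"
    unfolding \<delta>_def \<beta>_def by (auto intro: continuous_on_diff)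
qed

lemma bmeas_delta: "j < p \<Longrightarrow> bmeas01 (\<delta> j)"
  and bmeas_beta: "j < p \<Longrightarrow> bmeas01 (\<beta> j)"
  using continuous_coords bmeas01_continuous by blast+

lemma bmeas_Sig:
  assumes "i < p" "j < p"
  shows "bmeas01 (\<lambda>u. Sig u $$ (i,j))"
proof -
  have "\<bar>Sig u $$ (i,j)\<bar> \<le> 2 * lam1" if u: "u \<in> {0..1}" for u
  proof -
    let ?e = "\<lambda>i l. if l = i then 1 else (0::real)"
    let ?Q = "qform p (\<lambda>i j. Sig u $$ (i,j))"
    have diag: "0 \<le> Sig u $$ (l,l)" "Sig u $$ (l,l) \<le> lam1" if "l < p" for l
    proof -
      have s: "(\<Sum>i<p. (?e l i)\<^sup>2) = 1" using that by (simp add: if_distrib[of "\<lambda>x. x\<^sup>2"] cong: if_cong)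
      have Q: "?Q (?e l) (?e l) = Sig u $$ (l,l)" using qform_delta[OF that that, of "\<lambda>i j. Sig u $$ (i,j)" 1 1] by simp
      show "0 \<le> Sig u $$ (l,l)" "Sig u $$ (l,l) \<le> lam1"
        using Sig_bounds[OF u, of "?e l"] lam unfolding s Q by auto
    qed
    have Q: "?Q (\<lambda>l. ?e i l + ?e j l) (\<lambda>l. ?e i l + ?e j l) = Sig u $$ (i,i) + 2 * Sig u $$ (i,j) + Sig u $$ (j,j)"
      unfolding qform_add_left qform_add_right using assms Sig_sym[OF u assms]
      by (simp add: qform_delta[where b = 1 and b' = 1])
    have "(\<Sum>l<p. (?e i l + ?e j l)\<^sup>2) \<le> (\<Sum>l<p. 2 * ?e i l + 2 * ?e j l)"
      by (intro sum_mono) auto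
    also have "\<dots> = 4" using assms by (simp add: sum.distrib if_distrib[of "\<lambda>x. 2 * x"] cong: if_cong)
    finally have "lam1 * (\<Sum>l<p. (?e i l + ?e j l)\<^sup>2) \<le> lam1 * 4" using lam by (intro mult_left_mono) auto
    moreover have "0 \<le> lam0 * (\<Sum>l<p. (?e i l + ?e j l)\<^sup>2)" using lam by (intro mult_nonneg_nonneg sum_nonneg) auto
    ultimately show ?thesis
      using Sig_bounds[OF u, of "\<lambda>l. ?e i l + ?e j l"] diag[OF assms(1)] diag[OF assms(2)] unfolding Q by linarith
  qed
  then show ?thesis using Sig_meas[OF assms] unfolding bmeas01_def by blast
qed

lemma bmeas_A: "i < p \<Longrightarrow> j < p \<Longrightarrow> bmeas01 (\<lambda>u. A u i j)"
  unfolding A_def divide_inverse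
  by (intro bmeas01_add bmeas01_mult bmeas01_const bmeas_Sig bmeas_delta)

lemma bmeas_theta: "j < p \<Longrightarrow> bmeas01 (\<theta> j)"
proof -
  assume j: "j < p"
  have "bmeas01 (\<lambda>u. 4 + q u)" unfolding q_def
    by (intro bmeas01_add bmeas01_const bmeas01_sum bmeas01_mult bmeas_delta bmeas_beta) auto
  then have "bmeas01 (\<lambda>u. 1 / (4 + q u))" using q_nonneg(1) by (intro bmeas01_inverse) fastforce+
  moreover have "\<theta> j = (\<lambda>u. \<beta> j u * (1 / (4 + q u)))" by (simp add: fun_eq_iff \<theta>_def)
  ultimately show ?thesis using bmeas01_mult[OF bmeas_beta[OF j]] by (simp only:)
qed

lemma bmeas_B: "k < L \<Longrightarrow> bmeas01 (B k)"
proof -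
  assume k: "k < L"
  have "\<bar>bspl tk k m u\<bar> \<le> 1" if "u \<in> {0..1}" for u
  proof -
    have "bspl tk k m u \<le> (\<Sum>i<L. bspl tk i m u)" using k bspl_nonneg[OF mono_knots] by (intro member_le_sum) auto
    then show ?thesis using bspl_partition_of_unity[of u] bspl_nonneg[OF mono_knots, of k m u] that by simp
  qed
  then have "bmeas01 (\<lambda>u. bspl tk k m u)" unfolding bmeas01_def by (intro conjI exI[of _ 1]) auto
  moreover have "B k = (\<lambda>u. sqrt (real L) * bspl tk k m u)" by (simp add: fun_eq_iff B_def Bsc_def Bstar_def tk_def)
  ultimately show ?thesis by (simp only: bmeas01_mult bmeas01_const)
qed

lemma beta_off_support:
  assumes "j < p" "j \<notin> S" "u \<in> {0..1}"
  shows "\<beta> j u = 0"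
proof -
  have m2: "bmeas01 (\<lambda>u. (\<beta> j u)\<^sup>2)"
    unfolding power2_eq_square using bmeas_beta[OF assms(1)] by (intro bmeas01_mult)
  have "int01 (\<lambda>u. h u * (\<beta> j u)\<^sup>2) \<le> 0"
    using assms(1,2) by (simp add: S_def supp_def int01_def \<beta>_def mult.assoc not_less)
  moreover have "D1 * int01 (\<lambda>u. (\<beta> j u)\<^sup>2) \<le> int01 (\<lambda>u. h u * (\<beta> j u)\<^sup>2)"
    unfolding int01_cmult[symmetric] using h_bounds
    by (intro int01_mono bmeas01_mult bmeas01_const bmeas_h m2) (auto intro: mult_right_mono)
  ultimately have "D1 * int01 (\<lambda>u. (\<beta> j u)\<^sup>2) \<le> 0" by linarith
  then have "int01 (\<lambda>u. (\<beta> j u)\<^sup>2) \<le> 0" using D by (simp add: mult_le_0_iff)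
  moreover have "0 \<le> int01 (\<lambda>u. (\<beta> j u)\<^sup>2)" by (intro int01_nonneg) simp
  ultimately have "(\<beta> j u)\<^sup>2 = 0"
    using continuous_coords(2)[OF assms(1)]
    by (intro int01_zero_continuous[OF _ _ _ assms(3), of "\<lambda>u. (\<beta> j u)\<^sup>2"]) (auto intro: continuous_intros)
  then show ?thesis by simp
qed

lemma sum_support:
  assumes "\<And>j. j < p \<Longrightarrow> j \<notin> S \<Longrightarrow> f j = (0::real)"
  shows "(\<Sum>j<p. f j) = (\<Sum>j\<in>S. f j)"
  using S_subset assms by (intro sum.mono_neutral_right) auto

lemma q_support: "u \<in> {0..1} \<Longrightarrow> q u = (\<Sum>j\<in>S. \<delta> j u * \<beta> j u)"
  unfolding q_def using beta_off_support by (intro sum_support) auto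

lemma delta_norm: "u \<in> {0..1} \<Longrightarrow> L2_set (\<lambda>j. \<delta> j u) S \<le> M"
  using norm_bounds unfolding L2_set_def \<delta>_def S_def by blast

lemma beta_norm:
  assumes u: "u \<in> {0..1}"
  shows "L2_set (\<lambda>j. \<beta> j u) S \<le> M / lam0"
proof -
  define b where "b = L2_set (\<lambda>j. \<beta> j u) S"
  have b0: "0 \<le> b" by (simp add: b_def)
  have "(\<Sum>i<p. (\<beta> i u)\<^sup>2) = (\<Sum>i\<in>S. (\<beta> i u)\<^sup>2)" using beta_off_support[OF _ _ u] by (intro sum_support) auto
  also have "\<dots> = b\<^sup>2" by (simp add: b_def L2_set_def sum_nonneg)
  finally have "lam0 * b\<^sup>2 \<le> q u" using q_nonneg(2)[OF u] by simp
  also have "q u \<le> L2_set (\<lambda>j. \<delta> j u) S * b"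
    unfolding q_support[OF u] b_def using abs_inner_le_L2_set[of "\<lambda>j. \<delta> j u" "\<lambda>j. \<beta> j u" S] by linarith
  also have "\<dots> \<le> M * b" using delta_norm[OF u] b0 by (intro mult_right_mono)
  finally have le: "b * (lam0 * b) \<le> b * M" by (simp add: power2_eq_square mult_ac)
  have "0 \<le> M" using delta_norm[OF u] L2_set_nonneg order_trans by blast
  then have "lam0 * b \<le> M" using le b0 by (cases "b = 0") auto
  then show ?thesis using lam by (simp add: b_def field_simps)
qed

end

section \<open>Galerkin projection\<close>

context varying_discriminant
begin

definition spl where "spl \<gamma> j u = (\<Sum>k<L. \<gamma> (j * L + k) * B k u)"
definition ell where "ell w i = int01 (\<lambda>u. h u * (B (i mod L) u * (\<Sum>j<p. A u (i div L) j * w j u)))"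
definition IS where "IS = {i. i < p * L \<and> i div L \<in> S}"
definition energy where "energy v w = int01 (\<lambda>u. h u * qform p (A u) (\<lambda>j. v j u) (\<lambda>j. w j u))"

lemma block_div_mod:
  assumes "k < L"
  shows "(j * L + k) div L = j" "(j * L + k) mod L = k"
  using assms by auto

lemma bmeas_spl: "bmeas01 (spl \<gamma> j)"
proof -
  have "spl \<gamma> j = (\<lambda>u. \<Sum>k<L. \<gamma> (j * L + k) * B k u)" by (simp add: fun_eq_iff spl_def)
  moreover have "bmeas01 (\<lambda>u. \<Sum>k<L. \<gamma> (j * L + k) * B k u)"
    by (intro bmeas01_sum bmeas01_mult bmeas01_const bmeas_B) auto
  ultimately show ?thesis by (simp only:)
qed

lemma bmeas_row: "j < p \<Longrightarrow> (\<And>j. j < p \<Longrightarrow> bmeas01 (w j)) \<Longrightarrow> bmeas01 (\<lambda>u. \<Sum>j'<p. A u j j' * w j' u)"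
  by (intro bmeas01_sum bmeas01_mult bmeas_A) auto

lemma bmeas_qform:
  assumes "\<And>j. j < p \<Longrightarrow> bmeas01 (v j)" "\<And>j. j < p \<Longrightarrow> bmeas01 (w j)"
  shows "bmeas01 (\<lambda>u. h u * qform p (A u) (\<lambda>j. v j u) (\<lambda>j. w j u))"
  unfolding qform_left_sum using assms by (intro bmeas01_mult bmeas_h bmeas01_sum bmeas_row) auto

lemma bmeas_ell_integrand:
  assumes "i < p * L" "\<And>j. j < p \<Longrightarrow> bmeas01 (w j)"
  shows "bmeas01 (\<lambda>u. h u * (B (i mod L) u * (\<Sum>j<p. A u (i div L) j * w j u)))"
  using assms L_pos by (intro bmeas01_mult bmeas_h bmeas_B bmeas_row) (auto simp: less_mult_imp_div_less)

lemma energy_spl: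
  assumes w: "\<And>j. j < p \<Longrightarrow> bmeas01 (w j)"
  shows "energy (spl \<gamma>) w = (\<Sum>i<p * L. \<gamma> i * ell w i)"
proof -
  have "h u * qform p (A u) (\<lambda>j. spl \<gamma> j u) (\<lambda>j. w j u) =
    (\<Sum>i<p * L. \<gamma> i * (h u * (B (i mod L) u * (\<Sum>j<p. A u (i div L) j * w j u))))" for u
  proof -
    define G where "G j = (\<Sum>j'<p. A u j j' * w j' u)" for j
    have "h u * (\<Sum>j<p. spl \<gamma> j u * G j) = (\<Sum>j<p. \<Sum>k<L. \<gamma> (j * L + k) * (h u * (B k u * G j)))"
      by (simp add: spl_def sum_distrib_left sum_distrib_right mult_ac)
    also have "\<dots> = (\<Sum>i<p * L. \<gamma> i * (h u * (B (i mod L) u * G (i div L))))"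
      unfolding sum_blocks by (intro sum.cong refl) (simp add: block_div_mod)
    finally show ?thesis by (simp add: qform_left_sum G_def)
  qed
  then have "energy (spl \<gamma>) w = int01 (\<lambda>u. \<Sum>i<p * L. \<gamma> i * (h u * (B (i mod L) u * (\<Sum>j<p. A u (i div L) j * w j u))))"
    by (simp add: energy_def)
  also have "\<dots> = (\<Sum>i<p * L. int01 (\<lambda>u. \<gamma> i * (h u * (B (i mod L) u * (\<Sum>j<p. A u (i div L) j * w j u)))))"
    using w by (intro int01_sum bmeas01_mult[OF bmeas01_const] bmeas_ell_integrand) auto
  finally show ?thesis by (simp add: int01_cmult ell_def)
qed

lemma ell_spl:
  assumes i: "i < p * L"
  shows "ell (spl \<gamma>) i = (\<Sum>i'<p * L. Dmat p m L xi h mu1 mu2 Sig $$ (i,i') * \<gamma> i')"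
proof -
  have j: "i div L < p" using i by (auto simp: less_mult_imp_div_less)
  have "h u * (B (i mod L) u * (\<Sum>j<p. A u (i div L) j * spl \<gamma> j u)) =
    (\<Sum>i'<p * L. \<gamma> i' * (h u * (A u (i div L) (i' div L) * B (i mod L) u * B (i' mod L) u)))" for u
    unfolding sum_blocks spl_def sum_distrib_left
    by (intro sum.cong refl) (simp add: block_div_mod mult_ac)
  then have "ell (spl \<gamma>) i = int01 (\<lambda>u. \<Sum>i'<p * L. \<gamma> i' * (h u * (A u (i div L) (i' div L) * B (i mod L) u * B (i' mod L) u)))"
    by (simp add: ell_def)
  also have "\<dots> = (\<Sum>i'<p * L. int01 (\<lambda>u. \<gamma> i' * (h u * (A u (i div L) (i' div L) * B (i mod L) u * B (i' mod L) u))))"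
    using j L_pos by (intro int01_sum bmeas01_mult bmeas01_const bmeas_h bmeas_A bmeas_B) (auto simp: less_mult_imp_div_less)
  also have "\<dots> = (\<Sum>i'<p * L. Dmat p m L xi h mu1 mu2 Sig $$ (i,i') * \<gamma> i')"
    using Dmat_entry[OF i] by (intro sum.cong) (auto simp: int01_cmult mult.commute)
  finally show ?thesis .
qed

lemma ell_theta:
  assumes i: "i < p * L"
  shows "ell \<theta> i = bvec p m L xi h mu1 mu2 Sig $ i"
proof -
  have j: "i div L < p" using i by (auto simp: less_mult_imp_div_less)
  show ?thesis unfolding ell_def bvec_entry[OF i]
  proof (rule int01_cong)
    fix u :: real assume "u \<in> {0..1}"
    from A_theta[OF this j]
    show "h u * (B (i mod L) u * (\<Sum>j<p. A u (i div L) j * \<theta> j u)) = h u * (\<delta> (i div L) u / 4 * B (i mod L) u)" by simp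
  qed
qed

lemma ell_diff:
  assumes "i < p * L" "\<And>j. j < p \<Longrightarrow> bmeas01 (v j)" "\<And>j. j < p \<Longrightarrow> bmeas01 (w j)"
  shows "ell (\<lambda>j u. v j u - w j u) i = ell v i - ell w i"
proof -
  have "h u * (B (i mod L) u * (\<Sum>j<p. A u (i div L) j * (v j u - w j u))) =
    h u * (B (i mod L) u * (\<Sum>j<p. A u (i div L) j * v j u)) + (-1) * (h u * (B (i mod L) u * (\<Sum>j<p. A u (i div L) j * w j u)))" for u
    by (simp add: right_diff_distrib sum_subtractf)
  then show ?thesis
    using assms unfolding ell_def
    by (simp only: int01_add bmeas_ell_integrand bmeas01_mult bmeas01_const int01_cmult)
qed

lemma energy_lower:
  assumes "\<And>j. j < p \<Longrightarrow> bmeas01 (v j)"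
  shows "D1 * lam0 * int01 (\<lambda>u. \<Sum>j<p. (v j u)\<^sup>2) \<le> energy v v"
  unfolding int01_cmult[symmetric] energy_def
proof (rule int01_mono)
  show "bmeas01 (\<lambda>u. D1 * lam0 * (\<Sum>j<p. (v j u)\<^sup>2))"
    unfolding power2_eq_square using assms by (intro bmeas01_mult bmeas01_const bmeas01_sum) auto
  show "bmeas01 (\<lambda>u. h u * qform p (A u) (\<lambda>j. v j u) (\<lambda>j. v j u))" using assms by (intro bmeas_qform)
  fix u assume u: "u \<in> {0..1::real}"
  have "0 \<le> lam0 * (\<Sum>j<p. (v j u)\<^sup>2)" using lam by (simp add: sum_nonneg)
  then have "D1 * (lam0 * (\<Sum>j<p. (v j u)\<^sup>2)) \<le> h u * qform p (A u) (\<lambda>j. v j u) (\<lambda>j. v j u)"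
    using h_bounds[OF u] D A_lower[OF u, of "\<lambda>j. v j u"] by (intro mult_mono) auto
  then show "D1 * lam0 * (\<Sum>j<p. (v j u)\<^sup>2) \<le> h u * qform p (A u) (\<lambda>j. v j u) (\<lambda>j. v j u)" by (simp add: mult.assoc)
qed

lemma A_upper:
  assumes u: "u \<in> {0..1}" and off: "\<And>j. j < p \<Longrightarrow> j \<notin> S \<Longrightarrow> v j = 0"
  shows "qform p (A u) v v \<le> (lam1 + M\<^sup>2 / 4) * (\<Sum>j<p. (v j)\<^sup>2)"
proof -
  have "(\<Sum>i<p. v i * \<delta> i u) = (\<Sum>i\<in>S. v i * \<delta> i u)" using off by (intro sum_support) auto
  then have "\<bar>\<Sum>i<p. v i * \<delta> i u\<bar> \<le> L2_set v S * L2_set (\<lambda>i. \<delta> i u) S" using abs_inner_le_L2_set by simp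
  also have "\<dots> \<le> L2_set v S * M" using delta_norm[OF u] by (intro mult_left_mono) auto
  finally have "(\<Sum>i<p. v i * \<delta> i u)\<^sup>2 \<le> (L2_set v S * M)\<^sup>2" by (rule abs_le_square_iff[THEN iffD1, OF order_trans]) simp
  also have "\<dots> = (\<Sum>j<p. (v j)\<^sup>2) * M\<^sup>2"
  proof -
    have "(\<Sum>j<p. (v j)\<^sup>2) = (\<Sum>j\<in>S. (v j)\<^sup>2)" using off by (intro sum_support) auto
    then show ?thesis by (simp add: L2_set_def power_mult_distrib sum_nonneg)
  qed
  finally have "(\<Sum>i<p. v i * \<delta> i u) * (\<Sum>i<p. v i * \<delta> i u) / 4 \<le> M\<^sup>2 / 4 * (\<Sum>j<p. (v j)\<^sup>2)"
    by (simp add: power2_eq_square mult_ac)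
  then show ?thesis unfolding qform_A using Sig_bounds(2)[OF u, of v] unfolding distrib_right by linarith
qed

lemma energy_upper:
  assumes "\<And>j. j < p \<Longrightarrow> bmeas01 (v j)" and off: "\<And>j u. j < p \<Longrightarrow> j \<notin> S \<Longrightarrow> u \<in> {0..1} \<Longrightarrow> v j u = 0"
  shows "energy v v \<le> D2 * (lam1 + M\<^sup>2 / 4) * int01 (\<lambda>u. \<Sum>j<p. (v j u)\<^sup>2)"
  unfolding int01_cmult[symmetric] energy_def
proof (rule int01_mono)
  show "bmeas01 (\<lambda>u. D2 * (lam1 + M\<^sup>2 / 4) * (\<Sum>j<p. (v j u)\<^sup>2))"
    unfolding power2_eq_square using assms by (intro bmeas01_mult[OF bmeas01_const] bmeas01_sum bmeas01_mult) auto
  show "bmeas01 (\<lambda>u. h u * qform p (A u) (\<lambda>j. v j u) (\<lambda>j. v j u))" using assms by (intro bmeas_qform)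
  fix u assume u: "u \<in> {0..1::real}"
  have "0 \<le> lam0 * (\<Sum>j<p. (v j u)\<^sup>2)" using lam by (simp add: sum_nonneg)
  then have "0 \<le> qform p (A u) (\<lambda>j. v j u) (\<lambda>j. v j u)" using A_lower[OF u, of "\<lambda>j. v j u"] by linarith
  then have "h u * qform p (A u) (\<lambda>j. v j u) (\<lambda>j. v j u) \<le> D2 * ((lam1 + M\<^sup>2 / 4) * (\<Sum>j<p. (v j u)\<^sup>2))"
    using h_bounds[OF u] D A_upper[OF u, of "\<lambda>j. v j u"] off u by (intro mult_mono) auto
  then show "h u * qform p (A u) (\<lambda>j. v j u) (\<lambda>j. v j u) \<le> D2 * (lam1 + M\<^sup>2 / 4) * (\<Sum>j<p. (v j u)\<^sup>2)" by (simp add: mult.assoc)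
qed

lemma Dmat_injective:
  assumes off: "\<And>i. i \<notin> IS \<Longrightarrow> \<gamma> i = 0"
    and ker: "\<And>i. i \<in> IS \<Longrightarrow> (\<Sum>i'<p * L. Dmat p m L xi h mu1 mu2 Sig $$ (i,i') * \<gamma> i') = 0"
  shows "\<gamma> i = 0"
proof (cases "i \<in> IS")
  case True
  define N where "N = int01 (\<lambda>u. \<Sum>j<p. (spl \<gamma> j u)\<^sup>2)"
  have "\<gamma> i * ell (spl \<gamma>) i = 0" if "i < p * L" for i
    using off[of i] ker[of i] ell_spl[OF that, of \<gamma>] by (cases "i \<in> IS") auto
  then have "energy (spl \<gamma>) (spl \<gamma>) = 0" unfolding energy_spl[OF bmeas_spl] by (intro sum.neutral) blast
  then have "D1 * lam0 * N \<le> 0" using energy_lower[of "spl \<gamma>", OF bmeas_spl] by (simp add: N_def)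
  moreover have "0 < D1 * lam0" using D lam by simp
  ultimately have "N \<le> 0" by (metis linorder_not_le mult_pos_pos)
  moreover have "0 \<le> N" unfolding N_def by (intro int01_nonneg sum_nonneg) auto
  ultimately have "N = 0" by simp
  moreover have "bmeas01 (\<lambda>u. \<Sum>j<p. (spl \<gamma> j u)\<^sup>2)"
    unfolding power2_eq_square by (intro bmeas01_sum bmeas01_mult bmeas_spl)
  ultimately have AE: "AE u in lborel. 0 \<le> u \<and> u \<le> 1 \<longrightarrow> (\<Sum>j<p. (spl \<gamma> j u)\<^sup>2) = 0"
    unfolding N_def by (intro int01_zero_AE) (auto intro: sum_nonneg)
  define j where "j = i div L"
  define k where "k = i mod L"
  have j: "j < p" and k: "k < L" using True L_pos by (auto simp: IS_def j_def k_def less_mult_imp_div_less)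
  have "AE u in lborel. 0 \<le> u \<and> u \<le> 1 \<longrightarrow> (\<Sum>k<L. (\<gamma> (j * L + k) * sqrt (real L)) * bspl tk k m u) = 0"
    using AE
  proof eventually_elim
    case (elim u)
    show ?case
    proof
      assume "0 \<le> u \<and> u \<le> 1"
      with elim have "(\<Sum>j<p. (spl \<gamma> j u)\<^sup>2) = 0" by simp
      then have "spl \<gamma> j u = 0" using j by (simp add: sum_nonneg_eq_0_iff)
      then show "(\<Sum>k<L. (\<gamma> (j * L + k) * sqrt (real L)) * bspl tk k m u) = 0"
        by (simp add: spl_def B_def Bsc_def Bstar_def tk_def mult.assoc)
    qed
  qed
  from bspl_linear_independent[OF this k] have "\<gamma> (j * L + k) = 0" using L_pos by simp
  moreover have "j * L + k = i" by (simp add: j_def k_def)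
  ultimately show ?thesis by simp
qed (rule off)

definition \<gamma>t where "\<gamma>t i = (if i < p * L then gamma_tilde p m L xi h mu1 mu2 Sig $ i else 0)"

lemma gamma_tilde_normal_equations:
  shows "i \<notin> IS \<Longrightarrow> \<gamma>t i = 0"
    and "i \<in> IS \<Longrightarrow> (\<Sum>i'<p * L. Dmat p m L xi h mu1 mu2 Sig $$ (i,i') * \<gamma>t i') = bvec p m L xi h mu1 mu2 Sig $ i"
proof -
  let ?D = "Dmat p m L xi h mu1 mu2 Sig" and ?b = "bvec p m L xi h mu1 mu2 Sig"
  define n where "n = card IS"
  define idx where "idx i = card {i'\<in>IS. i' < i}" for i
  define Dss where "Dss = submatrix ?D IS IS"
  have fin: "finite IS" by (rule finite_subset[of _ "{..<p * L}"]) (auto simp: IS_def)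
  have idx_lt: "i \<in> IS \<Longrightarrow> idx i < n" for i unfolding idx_def n_def by (rule sum_pick(2)[OF fin])
  have pick_idx: "i \<in> IS \<Longrightarrow> pick IS (idx i) = i" for i unfolding idx_def by (rule pick_card_in_set)
  have restrict: "{i. i < p * L \<and> i \<in> IS} = IS" by (auto simp: IS_def)
  have dimD: "dim_row ?D = p * L" "dim_col ?D = p * L" by (auto simp: Dmat_def)
  have Dss: "Dss \<in> carrier_mat n n" unfolding Dss_def n_def by (intro carrier_matI) (simp_all add: dim_submatrix dimD restrict)
  have entry: "Dss $$ (a, b) = ?D $$ (pick IS a, pick IS b)" if "a < n" "b < n" for a b
    unfolding Dss_def using that by (intro submatrix_index) (simp_all add: dimD restrict n_def)
  have row: "(Dss *\<^sub>v v) $ idx i = (\<Sum>i'<p * L. ?D $$ (i,i') * (if i' \<in> IS then v $ idx i' else 0))"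
    if v: "v \<in> carrier_vec n" and i: "i \<in> IS" for v i
  proof -
    have "(Dss *\<^sub>v v) $ idx i = (\<Sum>a<n. ?D $$ (i, pick IS a) * v $ a)"
      using Dss v idx_lt[OF i] by (simp add: scalar_prod_def lessThan_atLeast0 entry pick_idx[OF i])
    also have "\<dots> = (\<Sum>i'\<in>IS. ?D $$ (i,i') * v $ idx i')"
      unfolding n_def idx_def by (rule sum_pick(1)[OF fin, of "\<lambda>i' a. ?D $$ (i,i') * v $ a"])
    also have "\<dots> = (\<Sum>i'<p * L. ?D $$ (i,i') * (if i' \<in> IS then v $ idx i' else 0))"
      by (rule sum.mono_neutral_cong_left) (auto simp: IS_def)
    finally show ?thesis .
  qed
  obtain P where P: "mat_inverse Dss = Some P" "P \<in> carrier_mat n n" "Dss * P = 1\<^sub>m n"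
  proof (rule mat_inverse_of_injective[OF Dss])
    fix v assume v: "v \<in> carrier_vec n" "Dss *\<^sub>v v = 0\<^sub>v n"
    define \<gamma> where "\<gamma> i = (if i \<in> IS then v $ idx i else 0)" for i
    have ker: "(\<Sum>i'<p * L. ?D $$ (i,i') * \<gamma> i') = 0" if "i \<in> IS" for i
      using row[OF v(1) that] v(2) idx_lt[OF that] by (simp add: \<gamma>_def)
    have z: "\<gamma> i = 0" for i
      by (rule Dmat_injective[OF _ ker]) (simp add: \<gamma>_def)
    have "v $ a = 0" if "a < n" for a
    proof -
      have "(\<Sum>i\<in>IS. (if idx i = a then 1 else 0) * v $ idx i) = (0::real)"
      proof (intro sum.neutral ballI)
        fix i assume "i \<in> IS"
        then show "(if idx i = a then 1 else 0) * v $ idx i = 0" using z[of i] by (simp add: \<gamma>_def)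
      qed
      moreover have "(\<Sum>b<n. (if b = a then 1 else 0) * v $ b) = (\<Sum>i\<in>IS. (if idx i = a then 1 else 0) * v $ idx i)"
        unfolding n_def idx_def by (rule sum_pick(1)[OF fin, of "\<lambda>i b. (if b = a then 1 else 0) * v $ b"])
      ultimately show ?thesis using sum_delta_eq[OF that, of 1 "\<lambda>b. v $ b"] by simp
    qed
    then show "v = 0\<^sub>v n" using v(1) by (intro eq_vecI) auto
  qed auto
  define bS where "bS = vec n (\<lambda>k. ?b $ pick IS k)"
  define gS where "gS = P *\<^sub>v bS"
  have gS: "gS \<in> carrier_vec n" using P(2) by (simp add: gS_def bS_def)
  have "Dss *\<^sub>v gS = (Dss * P) *\<^sub>v bS"
    unfolding gS_def using Dss P(2) by (intro assoc_mult_mat_vec[symmetric]) (auto simp: bS_def)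
  also have "\<dots> = bS" using P(3) by (simp add: bS_def)
  finally have solve: "Dss *\<^sub>v gS = bS" .
  have "gamma_tilde p m L xi h mu1 mu2 Sig = vec (p * L) (\<lambda>i. if i \<in> IS then gS $ idx i else 0)"
    unfolding gamma_tilde_def Let_def S_def[symmetric] IS_def[symmetric] Dss_def[symmetric] P(1) option.sel
      n_def[symmetric] bS_def[symmetric] gS_def[symmetric] idx_def ..
  then have \<gamma>t: "\<gamma>t i = (if i \<in> IS then gS $ idx i else 0)" for i by (auto simp: \<gamma>t_def IS_def)
  show "i \<notin> IS \<Longrightarrow> \<gamma>t i = 0" by (simp add: \<gamma>t)
  assume i: "i \<in> IS"
  have "(\<Sum>i'<p * L. ?D $$ (i,i') * \<gamma>t i') = bS $ idx i" using row[OF gS i] unfolding \<gamma>t solve by simp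
  also have "\<dots> = ?b $ i" using idx_lt[OF i] pick_idx[OF i] by (simp add: bS_def)
  finally show "(\<Sum>i'<p * L. ?D $$ (i,i') * \<gamma>t i') = ?b $ i" .
qed

definition err where "err j u = spl \<gamma>t j u - \<theta> j u"

lemma bmeas_err: "j < p \<Longrightarrow> bmeas01 (err j)"
proof -
  assume "j < p"
  then have "bmeas01 (\<lambda>u. spl \<gamma>t j u - \<theta> j u)" by (intro bmeas01_diff bmeas_spl bmeas_theta)
  then show ?thesis by (simp add: err_def[abs_def])
qed

lemma galerkin_orthogonality:
  assumes "i \<in> IS"
  shows "ell err i = 0"
proof -
  have i: "i < p * L" using assms by (simp add: IS_def)
  have "ell err i = ell (spl \<gamma>t) i - ell \<theta> i"
    using ell_diff[OF i, of "spl \<gamma>t" \<theta>] bmeas_spl bmeas_theta by (simp add: err_def[abs_def])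
  then show ?thesis by (simp add: ell_spl[OF i] ell_theta[OF i] gamma_tilde_normal_equations(2)[OF assms])
qed

lemma best_approximation:
  assumes off: "\<And>i. i \<notin> IS \<Longrightarrow> \<gamma> i = 0"
  shows "energy err err \<le> energy (\<lambda>j u. spl \<gamma> j u - \<theta> j u) (\<lambda>j u. spl \<gamma> j u - \<theta> j u)"
proof -
  define w where "w i = \<gamma> i - \<gamma>t i" for i
  have dec: "spl \<gamma> j u - \<theta> j u = spl w j u + err j u" for j u
    by (simp add: spl_def w_def err_def left_diff_distrib sum_subtractf)
  have "h u * qform p (A u) (\<lambda>j. spl \<gamma> j u - \<theta> j u) (\<lambda>j. spl \<gamma> j u - \<theta> j u) =
    (h u * qform p (A u) (\<lambda>j. spl w j u) (\<lambda>j. spl w j u) + 2 * (h u * qform p (A u) (\<lambda>j. spl w j u) (\<lambda>j. err j u)))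
     + h u * qform p (A u) (\<lambda>j. err j u) (\<lambda>j. err j u)" if u: "u \<in> {0..1}" for u
  proof -
    have "qform p (A u) (\<lambda>j. err j u) (\<lambda>j. spl w j u) = qform p (A u) (\<lambda>j. spl w j u) (\<lambda>j. err j u)"
      by (rule qform_sym[OF A_sym[OF u]])
    then show ?thesis unfolding dec qform_add_left qform_add_right by (simp add: algebra_simps)
  qed
  then have "energy (\<lambda>j u. spl \<gamma> j u - \<theta> j u) (\<lambda>j u. spl \<gamma> j u - \<theta> j u) =
    int01 (\<lambda>u. (h u * qform p (A u) (\<lambda>j. spl w j u) (\<lambda>j. spl w j u) + 2 * (h u * qform p (A u) (\<lambda>j. spl w j u) (\<lambda>j. err j u)))
     + h u * qform p (A u) (\<lambda>j. err j u) (\<lambda>j. err j u))"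
    unfolding energy_def by (rule int01_cong)
  also have "\<dots> = energy (spl w) (spl w) + 2 * energy (spl w) err + energy err err"
    unfolding energy_def int01_cmult[symmetric]
    using bmeas_qform[of "spl w" "spl w"] bmeas_qform[of "spl w" err] bmeas_qform[of err err] bmeas_spl bmeas_err
    by (simp add: int01_add bmeas01_add bmeas01_mult bmeas01_const)
  also have "energy (spl w) err = (\<Sum>i<p * L. w i * ell err i)" by (rule energy_spl[OF bmeas_err])
  also have "\<dots> = 0"
  proof (rule sum.neutral, intro ballI)
    fix i
    show "w i * ell err i = 0"
      using off[of i] gamma_tilde_normal_equations(1)[of i] galerkin_orthogonality[of i] by (cases "i \<in> IS") (auto simp: w_def)
  qed
  finally have "energy (\<lambda>j u. spl \<gamma> j u - \<theta> j u) (\<lambda>j u. spl \<gamma> j u - \<theta> j u) = energy (spl w) (spl w) + energy err err" by simp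
  moreover have "0 \<le> energy (spl w) (spl w)"
  proof -
    have "0 \<le> D1 * lam0 * int01 (\<lambda>u. \<Sum>j<p. (spl w j u)\<^sup>2)"
      using D lam by (intro mult_nonneg_nonneg int01_nonneg sum_nonneg) auto
    then show ?thesis using energy_lower[of "spl w", OF bmeas_spl] by linarith
  qed
  ultimately show ?thesis by simp
qed

lemma L2dist_theta_tilde:
  "L2dist (theta_tilde p m L xi h mu1 mu2 Sig) ths = sqrt (int01 (\<lambda>u. \<Sum>j<p. (err j u)\<^sup>2))"
proof -
  define T where "T = theta_tilde p m L xi h mu1 mu2 Sig"
  have "(T u - ths u) \<bullet> (T u - ths u) = (\<Sum>j<p. (err j u)\<^sup>2)" if u: "u \<in> {0..1}" for u
  proof -
    have tc: "dim_vec (ths u) = p" using dims[OF u] by auto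
    have "T u $ j = spl \<gamma>t j u" if "j < p" for j
    proof -
      have "j * L + k < p * L" if "k < L" for k
      proof -
        have "j * L + k < Suc j * L" using that by simp
        also have "\<dots> \<le> p * L" using \<open>j < p\<close> by (intro mult_le_mono1) simp
        finally show ?thesis .
      qed
      then show ?thesis using that by (simp add: T_def theta_tilde_def Let_def spl_def \<gamma>t_def B_def)
    qed
    then have "(T u - ths u) $ j = err j u" if "j < p" for j using that tc by (simp add: err_def ths_eq[OF u])
    then show ?thesis using tc by (simp add: scalar_prod_def lessThan_atLeast0 power2_eq_square)
  qed
  then have "int01 (\<lambda>u. (T u - ths u) \<bullet> (T u - ths u)) = int01 (\<lambda>u. \<Sum>j<p. (err j u)\<^sup>2)" by (rule int01_cong)
  then show ?thesis by (simp add: L2dist_def int01_def T_def)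
qed

lemma theta_off_support: "j < p \<Longrightarrow> j \<notin> S \<Longrightarrow> u \<in> {0..1} \<Longrightarrow> \<theta> j u = 0"
  using beta_off_support by (simp add: \<theta>_def)

lemma quasi_optimality:
  assumes \<eta>: "0 \<le> \<eta>"
    and g: "\<And>u. u \<in> {0..1} \<Longrightarrow> L2_set (\<lambda>j. \<theta> j u - (\<Sum>i<L. g j i * bspl tk i m u)) S \<le> \<eta>"
  shows "L2dist (theta_tilde p m L xi h mu1 mu2 Sig) ths \<le> sqrt (D2 * (lam1 + M\<^sup>2 / 4) / (D1 * lam0)) * \<eta>"
proof -
  define \<gamma> where "\<gamma> i = (if i \<in> IS then g (i div L) (i mod L) / sqrt (real L) else 0)" for i
  define f where "f j u = spl \<gamma> j u - \<theta> j u" for j u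
  have f_off: "f j u = 0" if "j < p" "j \<notin> S" "u \<in> {0..1}" for j u
  proof -
    have "spl \<gamma> j u = 0" unfolding spl_def
      using that by (intro sum.neutral ballI) (simp add: \<gamma>_def IS_def block_div_mod)
    then show ?thesis using theta_off_support[OF that] by (simp add: f_def)
  qed
  have f_S: "f j u = - (\<theta> j u - (\<Sum>i<L. g j i * bspl tk i m u))" if "j \<in> S" for j u
  proof -
    have jp: "j < p" using that S_subset by auto
    have "\<gamma> (j * L + k) * B k u = g j k * bspl tk k m u" if "k < L" for k
    proof -
      have "j * L + k < Suc j * L" using that by simp
      also have "\<dots> \<le> p * L" using jp by (intro mult_le_mono1) simp
      finally have "j * L + k \<in> IS" using that \<open>j \<in> S\<close> by (simp add: IS_def block_div_mod)
      then show ?thesis using that L_pos by (simp add: \<gamma>_def block_div_mod B_def Bsc_def Bstar_def tk_def)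
    qed
    then show ?thesis by (simp add: f_def spl_def)
  qed
  have "bmeas01 (\<lambda>u. spl \<gamma> j u - \<theta> j u)" if "j < p" for j using that by (intro bmeas01_diff bmeas_spl bmeas_theta)
  then have bf: "bmeas01 (f j)" if "j < p" for j using that by (simp add: f_def[abs_def])
  have "(\<Sum>j<p. (f j u)\<^sup>2) \<le> \<eta>\<^sup>2" if u: "u \<in> {0..1}" for u
  proof -
    have "(\<Sum>j<p. (f j u)\<^sup>2) = (\<Sum>j\<in>S. (f j u)\<^sup>2)" using f_off u by (intro sum_support) auto
    also have "\<dots> = (L2_set (\<lambda>j. f j u) S)\<^sup>2" by (simp add: L2_set_def sum_nonneg)
    also have "L2_set (\<lambda>j. f j u) S = L2_set (\<lambda>j. \<theta> j u - (\<Sum>i<L. g j i * bspl tk i m u)) S"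
      unfolding L2_set_uminus[of "\<lambda>j. \<theta> j u - _ j", symmetric] using f_S by (intro L2_set_cong refl)
    also have "\<dots>\<^sup>2 \<le> \<eta>\<^sup>2" using g[OF u] by (intro power_mono) auto
    finally show ?thesis .
  qed
  then have "int01 (\<lambda>u. \<Sum>j<p. (f j u)\<^sup>2) \<le> int01 (\<lambda>u. \<eta>\<^sup>2)"
    using bf unfolding power2_eq_square by (intro int01_mono bmeas01_const bmeas01_sum bmeas01_mult) auto
  then have fi: "int01 (\<lambda>u. \<Sum>j<p. (f j u)\<^sup>2) \<le> \<eta>\<^sup>2" by (simp add: int01_const)
  have "D1 * lam0 * int01 (\<lambda>u. \<Sum>j<p. (err j u)\<^sup>2) \<le> energy err err" by (rule energy_lower[OF bmeas_err])
  also have "\<dots> \<le> energy f f" using best_approximation[of \<gamma>] by (simp add: \<gamma>_def f_def[abs_def])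
  also have "\<dots> \<le> D2 * (lam1 + M\<^sup>2 / 4) * int01 (\<lambda>u. \<Sum>j<p. (f j u)\<^sup>2)" by (rule energy_upper[OF bf f_off])
  also have "\<dots> \<le> D2 * (lam1 + M\<^sup>2 / 4) * \<eta>\<^sup>2" using fi D lam by (intro mult_left_mono) auto
  finally have "int01 (\<lambda>u. \<Sum>j<p. (err j u)\<^sup>2) \<le> D2 * (lam1 + M\<^sup>2 / 4) / (D1 * lam0) * \<eta>\<^sup>2"
    using D lam by (simp add: field_simps)
  then have "sqrt (int01 (\<lambda>u. \<Sum>j<p. (err j u)\<^sup>2)) \<le> sqrt (D2 * (lam1 + M\<^sup>2 / 4) / (D1 * lam0) * \<eta>\<^sup>2)" by (rule real_sqrt_le_mono)
  also have "\<dots> = sqrt (D2 * (lam1 + M\<^sup>2 / 4) / (D1 * lam0)) * \<eta>" unfolding real_sqrt_mult using \<eta> by simp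
  finally show ?thesis unfolding L2dist_theta_tilde .
qed

lemma locally_polynomial_coords:
  assumes "j < p"
  shows "locally_polynomial m (real t + r) (2 * (\<bar>Dc\<bar> + \<bar>Lc\<bar>)) (\<beta> j)"
    and "locally_polynomial m (real t + r) (2 * (\<bar>Dc\<bar> + \<bar>Lc\<bar>)) (\<delta> j)"
proof -
  let ?K = "\<bar>Dc\<bar> + \<bar>Lc\<bar>"
  have loc: "\<exists>c. \<forall>x\<in>{0..1}. \<bar>f x - (\<Sum>k<m. c k * (x - x0)^k)\<bar> \<le> ?K * \<bar>x - x0\<bar> powr (real t + r)"
    if "holder_class t r Dc Lc f" "x0 \<in> {0..1}" for f x0
    using that r d by (intro holder_local_polynomial)
  show "locally_polynomial m (real t + r) (2 * ?K) (\<beta> j)"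
    unfolding locally_polynomial_def
  proof
    fix x0 :: real assume x0: "x0 \<in> {0..1}"
    obtain c where c: "\<forall>x\<in>{0..1}. \<bar>betastar mu1 mu2 Sig x $ j - (\<Sum>k<m. c k * (x - x0)^k)\<bar> \<le> ?K * \<bar>x - x0\<bar> powr (real t + r)"
      using loc[OF _ x0] holder[OF assms] by blast
    show "\<exists>c. \<forall>x\<in>{0..1}. \<bar>\<beta> j x - (\<Sum>k<m. c k * (x - x0)^k)\<bar> \<le> 2 * ?K * \<bar>x - x0\<bar> powr (real t + r)"
    proof (intro exI[of _ c] ballI)
      fix x :: real assume "x \<in> {0..1}"
      with c have "\<bar>\<beta> j x - (\<Sum>k<m. c k * (x - x0)^k)\<bar> \<le> ?K * \<bar>x - x0\<bar> powr (real t + r)" by (simp add: \<beta>_def)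
      also have "\<dots> \<le> 2 * ?K * \<bar>x - x0\<bar> powr (real t + r)" by (intro mult_right_mono) auto
      finally show "\<bar>\<beta> j x - (\<Sum>k<m. c k * (x - x0)^k)\<bar> \<le> 2 * ?K * \<bar>x - x0\<bar> powr (real t + r)" .
    qed
  qed
  show "locally_polynomial m (real t + r) (2 * ?K) (\<delta> j)"
    unfolding locally_polynomial_def
  proof
    fix x0 :: real assume x0: "x0 \<in> {0..1}"
    obtain c where c: "\<forall>x\<in>{0..1}. \<bar>mu1 x $ j - (\<Sum>k<m. c k * (x - x0)^k)\<bar> \<le> ?K * \<bar>x - x0\<bar> powr (real t + r)"
      using loc[OF _ x0] holder[OF assms] by blast
    obtain c' where c': "\<forall>x\<in>{0..1}. \<bar>mu2 x $ j - (\<Sum>k<m. c' k * (x - x0)^k)\<bar> \<le> ?K * \<bar>x - x0\<bar> powr (real t + r)"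
      using loc[OF _ x0] holder[OF assms] by blast
    show "\<exists>c. \<forall>x\<in>{0..1}. \<bar>\<delta> j x - (\<Sum>k<m. c k * (x - x0)^k)\<bar> \<le> 2 * ?K * \<bar>x - x0\<bar> powr (real t + r)"
    proof (intro exI[of _ "\<lambda>k. c k - c' k"] ballI)
      fix x :: real assume x: "x \<in> {0..1}"
      have "\<delta> j x - (\<Sum>k<m. (c k - c' k) * (x - x0)^k) =
        (mu1 x $ j - (\<Sum>k<m. c k * (x - x0)^k)) - (mu2 x $ j - (\<Sum>k<m. c' k * (x - x0)^k))"
        by (simp add: \<delta>_def left_diff_distrib sum_subtractf)
      also have "\<bar>\<dots>\<bar> \<le> ?K * \<bar>x - x0\<bar> powr (real t + r) + ?K * \<bar>x - x0\<bar> powr (real t + r)"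
        using c[rule_format, OF x] c'[rule_format, OF x] by (rule order_trans[OF abs_triangle_ineq4 add_mono])
      also have "\<dots> = 2 * ?K * \<bar>x - x0\<bar> powr (real t + r)" by simp
      finally show "\<bar>\<delta> j x - (\<Sum>k<m. (c k - c' k) * (x - x0)^k)\<bar> \<le> 2 * ?K * \<bar>x - x0\<bar> powr (real t + r)" .
    qed
  qed
qed

end

theorem theorem3:
  fixes m t :: nat and r lam0 lam1 D1 D2 Dc Lc M cq :: real
  assumes "1 \<le> m"
    and "0 < lam0" and "lam0 \<le> lam1"
    and "0 < D1" and "D1 \<le> D2"
    and "0 \<le> r" and "r \<le> 1" and "1 \<le> real t + r"
    and "real t + r \<le> real m"
  shows "\<exists>C. \<forall>(p :: nat \<Rightarrow> nat) (L :: nat \<Rightarrow> nat) (xi :: nat \<Rightarrow> nat \<Rightarrow> real)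
            (h :: nat \<Rightarrow> real \<Rightarrow> real) (mu1 :: nat \<Rightarrow> real \<Rightarrow> real vec) (mu2 :: nat \<Rightarrow> real \<Rightarrow> real vec)
            (Sig :: nat \<Rightarrow> real \<Rightarrow> real mat) (ths :: nat \<Rightarrow> real \<Rightarrow> real vec).
     (\<forall>n. model_conditions m t r lam0 lam1 D1 D2 Dc Lc M cq (p n) (L n) (xi n) (h n) (mu1 n) (mu2 n) (Sig n) (ths n))
     \<and> filterlim L at_top sequentially
     \<and> (\<lambda>n. real (card (supp (p n) (h n) (mu1 n) (mu2 n) (Sig n))))
          \<in> o(\<lambda>n. real n powr ((2 * (real t + r) - 1) / (4 * ((real t + r) + 1))))
     \<longrightarrow> (\<forall>\<^sub>F n in sequentially.
            L2dist (theta_tilde (p n) m (L n) (xi n) (h n) (mu1 n) (mu2 n) (Sig n)) (ths n)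
            \<le> C * sqrt (real (card (supp (p n) (h n) (mu1 n) (mu2 n) (Sig n))))
                * real (L n) powr (- (real t + r)))"
proof -
  define d where "d = real t + r"
  define K where "K = 2 * (\<bar>Dc\<bar> + \<bar>Lc\<bar>)"
  define M' where "M' = \<bar>M\<bar> + \<bar>M\<bar> / lam0"
  have d: "0 < d" "d \<le> real m" using assms by (auto simp: d_def)
  have K: "0 \<le> K" by (simp add: K_def)
  have M': "0 \<le> M'" using assms by (simp add: M'_def)
  obtain C where C: "0 \<le> C" and appr: "\<forall>(S::nat set) L xi \<beta> \<delta>. quasi_uniform m L cq xi \<longrightarrow> finite S \<longrightarrow> S \<noteq> {} \<longrightarrow>
    (\<forall>j\<in>S. locally_polynomial m d K (\<beta> j)) \<longrightarrow> (\<forall>j\<in>S. locally_polynomial m d K (\<delta> j)) \<longrightarrow>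
    (\<forall>u\<in>{0..1}. L2_set (\<lambda>j. \<beta> j u) S \<le> M' \<and> L2_set (\<lambda>j. \<delta> j u) S \<le> M' \<and> 0 \<le> (\<Sum>j\<in>S. \<delta> j u * \<beta> j u)) \<longrightarrow>
    (\<exists>g. \<forall>u\<in>{0..1}. L2_set (\<lambda>j. \<beta> j u / (4 + (\<Sum>i\<in>S. \<delta> i u * \<beta> i u)) -
        (\<Sum>i<L. g j i * bspl (knots m (L - m) xi) i m u)) S \<le> C * sqrt (real (card S)) * real L powr (- d))"
    using spline_quotient_approximation[OF assms(1) d K M', of cq] by (elim exE conjE) (rule that)
  define Q where "Q = sqrt (D2 * (lam1 + M\<^sup>2 / 4) / (D1 * lam0))"
  have bound: "L2dist (theta_tilde p m L xi h mu1 mu2 Sig) ths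
      \<le> Q * C * sqrt (real (card (supp p h mu1 mu2 Sig))) * real L powr (- d)"
    if mc: "model_conditions m t r lam0 lam1 D1 D2 Dc Lc M cq p L xi h mu1 mu2 Sig ths" for p L xi h mu1 mu2 Sig ths
  proof -
    interpret varying_discriminant m t r lam0 lam1 D1 D2 Dc Lc M cq p L xi h mu1 mu2 Sig ths
      using assms mc by unfold_locales
    define \<eta> where "\<eta> = C * sqrt (real (card S)) * real L powr (- d)"
    have \<eta>: "0 \<le> \<eta>" using C by (simp add: \<eta>_def)
    have "\<exists>g. \<forall>u\<in>{0..1}. L2_set (\<lambda>j. \<theta> j u - (\<Sum>i<L. g j i * bspl tk i m u)) S \<le> \<eta>"
    proof (cases "S = {}")
      case True
      then show ?thesis using \<eta> by simp
    next
      case False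
      have "\<exists>g. \<forall>u\<in>{0..1}. L2_set (\<lambda>j. \<beta> j u / (4 + (\<Sum>i\<in>S. \<delta> i u * \<beta> i u)) -
        (\<Sum>i<L. g j i * bspl (knots m (L - m) xi) i m u)) S \<le> C * sqrt (real (card S)) * real L powr (- d)"
      proof (rule appr[rule_format, OF knots_quasi_uniform S_subset(2) False])
        show "locally_polynomial m d K (\<beta> j)" if "j \<in> S" for j
          using that S_subset locally_polynomial_coords(1) by (auto simp: d_def K_def)
        show "locally_polynomial m d K (\<delta> j)" if "j \<in> S" for j
          using that S_subset locally_polynomial_coords(2) by (auto simp: d_def K_def)
        fix u :: real assume u: "u \<in> {0..1}"
        have "M / lam0 \<le> \<bar>M\<bar> / lam0" "0 \<le> \<bar>M\<bar> / lam0" using assms by (auto intro: divide_right_mono)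
        then have "M / lam0 \<le> M'" "M \<le> M'" unfolding M'_def by linarith+
        then show "L2_set (\<lambda>j. \<beta> j u) S \<le> M' \<and> L2_set (\<lambda>j. \<delta> j u) S \<le> M' \<and> 0 \<le> (\<Sum>j\<in>S. \<delta> j u * \<beta> j u)"
          using beta_norm[OF u] delta_norm[OF u] q_nonneg(1)[OF u] q_support[OF u] by simp
      qed
      then obtain g where "\<forall>u\<in>{0..1}. L2_set (\<lambda>j. \<beta> j u / (4 + (\<Sum>i\<in>S. \<delta> i u * \<beta> i u)) -
        (\<Sum>i<L. g j i * bspl (knots m (L - m) xi) i m u)) S \<le> \<eta>" unfolding \<eta>_def by (rule exE)
      then show ?thesis by (intro exI[of _ g]) (simp add: \<theta>_def q_support tk_def)
    qed
    then obtain g where g: "\<And>u. u \<in> {0..1} \<Longrightarrow> L2_set (\<lambda>j. \<theta> j u - (\<Sum>i<L. g j i * bspl tk i m u)) S \<le> \<eta>" by blast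
    show ?thesis using quasi_optimality[OF \<eta> g] by (simp add: Q_def \<eta>_def S_def mult.assoc)
  qed
  show ?thesis
    unfolding d_def[symmetric]
    by (intro exI[of _ "Q * C"] allI impI always_eventually) (rule bound, blast)
qed

end
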